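(* Let $G$ be the connected, simply connected two-step nilpotent Lie group with Lie algebra isomorphic to $\mathfrak h_1$, with basis $(E_1,\dots,E_7)$ whose only non-zero brackets (up to skew-symmetry) are $[E_1,E_2]=-E_6$, $[E_1,E_3]=-E_7$, and let $M=\Gamma\backslash G$ be any associated nilmanifold ($\Gamma$ a cocompact lattice). For every Riemannian metric on $M$ induced by a left-invariant metric $$g_a=(E^1)^2+\dots+(E^5)^2+a^2(E^6)^2+a^2(E^7)^2,\qquad a\in\mathbb R\setminus\{0\},$$ and the trivial spin structure, the space of harmonic spinors for the spin Dirac operator $D_M$ is even-dimensional. Moreover, there exist non-zero, non-invariant harmonic spinors.
   Context: $(E^1,\dots,E^7)$ is the dual basis of $(E_1,\dots,E_7)$. Orthonormal basis for $g_a$: $e_i=E_i$ for $i\le5$, $e_k=E_k/a$ for $k=6,7$. The Clifford algebra relation is $e_ie_j+e_je_i=-2\delta_{ij}$. Let $\Delta\cong\mathbb C^8$ be the 8-dimensional complex Clifford module of $\mathrm{Cl}^{\mathbb C}(7)\cong\mathrm{End}(\mathbb C^8)\oplus\mathrm{End}(\mathbb C^8)$ given by one summand, chosen so that for each $\mathrm G_2$-structure $\varphi$ there is a unit real spinor $\phi$ with $\varphi(x,y,z)=(xyz\,\phi,\phi)$, where the orientation and 3-form are those of $\varphi_a=e^{123}+e^{145}+e^{167}+e^{246}-e^{257}-e^{356}-e^{347}$ (so $e_1,\dots,e_7$ is oriented). $\Delta$ has a real structure. With the trivial spin structure, the left-invariant frame trivialises the spinor bundle, so that (complex) spinor fields on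 $M$ are $\Gamma$-invariant functions $G\to\Delta$; invariant spinors are the constant ones. The dimension of the space of harmonic spinors is the complex dimension of $\ker D_M$ on complex spinors, equivalently the real dimension of its real form. The Dirac operator is $D_M\phi=\sum_ke_k\nabla^S_{e_k}\phi$, where $\nabla^S$ is the spin connection induced by the Levi-Civita connection, $\nabla^S_{e_i}\phi=\partial_{e_i}\phi+\frac12\sum_{j<k}g(\nabla_{e_i}e_j,e_k)e_je_k\phi$; harmonic spinors are elements of $\ker D_M$.
   Formalization: Existence of non-zero, non-invariant harmonic spinors is proved for every Γ with some a ≠ 0, and for every a ≠ 0 with some Γ; for all pairs (Γ, a) it fails, since for fixed Γ and small |a| all harmonic spinors are invariant. *)

theory Defs
  imports "HOL-Analysis.Analysis" "HOL-Algebra.Coset" "HOL-Library.Function_Algebras"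
begin

text \<open>
  All index sets are the type \<open>7\<close>, whose elements are \<open>1, \<dots>, 7\<close>; in this type \<open>7 = 0\<close>.
\<close>

lemma UNIV_7: "(UNIV :: 7 set) = {1, 2, 3, 4, 5, 6, 7}"
proof -
  have "card {1, 2, 3, 4, 5, 6, 7 :: 7} = CARD(7)"
    by simp
  then show ?thesis
    by (metis card_subset_eq finite subset_UNIV)
qed

lemma forall_7: "(\<forall>i::7. P i) \<longleftrightarrow> P 1 \<and> P 2 \<and> P 3 \<and> P 4 \<and> P 5 \<and> P 6 \<and> P 7"
proof -
  have "(\<forall>i::7. P i) \<longleftrightarrow> (\<forall>i \<in> {1, 2, 3, 4, 5, 6, 7}. P i)"
    unfolding UNIV_7[symmetric] by simp
  then show ?thesis
    by simp
qed


subsection \<open>The Lie algebra and its simply connected Lie group\<close>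

text \<open>
  A vector \<open>x :: real^7\<close> stands for the element with coordinates \<open>x $ i\<close> in the basis
  \<open>E\<^sub>1, \<dots>, E\<^sub>7\<close>, i.e. \<open>E\<^sub>i\<close> is \<open>axis i 1\<close> and \<open>E\<^sup>i(x)\<close> is \<open>x $ i\<close>.
  The bracket has \<open>[E\<^sub>1, E\<^sub>2] = - E\<^sub>6\<close> and \<open>[E\<^sub>1, E\<^sub>3] = - E\<^sub>7\<close>.
\<close>

definition lie_bracket :: "real^7 \<Rightarrow> real^7 \<Rightarrow> real^7" where
  "lie_bracket x y =
     - (x $ 1 * y $ 2 - x $ 2 * y $ 1) *\<^sub>R axis 6 1
     - (x $ 1 * y $ 3 - x $ 3 * y $ 1) *\<^sub>R axis 7 1"

text \<open>
  The exponential map of a simply connected nilpotent Lie group is a diffeomorphism. In exponential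
  coordinates the product is given by the Baker-Campbell-Hausdorff formula, which for a two-step
  nilpotent Lie algebra stops after the first bracket.
\<close>

definition nil_group :: "(real^7) monoid" where
  "nil_group = \<lparr>carrier = UNIV, mult = (\<lambda>x y. x + y + (1/2) *\<^sub>R lie_bracket x y), one = 0\<rparr>"

lemma lie_bracket_nth:
  "lie_bracket x y $ i =
     (if i = 6 then - (x $ 1 * y $ 2 - x $ 2 * y $ 1)
      else if i = 7 then - (x $ 1 * y $ 3 - x $ 3 * y $ 1) else 0)"
  by (simp add: lie_bracket_def axis_def)

lemma bilinear_lie_bracket: "bilinear lie_bracket"
  unfolding bilinear_def
  by (intro allI conjI linearI; simp add: vec_eq_iff lie_bracket_nth algebra_simps)

lemma lie_bracket_two_step: "lie_bracket (lie_bracket x y) z = 0" "lie_bracket x (lie_bracket y z) = 0"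
  by (simp_all add: vec_eq_iff lie_bracket_nth)

lemmas lie_bracket_linear =
  bilinear_ladd[OF bilinear_lie_bracket] bilinear_radd[OF bilinear_lie_bracket]
  bilinear_lmul[OF bilinear_lie_bracket] bilinear_rmul[OF bilinear_lie_bracket]

lemma group_nil_group: "group nil_group"
proof (rule groupI)
  fix x y z
  show "x \<otimes>\<^bsub>nil_group\<^esub> y \<otimes>\<^bsub>nil_group\<^esub> z = x \<otimes>\<^bsub>nil_group\<^esub> (y \<otimes>\<^bsub>nil_group\<^esub> z)"
    by (simp add: nil_group_def lie_bracket_linear lie_bracket_two_step scaleR_add_right)
next
  fix x
  have "(- x) \<otimes>\<^bsub>nil_group\<^esub> x = \<one>\<^bsub>nil_group\<^esub>"
    by (simp add: nil_group_def vec_eq_iff lie_bracket_nth)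
  then show "\<exists>y\<in>carrier nil_group. y \<otimes>\<^bsub>nil_group\<^esub> x = \<one>\<^bsub>nil_group\<^esub>"
    by (intro bexI[of _ "- x"]) (simp_all add: nil_group_def)
qed (simp_all add: nil_group_def vec_eq_iff lie_bracket_nth)

text \<open>
  The points of the nilmanifold are the cosets \<open>\<Gamma> #> x\<close>, and it carries the quotient
  topology: a set of cosets is open iff its preimage in the group is open.
\<close>

definition nilmanifold :: "(real^7) set \<Rightarrow> (real^7) set topology" where
  "nilmanifold \<Gamma> =
     topology (\<lambda>U. U \<subseteq> rcosets\<^bsub>nil_group\<^esub> \<Gamma> \<and> open {x. \<Gamma> #>\<^bsub>nil_group\<^esub> x \<in> U})"

lemma openin_nilmanifold:
  "openin (nilmanifold \<Gamma>) U \<longleftrightarrow>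
     U \<subseteq> rcosets\<^bsub>nil_group\<^esub> \<Gamma> \<and> open {x. \<Gamma> #>\<^bsub>nil_group\<^esub> x \<in> U}"
proof -
  have "istopology (\<lambda>U. U \<subseteq> rcosets\<^bsub>nil_group\<^esub> \<Gamma> \<and> open {x. \<Gamma> #>\<^bsub>nil_group\<^esub> x \<in> U})"
    unfolding istopology_def
  proof (intro conjI allI impI)
    fix S T
    assume "S \<subseteq> rcosets\<^bsub>nil_group\<^esub> \<Gamma> \<and> open {x. \<Gamma> #>\<^bsub>nil_group\<^esub> x \<in> S}"
      and "T \<subseteq> rcosets\<^bsub>nil_group\<^esub> \<Gamma> \<and> open {x. \<Gamma> #>\<^bsub>nil_group\<^esub> x \<in> T}"
    then show "S \<inter> T \<subseteq> rcosets\<^bsub>nil_group\<^esub> \<Gamma>" "open {x. \<Gamma> #>\<^bsub>nil_group\<^esub> x \<in> S \<inter> T}"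
      by (auto simp: Collect_conj_eq)
  next
    fix \<K>
    assume *: "\<forall>K\<in>\<K>. K \<subseteq> rcosets\<^bsub>nil_group\<^esub> \<Gamma> \<and> open {x. \<Gamma> #>\<^bsub>nil_group\<^esub> x \<in> K}"
    then show "\<Union>\<K> \<subseteq> rcosets\<^bsub>nil_group\<^esub> \<Gamma>"
      by blast
    have "{x. \<Gamma> #>\<^bsub>nil_group\<^esub> x \<in> \<Union>\<K>} = (\<Union>K\<in>\<K>. {x. \<Gamma> #>\<^bsub>nil_group\<^esub> x \<in> K})"
      by blast
    then show "open {x. \<Gamma> #>\<^bsub>nil_group\<^esub> x \<in> \<Union>\<K>}"
      using * by auto
  qed
  then show ?thesis
    by (simp add: nilmanifold_def topology_inverse')
qed

definition cocompact_lattice :: "(real^7) set \<Rightarrow> bool" where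
  "cocompact_lattice \<Gamma> \<longleftrightarrow>
     subgroup \<Gamma> nil_group \<and> discrete \<Gamma> \<and> compact_space (nilmanifold \<Gamma>)"


subsection \<open>The left-invariant metrics and their Levi-Civita connections\<close>

text \<open>
  Left-invariant tensors are given by their values on the Lie algebra; a vector of the Lie algebra
  also stands for the left-invariant vector field it generates.
\<close>

definition left_metric :: "real \<Rightarrow> real^7 \<Rightarrow> real^7 \<Rightarrow> real" where
  "left_metric a x y = (\<Sum>i\<in>{1, 2, 3, 4, 5}. x $ i * y $ i) + a\<^sup>2 * (x $ 6 * y $ 6) + a\<^sup>2 * (x $ 7 * y $ 7)"

definition frame :: "real \<Rightarrow> 7 \<Rightarrow> real^7" where
  "frame a i = (if i \<in> {6, 7} then axis i (1 / a) else axis i 1)"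

lemma frame_orthonormal:
  assumes "a \<noteq> 0"
  shows "left_metric a (frame a i) (frame a j) = (if i = j then 1 else 0)"
proof -
  have "\<forall>i j. left_metric a (frame a i) (frame a j) = (if i = j then 1 else 0)"
    unfolding forall_7 using assms
    by (simp add: left_metric_def frame_def axis_def power2_eq_square)
  then show ?thesis
    by blast
qed

text \<open>
  \<open>N x y\<close> is the covariant derivative of the left-invariant field \<open>y\<close> in direction \<open>x\<close>, again a
  left-invariant field. In the metric condition the derivative of the function \<open>left_metric a x y\<close>
  is absent, because the metric is constant on left-invariant fields.
\<close>

definition is_levi_civita :: "real \<Rightarrow> (real^7 \<Rightarrow> real^7 \<Rightarrow> real^7) \<Rightarrow> bool" where
  "is_levi_civita a N \<longleftrightarrow>
     bilinear N \<and>
     (\<forall>x y. N x y - N y x = lie_bracket x y) \<and>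
     (\<forall>x y z. left_metric a (N z x) y + left_metric a x (N z y) = 0)"

definition levi_civita :: "real \<Rightarrow> real^7 \<Rightarrow> real^7 \<Rightarrow> real^7" where
  "levi_civita a = (THE N. is_levi_civita a N)"

lemma left_metric_commute: "left_metric a x y = left_metric a y x"
  by (simp add: left_metric_def mult.commute)

lemma left_metric_diff_left: "left_metric a (x - y) z = left_metric a x z - left_metric a y z"
  by (simp add: left_metric_def algebra_simps)

lemma left_metric_nondegenerate:
  assumes "a \<noteq> 0" and eq: "\<And>z. left_metric a x z = left_metric a y z"
  shows "x = y"
proof -
  have "\<forall>i. x $ i = y $ i"
    unfolding forall_7 using assms(1)
      eq[of "axis 1 1"] eq[of "axis 2 1"] eq[of "axis 3 1"] eq[of "axis 4 1"]
      eq[of "axis 5 1"] eq[of "axis 6 1"] eq[of "axis 7 1"]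
    by (simp add: left_metric_def axis_def)
  then show ?thesis
    by (simp add: vec_eq_iff)
qed

lemma koszul_formula:
  assumes "is_levi_civita a N"
  shows "2 * left_metric a (N x y) z =
    left_metric a (lie_bracket x y) z - left_metric a (lie_bracket y z) x + left_metric a (lie_bracket z x) y"
proof -
  have T: "left_metric a (lie_bracket u v) w = left_metric a (N u v) w - left_metric a (N v u) w" for u v w
    using assms by (simp add: is_levi_civita_def flip: left_metric_diff_left)
  have M: "left_metric a (N w u) v = - left_metric a (N w v) u" for u v w
    using assms unfolding is_levi_civita_def
    by (metis eq_neg_iff_add_eq_0 left_metric_commute)
  show ?thesis
    unfolding T using M[of x y z] M[of y z x] M[of z x y] by simp
qed

lemma ex1_levi_civita:
  assumes "a \<noteq> 0"
  shows "\<exists>!N. is_levi_civita a N"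
proof (rule ex_ex1I)
  define N :: "real^7 \<Rightarrow> real^7 \<Rightarrow> real^7" where
    "N x y = (1/2) *\<^sub>R (lie_bracket x y
       - (a\<^sup>2 * (x $ 2 * y $ 6 + x $ 3 * y $ 7 + y $ 2 * x $ 6 + y $ 3 * x $ 7)) *\<^sub>R axis 1 1
       + (a\<^sup>2 * (x $ 1 * y $ 6 + y $ 1 * x $ 6)) *\<^sub>R axis 2 1
       + (a\<^sup>2 * (x $ 1 * y $ 7 + y $ 1 * x $ 7)) *\<^sub>R axis 3 1)" for x y
  have "bilinear N"
    unfolding bilinear_def
    by (intro allI conjI linearI; simp add: N_def vec_eq_iff lie_bracket_nth axis_def algebra_simps)
  moreover have "\<forall>x y. N x y - N y x = lie_bracket x y"
    by (simp add: N_def vec_eq_iff lie_bracket_nth axis_def algebra_simps)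
  moreover have "\<forall>x y z. left_metric a (N z x) y + left_metric a x (N z y) = 0"
    by (simp add: N_def left_metric_def lie_bracket_nth axis_def algebra_simps)
  ultimately show "\<exists>N. is_levi_civita a N"
    unfolding is_levi_civita_def by blast
next
  fix N N'
  assume "is_levi_civita a N" "is_levi_civita a N'"
  then have "2 * left_metric a (N x y) z = 2 * left_metric a (N' x y) z" for x y z
    by (simp only: koszul_formula)
  then show "N = N'"
    using left_metric_nondegenerate[OF assms] by (metis ext mult_cancel_left zero_neq_numeral)
qed

lemma is_levi_civita_levi_civita: "a \<noteq> 0 \<Longrightarrow> is_levi_civita a (levi_civita a)"
  unfolding levi_civita_def using theI'[OF ex1_levi_civita] .


subsection \<open>The Clifford module\<close>

definition hermitian :: "complex^8 \<Rightarrow> complex^8 \<Rightarrow> complex" where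
  "hermitian s t = (\<Sum>i\<in>UNIV. s $ i * cnj (t $ i))"

definition real_structure :: "(complex^8 \<Rightarrow> complex^8) \<Rightarrow> bool" where
  "real_structure \<sigma> \<longleftrightarrow>
     (\<forall>s t. \<sigma> (s + t) = \<sigma> s + \<sigma> t) \<and> (\<forall>c s. \<sigma> (c *s s) = cnj c *s \<sigma> s) \<and>
     (\<forall>s. \<sigma> (\<sigma> s) = s) \<and> (\<forall>s t. hermitian (\<sigma> s) (\<sigma> t) = cnj (hermitian s t))"

definition wedge3 :: "7 \<Rightarrow> 7 \<Rightarrow> 7 \<Rightarrow> real^7 \<Rightarrow> real^7 \<Rightarrow> real^7 \<Rightarrow> real" where
  "wedge3 i j k x y z =
     det (vector [vector [x $ i, x $ j, x $ k],
                  vector [y $ i, y $ j, y $ k],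
                  vector [z $ i, z $ j, z $ k]] :: real^3^3)"

text \<open>Here and in \<open>spinor_module\<close>, the coordinates of \<open>real^7\<close> are those with respect to
  the orthonormal frame \<open>e\<^sub>1, \<dots>, e\<^sub>7\<close>, which identifies every tangent space with Euclidean space.\<close>

definition g2_form :: "real^7 \<Rightarrow> real^7 \<Rightarrow> real^7 \<Rightarrow> real" where
  "g2_form x y z =
     wedge3 1 2 3 x y z + wedge3 1 4 5 x y z + wedge3 1 6 7 x y z + wedge3 2 4 6 x y z
     - wedge3 2 5 7 x y z - wedge3 3 5 6 x y z - wedge3 3 4 7 x y z"

text \<open>
  \<open>cl x\<close> is Clifford multiplication by \<open>x\<close>. A complex module of dimension 8 is one of the two
  irreducible ones; the last condition, on the spinor \<open>\<phi>\<close>, selects the summand.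
\<close>

definition spinor_module :: "(real^7 \<Rightarrow> complex^8^8) \<Rightarrow> (complex^8 \<Rightarrow> complex^8) \<Rightarrow> bool" where
  "spinor_module cl \<sigma> \<longleftrightarrow>
     linear cl \<and>
     (\<forall>x y. cl x ** cl y + cl y ** cl x = mat (of_real (- 2 * (x \<bullet> y)))) \<and>
     (\<forall>x s t. hermitian (cl x *v s) t = - hermitian s (cl x *v t)) \<and>
     real_structure \<sigma> \<and>
     (\<forall>x s. \<sigma> (cl x *v s) = cl x *v \<sigma> s) \<and>
     (\<exists>\<phi>. \<sigma> \<phi> = \<phi> \<and> hermitian \<phi> \<phi> = 1 \<and>
        (\<forall>x y z. hermitian (cl x *v (cl y *v (cl z *v \<phi>))) \<phi> = of_real (g2_form x y z)))"


subsection \<open>Spinor fields and the Dirac operator\<close>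

fun times_cont_diff :: "nat \<Rightarrow> ('a::euclidean_space \<Rightarrow> 'b::real_normed_vector) \<Rightarrow> bool" where
  "times_cont_diff 0 f \<longleftrightarrow> continuous_on UNIV f"
| "times_cont_diff (Suc n) f \<longleftrightarrow>
     (\<forall>x. f differentiable (at x)) \<and>
     (\<forall>v. times_cont_diff n (\<lambda>x. frechet_derivative f (at x) v))"

definition smooth :: "('a::euclidean_space \<Rightarrow> 'b::real_normed_vector) \<Rightarrow> bool" where
  "smooth f \<longleftrightarrow> (\<forall>n. times_cont_diff n f)"

text \<open>
  The left-invariant vector field generated by \<open>v\<close>, acting on functions: in exponential
  coordinates \<open>t *\<^sub>R v\<close> is the one-parameter group of \<open>v\<close>.
\<close>

definition left_deriv :: "real^7 \<Rightarrow> (real^7 \<Rightarrow> complex^8) \<Rightarrow> real^7 \<Rightarrow> complex^8" where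
  "left_deriv v \<psi> x = vector_derivative (\<lambda>t. \<psi> (x \<otimes>\<^bsub>nil_group\<^esub> (t *\<^sub>R v))) (at 0)"

text \<open>
  The spin covariant derivative along \<open>e\<^sub>i\<close>. The order of the type \<open>7\<close> puts \<open>7 = 0\<close> first;
  this is immaterial, since the summand is symmetric in \<open>j\<close> and \<open>k\<close> for \<open>j \<noteq> k\<close>.
\<close>

definition spin_connection ::
  "(real^7 \<Rightarrow> complex^8^8) \<Rightarrow> real \<Rightarrow> 7 \<Rightarrow> (real^7 \<Rightarrow> complex^8) \<Rightarrow> real^7 \<Rightarrow> complex^8" where
  "spin_connection cl a i \<psi> x =
     left_deriv (frame a i) \<psi> x +
     (1/2) *\<^sub>R (\<Sum>(j, k)\<in>{(j, k). j < k}.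
        left_metric a (levi_civita a (frame a i) (frame a j)) (frame a k) *\<^sub>R
          (cl (axis j 1) *v (cl (axis k 1) *v \<psi> x)))"

definition dirac ::
  "(real^7 \<Rightarrow> complex^8^8) \<Rightarrow> real \<Rightarrow> (real^7 \<Rightarrow> complex^8) \<Rightarrow> real^7 \<Rightarrow> complex^8" where
  "dirac cl a \<psi> x = (\<Sum>i\<in>UNIV. cl (axis i 1) *v spin_connection cl a i \<psi> x)"

definition harmonic_spinors ::
  "(real^7 \<Rightarrow> complex^8^8) \<Rightarrow> real \<Rightarrow> (real^7) set \<Rightarrow> (real^7 \<Rightarrow> complex^8) set" where
  "harmonic_spinors cl a \<Gamma> =
     {\<psi>. smooth \<psi> \<and> (\<forall>\<gamma>\<in>\<Gamma>. \<forall>x. \<psi> (\<gamma> \<otimes>\<^bsub>nil_group\<^esub> x) = \<psi> x) \<and> (\<forall>x. dirac cl a \<psi> x = 0)}"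

definition invariant_spinor :: "(real^7 \<Rightarrow> complex^8) \<Rightarrow> bool" where
  "invariant_spinor \<psi> \<longleftrightarrow> (\<exists>s. \<forall>x. \<psi> x = s)"

definition spinor_scale :: "complex \<Rightarrow> (real^7 \<Rightarrow> complex^8) \<Rightarrow> real^7 \<Rightarrow> complex^8" where
  "spinor_scale c \<psi> = (\<lambda>x. c *s \<psi> x)"

interpretation spinor_fields: vector_space spinor_scale
  by unfold_locales
    (simp_all add: spinor_scale_def fun_eq_iff vec_eq_iff algebra_simps)

text \<open>In particular the space is finite-dimensional.\<close>

definition even_dimensional :: "(real^7 \<Rightarrow> complex^8) set \<Rightarrow> bool" where
  "even_dimensional V \<longleftrightarrow>
     (\<exists>B. finite B \<and> spinor_fields.independent B \<and> spinor_fields.span B = V \<and> even (card B))"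

end

theory Submission
  imports Defs "Jordan_Normal_Form.Char_Poly"
begin

text \<open>
  In terms of the left-invariant fields \<open>X\<^sub>i\<close> of the orthonormal frame, the Dirac operator is
  \<open>D = \<Sum> e\<^sub>i X\<^sub>i - (a/4) \<omega>\<close> with \<open>\<omega> = e\<^sub>1 e\<^sub>2 e\<^sub>6 + e\<^sub>1 e\<^sub>3 e\<^sub>7\<close>.

  Finite dimension: \<open>D \<psi> = 0\<close> expresses \<open>\<Sum> X\<^sub>i X\<^sub>i \<psi>\<close> through first derivatives, so Bernstein's
  maximum principle bounds the gradient of a harmonic spinor by its maximum; a harmonic spinor is
  then determined by its values on a sufficiently fine finite net.

  Parity: the central derivative \<open>T = X\<^sub>4\<close> acts on the kernel of \<open>D\<close> and commutes with the real structure.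
  A real operator without real eigenvalues lives in even dimension. On the kernel of \<open>T\<close> this applies
  to \<open>e\<^sub>4\<close>, which preserves harmonicity there and has square \<open>-1\<close>; on the image of \<open>T\<close> it applies to \<open>T\<close>
  itself, whose real eigenvalues are excluded by looking at a maximum. No integration is needed.

  Existence: on \<open>exp(i \<langle>x, \<cdot>\<rangle>) s\<close> with \<open>x\<close> in the span of the first three coordinates, \<open>D\<close> acts by an
  endomorphism that is singular iff \<open>\<bar>x\<bar>\<^sup>2 = \<plusminus> (a/2) x\<^sub>1\<close>. For given \<open>a\<close> one chooses a lattice with a suitable
  dual vector \<open>x\<close>. For a given lattice the projection to the first three coordinates is discrete, because
  commutators detect it, so a dual vector with \<open>x\<^sub>1 \<noteq> 0\<close> exists and determines \<open>a\<close>.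
\<close>

text \<open>What shapes the parity argument is that multiplication by \<open>e 4\<close>
  anticommutes with every term of the Dirac operator except the one containing \<open>e 4\<close>
  itself. So it acts on the harmonic spinors only where the derivative along it vanishes, which
  forces the split by rank and nullity of \<open>T4\<close>. The image of \<open>T4\<close> is not
  known to be complementary to its kernel; on the image the eigenvalue 0 must therefore be excluded
  together with the nonzero real ones. The real structure turns the absence of real eigenvalues into
  parity: a complex operator on a nonzero space always has eigenvalues, but one that commutes with
  \<sigma> has a real matrix in a basis fixed by \<sigma>, and a real matrix of odd size has a real
  eigenvalue. The gradient bound must be uniform over all harmonic spinors, so that a single finite
  net serves them all. Hence the operators and constants in it are fixed before the spinor is. In
  the plane wave, the circle of singular covectors is a completed square: with \<mu> = -a/4, the
  condition says that (x1 - \<mu>, x2, x3) has length |\<mu>|.\<close>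

text \<open>The matrix library reuses names and symbols of \<open>HOL-Analysis\<close>.\<close>

no_notation vec_index (infixl "$" 100) and scalar_prod (infix "\<bullet>" 70)
hide_const (open) Matrix.mat Matrix.vec Matrix.orthogonal
hide_fact (open) Matrix.vec_eq_iff Matrix.mat_def Matrix.orthogonal_def


subsection \<open>Linear algebra\<close>

lemma real_poly_odd_degree_root:
  fixes p :: "real poly"
  assumes "odd (degree p)" "lead_coeff p = 1"
  shows "\<exists>x. poly p x = 0"
proof -
  obtain b where b: "\<And>x. x \<ge> b \<Longrightarrow> poly p x \<ge> 1"
    using poly_pinfty_gt_lc[of p] assms(2) by auto
  \<comment> \<open>This is -p(-x), which is again monic because the degree is odd. Its positivity
    for large arguments is the negativity of \<open>p\<close> far to the left.\<close>
  define q where "q = - pcompose p [:0, -1:]"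
  have "lead_coeff (pcompose p [:0, -1:]) = - 1"
    using lead_coeff_comp[of "[:0, -1:]" p] assms by simp
  then have "lead_coeff q = 1"
    unfolding q_def by (simp add: lead_coeff_minus)
  then obtain c where c: "\<And>x. x \<ge> c \<Longrightarrow> poly q x \<ge> 1"
    using poly_pinfty_gt_lc[of q] by auto
  define m where "m = \<bar>b\<bar> + \<bar>c\<bar> + 1"
  have m: "b \<le> m" "c \<le> m" "- m < m"
    unfolding m_def by linarith+
  have "poly p m > 0"
    using b[OF m(1)] by simp
  moreover have "poly p (- m) < 0"
    using c[OF m(2)] by (simp add: q_def poly_pcompose)
  moreover note m(3)
  ultimately show ?thesis
    using poly_IVT_pos by blast
qed

text \<open>The characteristic polynomial is monic of odd degree and so has a real root. The entries
  form a function on naturals because the size \<open>n\<close> will be the dimension of a space,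
  known only inside a proof.\<close>

lemma odd_matrix_real_eigenvalue:
  fixes c :: "nat \<Rightarrow> nat \<Rightarrow> real"
  assumes "odd n"
  obtains x r where "\<exists>j<n. x j \<noteq> 0" "\<And>i. i < n \<Longrightarrow> (\<Sum>j<n. c i j * x j) = r * x i"
proof -
  define A where "A = Matrix.mat n n (\<lambda>(i, j). c i j)"
  have A: "A \<in> carrier_mat n n"
    by (simp add: A_def)
  have "degree (char_poly A) = n" "lead_coeff (char_poly A) = 1"
    using degree_monic_char_poly[OF A] by auto
  then obtain r where "poly (char_poly A) r = 0"
    using real_poly_odd_degree_root assms by metis
  then obtain v where v: "eigenvector A v r"
    using eigenvalue_root_char_poly[OF A] unfolding eigenvalue_def by blast
  then have v: "v \<in> carrier_vec n" "v \<noteq> 0\<^sub>v n" "A *\<^sub>v v = r \<cdot>\<^sub>v v"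
    using A unfolding eigenvector_def by auto
  show thesis
  proof (rule that)
    show "\<exists>j<n. vec_index v j \<noteq> 0"
      using v(1,2) by (metis carrier_vecD eq_vecI index_zero_vec)
    fix i assume i: "i < n"
    have "(\<Sum>j<n. c i j * vec_index v j) = vec_index (A *\<^sub>v v) i"
      using i v(1) by (simp add: A_def scalar_prod_def lessThan_atLeast0)
    also have "\<dots> = r * vec_index v i"
      using i v(1) by (simp add: v(3))
    finally show "(\<Sum>j<n. c i j * vec_index v j) = r * vec_index v i" .
  qed
qed

context vector_space
begin

text \<open>\<open>T\<close> is assumed linear on \<open>V\<close> only: it is meant to be a
  derivative, which is additive on differentiable functions. A basis \<open>B0\<close> of the kernel
  is extended to a basis \<open>B\<close> of \<open>V\<close>; the images of the added vectors form
  a basis of the image.\<close>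

lemma rank_nullity_on:
  assumes V: "subspace V" and C: "finite C" "V \<subseteq> span C"
    and add: "\<And>f g. f \<in> V \<Longrightarrow> g \<in> V \<Longrightarrow> T (f + g) = T f + T g"
    and sc: "\<And>c f. f \<in> V \<Longrightarrow> T (scale c f) = scale c (T f)"
  shows "dim V = dim {f \<in> V. T f = 0} + dim (T ` V)"
proof -
  let ?N = "{f \<in> V. T f = 0}"
  obtain B0 where B0: "B0 \<subseteq> ?N" "independent B0" "?N \<subseteq> span B0" "card B0 = dim ?N"
    using basis_exists by blast
  obtain B where B: "B0 \<subseteq> B" "B \<subseteq> V" "independent B" "V \<subseteq> span B"
    using maximal_independent_subset_extend[of B0 V] B0(1,2) by blast
  have "finite B"
    using independent_span_bound[OF C(1) B(3)] B(2) C(2) by blast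
  then have fin: "finite B" "finite B0" "finite (B - B0)"
    using B(1) finite_subset by auto
  let ?E = "B - B0"
  have T0: "T 0 = 0"
    using sc[of 0 0] V subspace_0 by simp
  have inV: "(\<Sum>v\<in>F. scale (u v) v) \<in> V" if "F \<subseteq> B" for F u
    using that B(2) by (intro subspace_sum[OF V] subspace_scale[OF V]) auto
  have T_sum: "T (\<Sum>v\<in>F. scale (u v) v) = (\<Sum>v\<in>F. scale (u v) (T v))" if "F \<subseteq> B" for F u
    using finite_subset[OF that fin(1)] that
  proof (induction F rule: finite_induct)
    case (insert v F)
    then have "v \<in> V" "(\<Sum>v\<in>F. scale (u v) v) \<in> V"
      using inV B(2) by auto
    then show ?case
      using insert by (simp add: add sc subspace_scale[OF V])
  qed (simp add: T0)
  have key: "u v = 0" if "(\<Sum>v\<in>?E. scale (u v) (T v)) = 0" "v \<in> ?E" for u v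
  proof -
    let ?x = "\<Sum>v\<in>?E. scale (u v) v"
    have "?x \<in> ?N"
      using inV[of ?E u] T_sum[of ?E u] that(1) by auto
    then have "?x \<in> span B0"
      using B0(3) by blast
    then obtain c where c: "?x = (\<Sum>w\<in>B0. scale (c w) w)"
      unfolding span_finite[OF fin(2)] by blast
    \<comment> \<open>The vector \<open>?x\<close> has one expansion in \<open>B0\<close> and one in
      \<open>?E\<close>. Their difference, with coefficients \<open>d\<close>, is a vanishing
      combination of the independent set \<open>B\<close>.\<close>
    define d where "d w = (if w \<in> B0 then - c w else u w)" for w
    have "(\<Sum>w\<in>B. scale (d w) w) = (\<Sum>w\<in>B0. scale (d w) w) + (\<Sum>w\<in>?E. scale (d w) w)"
      using sum.subset_diff[OF B(1) fin(1)] by (simp add: add.commute)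
    also have "(\<Sum>w\<in>B0. scale (d w) w) = - ?x"
      unfolding c by (simp add: d_def sum_negf)
    also have "(\<Sum>w\<in>?E. scale (d w) w) = ?x"
      by (rule sum.cong) (auto simp: d_def)
    finally have "(\<Sum>w\<in>B. scale (d w) w) = 0" by simp
    then have "d v = 0"
      using independentD[OF B(3) fin(1) order_refl] that(2) by blast
    then show ?thesis
      using that(2) by (simp add: d_def)
  qed
  have inj: "inj_on T ?E"
  proof (rule inj_onI, rule ccontr)
    fix v v' assume v: "v \<in> ?E" "v' \<in> ?E" "T v = T v'" "v \<noteq> v'"
    let ?u = "\<lambda>w. (if w = v then 1 else 0) - (if w = v' then 1 else 0)"
    have "(\<Sum>w\<in>?E. scale (?u w) (T w)) =
        (\<Sum>w\<in>?E. if w = v then T w else 0) - (\<Sum>w\<in>?E. if w = v' then T w else 0)"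
      unfolding scale_left_diff_distrib sum_subtractf
      by (intro arg_cong2[where f = minus] sum.cong) auto
    also have "\<dots> = 0"
      using v fin(3) by simp
    finally show False
      using key[of ?u v] v by simp
  qed
  have "independent (T ` ?E)"
  proof (rule independent_if_scalars_zero)
    fix u y assume "(\<Sum>y\<in>T ` ?E. scale (u y) y) = 0" "y \<in> T ` ?E"
    then show "u y = 0"
      using key[of "\<lambda>v. u (T v)"] by (auto simp: sum.reindex[OF inj])
  qed (use fin in auto)
  moreover have "T ` V \<subseteq> span (T ` ?E)"
  proof
    fix y assume "y \<in> T ` V"
    then obtain f where f: "f \<in> V" "y = T f" by blast
    then obtain c where c: "f = (\<Sum>w\<in>B. scale (c w) w)"
      using B(4) unfolding span_finite[OF fin(1)] by blast
    have "y = (\<Sum>w\<in>B. scale (c w) (T w))"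
      unfolding f(2) c by (rule T_sum) simp
    also have "\<dots> = (\<Sum>w\<in>?E. scale (c w) (T w))"
      using B0(1) by (intro sum.mono_neutral_right fin) auto
    finally show "y \<in> span (T ` ?E)"
      by (simp only:) (intro span_sum span_scale span_base imageI)
  qed
  moreover have "T ` ?E \<subseteq> T ` V"
    using B(2) by blast
  ultimately have "card (T ` ?E) = dim (T ` V)"
    by (intro basis_card_eq_dim)
  moreover have "card B = card B0 + card ?E"
    using card_Diff_subset[OF fin(2) B(1)] card_mono[OF fin(1) B(1)] by simp
  moreover have "card B = dim V"
    using B by (intro basis_card_eq_dim)
  ultimately show ?thesis
    using B0(4) card_image[OF inj] by simp
qed

end

text \<open>A real structure \<open>S\<close> commuting with \<open>T\<close> turns \<open>T\<close> into a real matrix, which has a real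
  eigenvalue in odd dimension.\<close>

lemma even_dim_of_no_real_eigenvalue:
  fixes scale :: "complex \<Rightarrow> 'b::ab_group_add \<Rightarrow> 'b"
  assumes "vector_space scale"
    and V: "module.subspace scale V" and C: "finite C" "V \<subseteq> module.span scale C"
    and add: "\<And>f g. f \<in> V \<Longrightarrow> g \<in> V \<Longrightarrow> T (f + g) = T f + T g"
    and sc: "\<And>c f. f \<in> V \<Longrightarrow> T (scale c f) = scale c (T f)"
    and TV: "\<And>f. f \<in> V \<Longrightarrow> T f \<in> V"
    and S_add: "\<And>f g. S (f + g) = S f + S g"
    and S_sc: "\<And>c f. S (scale c f) = scale (cnj c) (S f)"
    and S_S: "\<And>f. S (S f) = f"
    and SV: "\<And>f. f \<in> V \<Longrightarrow> S f \<in> V"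
    and TS: "\<And>f. f \<in> V \<Longrightarrow> T (S f) = S (T f)"
    and no_eigenvalue: "\<And>f r. f \<in> V \<Longrightarrow> T f = scale (of_real r) f \<Longrightarrow> f = 0"
  shows "even (vector_space.dim scale V)"
proof (rule ccontr)
  interpret vector_space scale by fact
  define R where "R = {f \<in> V. S f = f}"
  \<comment> \<open>\<open>R\<close> is only a real subspace, but \<open>D\<close> is independent
    over the complex numbers. Every \<open>f\<close> is a complex combination of its real and
    imaginary parts, which lie in \<open>R\<close>, so \<open>D\<close> is a complex basis of
    \<open>V\<close> made of vectors fixed by \<open>S\<close>.\<close>
  obtain D where D: "D \<subseteq> R" "independent D" "R \<subseteq> span D"
    using maximal_independent_subset by blast
  have S_diff: "S (f - g) = S f - S g" for f g
    using S_add[of "f - g" g] by (simp add: algebra_simps)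
  have "V \<subseteq> span D"
  proof
    fix f assume f: "f \<in> V"
    have 1: "scale (1/2) (f + S f) \<in> R"
      using f unfolding R_def by (simp add: subspace_scale subspace_add V SV S_sc S_add S_S add.commute)
    have 2: "scale (- \<i> / 2) (f - S f) \<in> R"
    proof -
      have "S (scale (- \<i> / 2) (f - S f)) = scale (\<i> / 2) (S f - f)"
        unfolding S_sc S_diff S_S by simp
      also have "\<dots> = scale (- \<i> / 2) (f - S f)"
        by (metis minus_diff_eq minus_divide_left scale_minus_left scale_minus_right)
      finally show ?thesis
        using f unfolding R_def by (simp add: subspace_scale subspace_diff V SV del: scale_minus_left)
    qed
    have "scale (1/2) (f + S f) + scale \<i> (scale (- \<i> / 2) (f - S f)) \<in> span D"
      by (rule span_add[OF subsetD[OF D(3) 1] span_scale[OF subsetD[OF D(3) 2]]])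
    moreover have "scale (1/2) (f + S f) + scale \<i> (scale (- \<i> / 2) (f - S f)) = f"
    proof -
      have "scale (1/2) (f + S f) + scale \<i> (scale (- \<i> / 2) (f - S f)) = scale (1/2) (f + S f) + scale (1/2) (f - S f)"
        by simp
      also have "\<dots> = scale (1/2) f + scale (1/2) f"
        by (simp add: scale_right_distrib scale_right_diff_distrib)
      also have "\<dots> = f"
        by (simp flip: scale_left_distrib)
      finally show ?thesis .
    qed
    ultimately show "f \<in> span D" by simp
  qed
  have DV: "D \<subseteq> V"
    using D(1) by (auto simp: R_def)
  have fin: "finite D"
    using independent_span_bound[OF C(1) D(2)] DV C(2) by blast
  define n where "n = card D"
  have "dim V = n"
    unfolding n_def using DV \<open>V \<subseteq> span D\<close> D(2) by (intro basis_card_eq_dim[symmetric])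
  assume "odd (dim V)"
  then have n: "odd n"
    using \<open>dim V = n\<close> by simp
  obtain b where b: "bij_betw b {..<n} D"
    using ex_bij_betw_nat_finite[OF fin] unfolding n_def by (auto simp: lessThan_atLeast0)
  have bV: "b i \<in> V" "S (b i) = b i" if "i < n" for i
    using bij_betwE[OF b] that D(1) by (auto simp: R_def)
  have indep: "u i = 0" if "(\<Sum>i<n. scale (u i) (b i)) = 0" "i < n" for u i
  proof -
    have inj: "inj_on b {..<n}" and im: "b ` {..<n} = D"
      using b by (auto simp: bij_betw_def)
    define w where "w = u \<circ> the_inv_into {..<n} b"
    have w: "w (b i) = u i" if "i < n" for i
      using that the_inv_into_f_f[OF inj] by (simp add: w_def)
    have "(\<Sum>d\<in>D. scale (w d) d) = (\<Sum>i<n. scale (w (b i)) (b i))"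
      unfolding im[symmetric] by (simp add: sum.reindex[OF inj])
    also have "\<dots> = 0"
      using that(1) w by simp
    finally have "w (b i) = 0"
      using independentD[OF D(2) fin order_refl] bij_betwE[OF b] that(2) by blast
    then show ?thesis
      using w that(2) by simp
  qed
  have "\<exists>u. T (b j) = (\<Sum>i<n. scale (u i) (b i))" if "j < n" for j
  proof -
    have "T (b j) \<in> span D"
      using TV bV(1)[OF that] \<open>V \<subseteq> span D\<close> by blast
    then obtain w where "T (b j) = (\<Sum>d\<in>D. scale (w d) d)"
      unfolding span_finite[OF fin] by blast
    also have "\<dots> = (\<Sum>i<n. scale (w (b i)) (b i))"
      by (rule sum.reindex_bij_betw[OF b, symmetric])
    finally show ?thesis by (intro exI[of _ "\<lambda>i. w (b i)"])
  qed
  then obtain c where c: "\<And>j. j < n \<Longrightarrow> T (b j) = (\<Sum>i<n. scale (c j i) (b i))"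
    by metis
  have S_0: "S 0 = 0"
    using S_add[of 0 0] by simp
  have S_sum: "S (\<Sum>i\<in>F. g i) = (\<Sum>i\<in>F. S (g i))" for F and g :: "nat \<Rightarrow> 'b"
    by (induction F rule: infinite_finite_induct) (auto simp: S_0 S_add)
  \<comment> \<open>\<open>S\<close> fixes the basis and conjugates coefficients, while
    \<open>T (b j)\<close> is itself fixed by \<open>S\<close>; comparing coefficients shows that
    they are real.\<close>
  have real: "c j i = of_real (Re (c j i))" if "i < n" "j < n" for i j
  proof -
    have "S (T (b j)) = (\<Sum>i<n. scale (cnj (c j i)) (b i))"
      unfolding c[OF that(2)] S_sum S_sc using bV(2) by simp
    moreover have "S (T (b j)) = T (b j)"
      using TS[OF bV(1)] bV(2) that(2) by simp
    ultimately have "(\<Sum>i<n. scale (cnj (c j i) - c j i) (b i)) = 0"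
      unfolding scale_left_diff_distrib sum_subtractf c[OF that(2)] by simp
    then have "cnj (c j i) - c j i = 0"
      using indep[of "\<lambda>i. cnj (c j i) - c j i"] that(1) by simp
    then show ?thesis
      by (simp add: complex_eq_iff)
  qed
  \<comment> \<open>The coefficient of \<open>b i\<close> in \<open>T (b j)\<close> is
    \<open>c j i\<close>, so the matrix acting on coordinate vectors is the transpose of
    \<open>c\<close>.\<close>
  obtain x r where x: "\<exists>j<n. x j \<noteq> 0" "\<And>i. i < n \<Longrightarrow> (\<Sum>j<n. Re (c j i) * x j) = r * x i"
    using odd_matrix_real_eigenvalue[OF n, of "\<lambda>i j. Re (c j i)"] by metis
  define f where "f = (\<Sum>j<n. scale (of_real (x j)) (b j))"
  have partial: "(\<Sum>j\<in>F. scale (of_real (x j)) (b j)) \<in> V" if "F \<subseteq> {..<n}" for F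
    using that bV(1) by (intro subspace_sum[OF V] subspace_scale[OF V]) auto
  have T0: "T 0 = 0"
    using sc[of 0 0] V subspace_0 by simp
  have "T (\<Sum>j\<in>F. scale (of_real (x j)) (b j)) = (\<Sum>j\<in>F. scale (of_real (x j)) (T (b j)))" if "F \<subseteq> {..<n}" for F
    using finite_subset[OF that finite_lessThan] that
  proof (induction F rule: finite_induct)
    case (insert j F)
    then show ?case
      using bV(1) partial[of F] by (simp add: add sc subspace_scale[OF V])
  qed (simp add: T0)
  then have "T f = (\<Sum>j<n. scale (of_real (x j)) (T (b j)))"
    unfolding f_def by blast
  also have "\<dots> = (\<Sum>j<n. \<Sum>i<n. scale (of_real (x j) * c j i) (b i))"
    by (simp add: c scale_sum_right)
  also have "\<dots> = (\<Sum>i<n. \<Sum>j<n. scale (of_real (x j) * c j i) (b i))"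
    by (rule sum.swap)
  also have "\<dots> = (\<Sum>i<n. scale (of_real r * of_real (x i)) (b i))"
  proof (rule sum.cong[OF refl])
    fix i assume "i \<in> {..<n}"
    then have i: "i < n" by simp
    have "(\<Sum>j<n. of_real (x j) * c j i) = (\<Sum>j<n. complex_of_real (Re (c j i) * x j))"
      by (intro sum.cong refl) (subst real[OF i], auto)
    also have "\<dots> = complex_of_real (r * x i)"
      unfolding of_real_sum[symmetric] x(2)[OF i] ..
    finally show "(\<Sum>j<n. scale (of_real (x j) * c j i) (b i)) = scale (of_real r * of_real (x i)) (b i)"
      by (simp flip: scale_sum_left)
  qed
  also have "\<dots> = scale (of_real r) f"
    by (simp add: f_def scale_sum_right)
  finally have "f = 0"
    using no_eigenvalue[of f r] partial[of "{..<n}"] by (simp add: f_def)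
  then have "of_real (x j) = (0::complex)" if "j < n" for j
    using indep[of "\<lambda>j. of_real (x j)"] that by (simp add: f_def)
  then show False
    using x(1) by auto
qed


subsection \<open>Smooth functions and left-invariant vector fields\<close>

text \<open>It suffices to name a class of differentiable functions closed under directional
  derivatives. The closure properties below then need no induction on the order of differentiation;
  the work lies in choosing a large enough class.\<close>

lemma smooth_coinduct:
  assumes "P f"
    and "\<And>f x. P f \<Longrightarrow> f differentiable (at x)"
    and "\<And>f v. P f \<Longrightarrow> P (\<lambda>x. frechet_derivative f (at x) v)"
  shows "smooth f"
proof -
  have "P f \<Longrightarrow> times_cont_diff n f" for n f
  proof (induction n arbitrary: f)
    case 0
    then show ?case
      using assms(2) by (simp add: continuous_at_imp_continuous_on differentiable_imp_continuous_within)
  next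
    case (Suc n)
    then show ?case using assms(2,3) by simp
  qed
  then show ?thesis using assms(1) by (simp add: smooth_def)
qed

lemma smooth_differentiable: "smooth f \<Longrightarrow> f differentiable (at x)"
  unfolding smooth_def by (metis times_cont_diff.simps(2))

lemma smooth_frechet_derivative: "smooth f \<Longrightarrow> smooth (\<lambda>x. frechet_derivative f (at x) v)"
  unfolding smooth_def by (metis times_cont_diff.simps(2))

lemma smooth_has_derivative: "smooth f \<Longrightarrow> (f has_derivative frechet_derivative f (at x)) (at x)"
  using frechet_derivative_works smooth_differentiable by blast

lemma smooth_continuous_on: "smooth f \<Longrightarrow> continuous_on S f"
  by (meson continuous_on_subset smooth_def subset_UNIV times_cont_diff.simps(1))

lemma frechet_derivative_eqI: "(f has_derivative f') (at x) \<Longrightarrow> frechet_derivative f (at x) = f'"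
  using frechet_derivative_at by metis

lemma smooth_linear_frechet: "smooth f \<Longrightarrow> linear (frechet_derivative f (at x))"
  by (simp add: linear_frechet_derivative smooth_differentiable)

lemma smooth_add:
  assumes "smooth f" "smooth g"
  shows "smooth (\<lambda>x. f x + g x)"
proof (rule smooth_coinduct[where P = "\<lambda>h. \<exists>f g. smooth f \<and> smooth g \<and> h = (\<lambda>x. f x + g x)"])
  fix h :: "'a \<Rightarrow> 'b" and v :: 'a
  assume "\<exists>f g. smooth f \<and> smooth g \<and> h = (\<lambda>x. f x + g x)"
  then obtain f g where fg: "smooth f" "smooth g" "h = (\<lambda>x. f x + g x)" by blast
  then have d: "(h has_derivative (\<lambda>v. frechet_derivative f (at x) v + frechet_derivative g (at x) v)) (at x)" for x
    by (auto intro!: derivative_intros smooth_has_derivative)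
  then show "h differentiable (at x)" for x
    by (meson differentiableI)
  show "\<exists>f g. smooth f \<and> smooth g \<and> (\<lambda>x. frechet_derivative h (at x) v) = (\<lambda>x. f x + g x)"
    unfolding frechet_derivative_eqI[OF d]
    by (intro exI[of _ "\<lambda>x. frechet_derivative f (at x) v"] exI[of _ "\<lambda>x. frechet_derivative g (at x) v"]
        conjI smooth_frechet_derivative fg refl)
qed (use assms in blast)

lemma smooth_bounded_linear:
  fixes f :: "'a::euclidean_space \<Rightarrow> 'b::real_normed_vector"
  assumes "bounded_linear L" "smooth f"
  shows "smooth (\<lambda>x. L (f x))"
proof (rule smooth_coinduct[where P = "\<lambda>h. \<exists>f. smooth f \<and> h = (\<lambda>x. L (f x))"])
  fix h :: "'a \<Rightarrow> 'c" and v :: 'a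
  assume "\<exists>f. smooth f \<and> h = (\<lambda>x. L (f x))"
  then obtain f where f: "smooth f" "h = (\<lambda>x. L (f x))" by blast
  then have d: "(h has_derivative (\<lambda>v. L (frechet_derivative f (at x) v))) (at x)" for x
    using bounded_linear.has_derivative[OF assms(1) smooth_has_derivative] by blast
  then show "h differentiable (at x)" for x
    by (meson differentiableI)
  show "\<exists>f. smooth f \<and> (\<lambda>x. frechet_derivative h (at x) v) = (\<lambda>x. L (f x))"
    unfolding frechet_derivative_eqI[OF d]
    by (intro exI[of _ "\<lambda>x. frechet_derivative f (at x) v"] conjI smooth_frechet_derivative f refl)
qed (use assms in blast)

lemma smooth_zero: "smooth (\<lambda>x. 0)"
proof (rule smooth_coinduct[where P = "\<lambda>h. h = (\<lambda>x. 0)"])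
qed (auto simp: frechet_derivative_eqI[OF has_derivative_const])

lemma smooth_sum: "(\<And>i. i \<in> I \<Longrightarrow> smooth (f i)) \<Longrightarrow> smooth (\<lambda>x. \<Sum>i\<in>I. f i x)"
  by (induction I rule: infinite_finite_induct) (auto simp: smooth_zero smooth_add)

lemma smooth_linear_scaleR:
  fixes l :: "'a::euclidean_space \<Rightarrow> real"
  assumes "linear l" "smooth f"
  shows "smooth (\<lambda>x. l x *\<^sub>R f x)"
\<comment> \<open>Differentiating the product leaves the term \<open>l v *\<^sub>R f x\<close>
  without a linear factor. The extra summand \<open>g\<close> makes the class closed.\<close>
proof (rule smooth_coinduct[where P = "\<lambda>h. \<exists>f g. smooth f \<and> smooth g \<and> h = (\<lambda>x. l x *\<^sub>R f x + g x)"])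
  have l: "bounded_linear l"
    using assms(1) linear_conv_bounded_linear by blast
  fix h :: "'a \<Rightarrow> 'b" and v :: 'a
  assume "\<exists>f g. smooth f \<and> smooth g \<and> h = (\<lambda>x. l x *\<^sub>R f x + g x)"
  then obtain f g where fg: "smooth f" "smooth g" "h = (\<lambda>x. l x *\<^sub>R f x + g x)" by blast
  then have d: "(h has_derivative (\<lambda>v. l x *\<^sub>R frechet_derivative f (at x) v +
      (l v *\<^sub>R f x + frechet_derivative g (at x) v))) (at x)" for x
    by (auto intro!: derivative_eq_intros smooth_has_derivative bounded_linear_imp_has_derivative[OF l])
  then show "h differentiable (at x)" for x
    by (meson differentiableI)
  have "smooth (\<lambda>x. l v *\<^sub>R f x + frechet_derivative g (at x) v)"
    using fg by (intro smooth_add smooth_bounded_linear[OF bounded_linear_scaleR_right] smooth_frechet_derivative)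
  then show "\<exists>f g. smooth f \<and> smooth g \<and>
      (\<lambda>x. frechet_derivative h (at x) v) = (\<lambda>x. l x *\<^sub>R f x + g x)"
    unfolding frechet_derivative_eqI[OF d]
    by (intro exI[of _ "\<lambda>x. frechet_derivative f (at x) v"]
        exI[of _ "\<lambda>x. l v *\<^sub>R f x + frechet_derivative g (at x) v"]
        conjI smooth_frechet_derivative fg refl)
next
  show "\<exists>fa g. smooth fa \<and> smooth g \<and> (\<lambda>x. l x *\<^sub>R f x) = (\<lambda>x. l x *\<^sub>R fa x + g x)"
    using assms(2) smooth_zero by (intro exI[of _ f] exI[of _ "\<lambda>x. 0"]) auto
qed

lemma smooth_plane_wave:
  fixes l :: "'a::euclidean_space \<Rightarrow> real" and s :: "complex^'n"
  assumes "linear l"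
  shows "smooth (\<lambda>x. exp (\<i> * of_real (l x)) *s s)"
    and "((\<lambda>x. exp (\<i> * of_real (l x)) *s s) has_derivative
           (\<lambda>v. (\<i> * of_real (l v)) *s (exp (\<i> * of_real (l x)) *s s))) (at x)"
proof -
  have l: "bounded_linear l"
    using assms(1) linear_conv_bounded_linear by blast
  have bl: "bounded_linear (\<lambda>c. c *s s)"
    by (rule linear_conv_bounded_linear[THEN iffD1], rule linearI) (auto simp: vec_eq_iff algebra_simps)
  have e: "((\<lambda>x. c * exp (\<i> * of_real (l x))) has_derivative
      (\<lambda>v. c * (exp (\<i> * of_real (l x)) * (\<i> * of_real (l v))))) (at x)" for c x
  proof -
    have "bounded_linear (\<lambda>v. \<i> * of_real (l v))"
      by (intro bounded_linear_mult_right[THEN bounded_linear_compose] bounded_linear_of_real[THEN bounded_linear_compose] l)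
    then have "((\<lambda>x. \<i> * of_real (l x)) has_derivative (\<lambda>v. \<i> * of_real (l v))) (at x)"
      by (rule bounded_linear_imp_has_derivative)
    then have "((\<lambda>x. exp (\<i> * of_real (l x))) has_derivative
        (\<lambda>v. exp (\<i> * of_real (l x)) * (\<i> * of_real (l v)))) (at x)"
      using has_derivative_compose[OF _ DERIV_exp[THEN has_field_derivative_imp_has_derivative]] by blast
    then show ?thesis
      by (rule has_derivative_mult_right)
  qed
  have d: "((\<lambda>x. (c * exp (\<i> * of_real (l x))) *s s) has_derivative
      (\<lambda>v. (c * (exp (\<i> * of_real (l x)) * (\<i> * of_real (l v)))) *s s)) (at x)" for c x
    using bounded_linear.has_derivative[OF bl e] by simp
  show "((\<lambda>x. exp (\<i> * of_real (l x)) *s s) has_derivative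
           (\<lambda>v. (\<i> * of_real (l v)) *s (exp (\<i> * of_real (l x)) *s s))) (at x)"
    using d[of 1 x] by (simp add: vec_eq_iff mult_ac)
  show "smooth (\<lambda>x. exp (\<i> * of_real (l x)) *s s)"
  \<comment> \<open>The constant \<open>c\<close> absorbs the factor that each differentiation
    produces.\<close>
  proof (rule smooth_coinduct[where P = "\<lambda>h. \<exists>c. h = (\<lambda>x. (c * exp (\<i> * of_real (l x))) *s s)"])
    fix h :: "'a \<Rightarrow> complex^'n" and v :: 'a
    assume "\<exists>c. h = (\<lambda>x. (c * exp (\<i> * of_real (l x))) *s s)"
    then obtain c where h: "h = (\<lambda>x. (c * exp (\<i> * of_real (l x))) *s s)" by blast
    show "h differentiable (at x)" for x
      unfolding h using d by (meson differentiableI)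
    show "\<exists>c. (\<lambda>x. frechet_derivative h (at x) v) = (\<lambda>x. (c * exp (\<i> * of_real (l x))) *s s)"
      unfolding h frechet_derivative_eqI[OF d]
      by (rule exI[of _ "c * (\<i> * of_real (l v))"]) (simp add: mult_ac)
  qed (rule exI[of _ 1], simp)
qed

lemma smooth_frechet_line:
  assumes "smooth f"
  shows "((\<lambda>s. f (y + s *\<^sub>R u) \<bullet> w) has_real_derivative frechet_derivative f (at (y + s *\<^sub>R u)) u \<bullet> w) (at s)"
proof -
  have "((\<lambda>s. f (y + s *\<^sub>R u)) has_derivative (\<lambda>h. frechet_derivative f (at (y + s *\<^sub>R u)) (h *\<^sub>R u))) (at s)"
    by (rule has_derivative_compose[OF _ smooth_has_derivative[OF assms]]) (auto intro!: derivative_eq_intros)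
  then have "((\<lambda>s. f (y + s *\<^sub>R u) \<bullet> w) has_derivative
      (\<lambda>h. frechet_derivative f (at (y + s *\<^sub>R u)) (h *\<^sub>R u) \<bullet> w)) (at s)"
    by (rule has_derivative_inner_left)
  then show ?thesis
    using smooth_linear_frechet[OF assms]
    by (simp add: has_field_derivative_def linear_cmul mult_commute_abs)
qed

text \<open>The second difference of \<open>f\<close> over the parallelogram spanned by t u and t v
  is symmetric in u and v. Two applications of the mean value theorem identify it with t^2 times the
  mixed derivative at a point near \<open>x\<close>, and t tends to 0. Pairing with \<open>w\<close>
  supplies the real-valued functions which that theorem requires.\<close>

lemma frechet_derivative_commute:
  fixes f :: "'a::euclidean_space \<Rightarrow> 'b::real_inner"
  assumes f: "smooth f"
  shows "frechet_derivative (\<lambda>y. frechet_derivative f (at y) u) (at x) v =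
         frechet_derivative (\<lambda>y. frechet_derivative f (at y) v) (at x) u"
proof -
  have "frechet_derivative (\<lambda>y. frechet_derivative f (at y) u) (at x) v \<bullet> w =
         frechet_derivative (\<lambda>y. frechet_derivative f (at y) v) (at x) u \<bullet> w" for w
  proof -
    define D where "D u v y = frechet_derivative (\<lambda>y. frechet_derivative f (at y) u) (at y) v" for u v y
    define \<Delta> where "\<Delta> u v t = f (x + t *\<^sub>R u + t *\<^sub>R v) \<bullet> w - f (x + t *\<^sub>R u) \<bullet> w - f (x + t *\<^sub>R v) \<bullet> w + f x \<bullet> w" for u v t
    have mv: "\<exists>p. norm (p - x) \<le> t * (norm u + norm v) \<and> \<Delta> u v t = t\<^sup>2 * (D u v p \<bullet> w)"
      if "t > 0" for t u v
    proof -
      have "\<exists>s. 0 < s \<and> s < t \<and>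
         (f (x + t *\<^sub>R v + t *\<^sub>R u) \<bullet> w - f (x + t *\<^sub>R u) \<bullet> w) - (f (x + t *\<^sub>R v + 0 *\<^sub>R u) \<bullet> w - f (x + 0 *\<^sub>R u) \<bullet> w)
         = (t - 0) * (frechet_derivative f (at (x + t *\<^sub>R v + s *\<^sub>R u)) u \<bullet> w - frechet_derivative f (at (x + s *\<^sub>R u)) u \<bullet> w)"
        using that by (intro MVT2 derivative_intros smooth_frechet_line[OF f]) auto
      then obtain s where s: "0 < s" "s < t" and
        "(f (x + t *\<^sub>R v + t *\<^sub>R u) \<bullet> w - f (x + t *\<^sub>R u) \<bullet> w) - (f (x + t *\<^sub>R v + 0 *\<^sub>R u) \<bullet> w - f (x + 0 *\<^sub>R u) \<bullet> w)
         = (t - 0) * (frechet_derivative f (at (x + t *\<^sub>R v + s *\<^sub>R u)) u \<bullet> w - frechet_derivative f (at (x + s *\<^sub>R u)) u \<bullet> w)"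
        by blast
      then have 1: "\<Delta> u v t = t * (frechet_derivative f (at (x + t *\<^sub>R v + s *\<^sub>R u)) u \<bullet> w - frechet_derivative f (at (x + s *\<^sub>R u)) u \<bullet> w)"
        by (simp add: \<Delta>_def algebra_simps)
      have "\<exists>r. 0 < r \<and> r < t \<and>
         frechet_derivative f (at (x + s *\<^sub>R u + t *\<^sub>R v)) u \<bullet> w - frechet_derivative f (at (x + s *\<^sub>R u + 0 *\<^sub>R v)) u \<bullet> w
         = (t - 0) * (D u v (x + s *\<^sub>R u + r *\<^sub>R v) \<bullet> w)"
        unfolding D_def using that
        by (intro MVT2 smooth_frechet_line[OF smooth_frechet_derivative[OF f]]) auto
      then obtain r where r: "0 < r" "r < t" and
        "frechet_derivative f (at (x + s *\<^sub>R u + t *\<^sub>R v)) u \<bullet> w - frechet_derivative f (at (x + s *\<^sub>R u + 0 *\<^sub>R v)) u \<bullet> w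
         = (t - 0) * (D u v (x + s *\<^sub>R u + r *\<^sub>R v) \<bullet> w)"
        by blast
      then have 2: "\<Delta> u v t = t\<^sup>2 * (D u v (x + s *\<^sub>R u + r *\<^sub>R v) \<bullet> w)"
        unfolding 1 by (simp add: add_ac power2_eq_square)
      have "norm (s *\<^sub>R u + r *\<^sub>R v) \<le> t * (norm u + norm v)"
      proof -
        have "norm (s *\<^sub>R u + r *\<^sub>R v) \<le> s * norm u + r * norm v"
          using norm_triangle_ineq[of "s *\<^sub>R u" "r *\<^sub>R v"] s r by simp
        also have "\<dots> \<le> t * norm u + t * norm v"
          using s r by (intro add_mono mult_right_mono) auto
        finally show ?thesis by (simp add: algebra_simps)
      qed
      then show ?thesis
        using 2 by (intro exI[of _ "x + s *\<^sub>R u + r *\<^sub>R v"]) (simp add: add.assoc)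
    qed
    have lim: "\<exists>p. p \<longlonglongrightarrow> x \<and> (\<forall>n. (real (Suc n))\<^sup>2 * \<Delta> u v (1 / real (Suc n)) = D u v (p n) \<bullet> w)" for u v
    proof -
      obtain p where p: "\<And>n. norm (p n - x) \<le> 1 / real (Suc n) * (norm u + norm v)"
        "\<And>n. \<Delta> u v (1 / real (Suc n)) = (1 / real (Suc n))\<^sup>2 * (D u v (p n) \<bullet> w)"
        using mv[of "1 / real (Suc _)" u v] by (metis of_nat_0_less_iff zero_less_Suc zero_less_divide_1_iff)
      have "(\<lambda>n. 1 / real (Suc n) * (norm u + norm v)) \<longlonglongrightarrow> 0"
        using tendsto_mult_left[OF LIMSEQ_inverse_real_of_nat, of "norm u + norm v"]
        by (simp add: field_simps)
      then have "(\<lambda>n. p n - x) \<longlonglongrightarrow> 0"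
        by (rule Lim_null_comparison[rotated]) (use p(1) in auto)
      then have "p \<longlonglongrightarrow> x"
        using LIM_zero_cancel by blast
      moreover have "(real (Suc n))\<^sup>2 * \<Delta> u v (1 / real (Suc n)) = D u v (p n) \<bullet> w" for n
        unfolding p(2) by (simp add: power_divide del: of_nat_Suc)
      ultimately show ?thesis by blast
    qed
    have cont: "isCont (\<lambda>y. D u v y \<bullet> w) x" for u v
    proof -
      have "smooth (D u v)"
        unfolding D_def by (intro smooth_frechet_derivative f)
      then have "isCont (D u v) x"
        using smooth_continuous_on[of _ UNIV] continuous_on_eq_continuous_at by blast
      then show ?thesis by (intro continuous_intros)
    qed
    have sym: "\<Delta> u v t = \<Delta> v u t" for t
      by (simp add: \<Delta>_def add_ac)
    obtain p where p: "p \<longlonglongrightarrow> x" "\<And>n. (real (Suc n))\<^sup>2 * \<Delta> u v (1 / real (Suc n)) = D u v (p n) \<bullet> w"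
      using lim by blast
    obtain q where q: "q \<longlonglongrightarrow> x" "\<And>n. (real (Suc n))\<^sup>2 * \<Delta> v u (1 / real (Suc n)) = D v u (q n) \<bullet> w"
      using lim by blast
    have "(\<lambda>n. D u v (p n) \<bullet> w) \<longlonglongrightarrow> D u v x \<bullet> w" "(\<lambda>n. D v u (q n) \<bullet> w) \<longlonglongrightarrow> D v u x \<bullet> w"
      using isCont_tendsto_compose[OF cont p(1)] isCont_tendsto_compose[OF cont q(1)] by auto
    moreover have "(\<lambda>n. D u v (p n) \<bullet> w) = (\<lambda>n. D v u (q n) \<bullet> w)"
      using p(2) q(2) sym by auto
    ultimately have "D u v x \<bullet> w = D v u x \<bullet> w"
      using LIMSEQ_unique by metis
    then show ?thesis
      by (simp add: D_def)
  qed
  then show ?thesis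
    using vector_eq_rdot by blast
qed

section \<open>Left-invariant differentiation in exponential coordinates\<close>

abbreviation nil_mult :: "real^7 \<Rightarrow> real^7 \<Rightarrow> real^7" (infixl "\<star>" 70)
  where "x \<star> y \<equiv> x \<otimes>\<^bsub>nil_group\<^esub> y"

lemma nil_mult_eq: "x \<star> y = x + y + (1/2) *\<^sub>R lie_bracket x y"
  by (simp add: nil_group_def)

lemma nil_mult_assoc: "x \<star> y \<star> z = x \<star> (y \<star> z)"
  by (simp add: nil_mult_eq lie_bracket_linear lie_bracket_two_step scaleR_add_right)

lemma lie_bracket_self: "lie_bracket x x = 0"
  by (simp add: vec_eq_iff lie_bracket_nth)

lemma nil_mult_zero: "x \<star> 0 = x"
  by (simp add: vec_eq_iff nil_mult_eq lie_bracket_nth)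

lemma nil_mult_one_parameter: "x \<star> (s *\<^sub>R v) \<star> (t *\<^sub>R v) = x \<star> ((s + t) *\<^sub>R v)"
  unfolding nil_mult_assoc
  by (simp add: nil_mult_eq[of "s *\<^sub>R v"] lie_bracket_linear lie_bracket_self scaleR_add_left)

text \<open>By bilinearity of the bracket the curve is a straight line, with velocity v + [x, v]/2.
  This is the value at \<open>x\<close> of the left-invariant field generated by
  \<open>v\<close>.\<close>

lemma left_deriv_curve_frechet:
  assumes "f differentiable (at x)"
  shows "((\<lambda>t. f (x \<star> (t *\<^sub>R v))) has_vector_derivative
           frechet_derivative f (at x) (v + (1/2) *\<^sub>R lie_bracket x v)) (at 0)"
proof -
  let ?w = "v + (1/2) *\<^sub>R lie_bracket x v"
  have eq: "x \<star> (t *\<^sub>R v) = x + t *\<^sub>R ?w" for t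
    by (simp add: nil_mult_eq lie_bracket_linear algebra_simps)
  have "((\<lambda>t. x + t *\<^sub>R ?w) has_derivative (\<lambda>t. t *\<^sub>R ?w)) (at 0)"
    by (auto intro!: derivative_eq_intros)
  moreover have "(f has_derivative frechet_derivative f (at x)) (at (x + 0 *\<^sub>R ?w))"
    using assms frechet_derivative_works by auto
  ultimately have "((\<lambda>t. f (x + t *\<^sub>R ?w)) has_derivative (\<lambda>t. frechet_derivative f (at x) (t *\<^sub>R ?w))) (at 0)"
    by (rule has_derivative_compose)
  then show ?thesis
    unfolding eq has_vector_derivative_def
    by (simp add: linear_cmul[OF linear_frechet_derivative[OF assms]])
qed

lemma left_deriv_frechet:
  assumes "f differentiable (at x)"
  shows "left_deriv v f x = frechet_derivative f (at x) (v + (1/2) *\<^sub>R lie_bracket x v)"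
  unfolding left_deriv_def using left_deriv_curve_frechet[OF assms] by (rule vector_derivative_at)

lemma has_vector_derivative_left_deriv:
  assumes "smooth f"
  shows "((\<lambda>t. f (x \<star> (t *\<^sub>R v))) has_vector_derivative left_deriv v f (x \<star> (t *\<^sub>R v))) (at t)"
proof -
  have "((\<lambda>s. f (x \<star> (t *\<^sub>R v) \<star> (s *\<^sub>R v))) has_vector_derivative left_deriv v f (x \<star> (t *\<^sub>R v))) (at 0)"
    using left_deriv_curve_frechet[OF smooth_differentiable[OF assms]]
    by (simp add: left_deriv_frechet smooth_differentiable assms)
  then have "((\<lambda>s. f (x \<star> ((t + s) *\<^sub>R v))) has_derivative (\<lambda>h. h *\<^sub>R left_deriv v f (x \<star> (t *\<^sub>R v)))) (at 0)"
    by (simp add: nil_mult_one_parameter has_vector_derivative_def)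
  moreover have "((\<lambda>r. r - t) has_derivative (\<lambda>h. h)) (at t)"
    by (auto intro!: derivative_eq_intros)
  ultimately have "((\<lambda>r. f (x \<star> ((t + (r - t)) *\<^sub>R v))) has_derivative (\<lambda>h. h *\<^sub>R left_deriv v f (x \<star> (t *\<^sub>R v)))) (at t)"
    using has_derivative_compose[of "\<lambda>r. r - t" "\<lambda>h. h" t UNIV "\<lambda>s. f (x \<star> ((t + s) *\<^sub>R v))"] by simp
  then show ?thesis
    by (simp add: has_vector_derivative_def)
qed

lemma left_deriv_linear:
  assumes "smooth f"
  shows "linear (\<lambda>v. left_deriv v f x)"
proof -
  have "linear (\<lambda>v. v + (1/2) *\<^sub>R lie_bracket x v)"
    by (rule linearI) (simp_all add: lie_bracket_linear scaleR_add_right)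
  then have "linear (frechet_derivative f (at x) \<circ> (\<lambda>v. v + (1/2) *\<^sub>R lie_bracket x v))"
    by (rule linear_compose) (rule smooth_linear_frechet[OF assms])
  then show ?thesis
    by (simp add: o_def left_deriv_frechet smooth_differentiable assms)
qed

lemma smooth_left_deriv:
  assumes "smooth f"
  shows "smooth (left_deriv v f)"
proof -
  let ?D = "\<lambda>w x. frechet_derivative f (at x) w"
  have lin: "linear (\<lambda>x::real^7. x $ i)" for i
    by (intro linearI) auto
  note lin_D = smooth_linear_frechet[OF assms]
  \<comment> \<open>The coefficients of the field are affine in \<open>x\<close>. The sum is
    arranged so that each coordinate of \<open>x\<close> multiplies a function already known to be
    smooth, as \<open>smooth_linear_scaleR\<close> expects.\<close>
  have "left_deriv v f = (\<lambda>x. ?D v x + (1/2) *\<^sub>R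
     ((x $ 2) *\<^sub>R (v $ 1 *\<^sub>R ?D (axis 6 1) x) + ((x $ 3) *\<^sub>R (v $ 1 *\<^sub>R ?D (axis 7 1) x) +
      (x $ 1) *\<^sub>R ((- v $ 2) *\<^sub>R ?D (axis 6 1) x + (- v $ 3) *\<^sub>R ?D (axis 7 1) x))))"
  proof
    fix x
    have *: "v + (1/2) *\<^sub>R lie_bracket x v = v + (1/2) *\<^sub>R
       (((x $ 2) * (v $ 1)) *\<^sub>R axis 6 1 + (((x $ 3) * (v $ 1)) *\<^sub>R axis 7 1 +
        ((x $ 1 * (- v $ 2)) *\<^sub>R axis 6 1 + (x $ 1 * (- v $ 3)) *\<^sub>R axis 7 1)))"
      by (simp add: lie_bracket_def algebra_simps)
    show "left_deriv v f x = ?D v x + (1/2) *\<^sub>R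
     ((x $ 2) *\<^sub>R (v $ 1 *\<^sub>R ?D (axis 6 1) x) + ((x $ 3) *\<^sub>R (v $ 1 *\<^sub>R ?D (axis 7 1) x) +
      (x $ 1) *\<^sub>R ((- v $ 2) *\<^sub>R ?D (axis 6 1) x + (- v $ 3) *\<^sub>R ?D (axis 7 1) x)))"
      unfolding left_deriv_frechet[OF smooth_differentiable[OF assms]] *
      by (simp only: linear_add[OF lin_D] linear_cmul[OF lin_D] scaleR_add_right scaleR_scaleR)
  qed
  moreover have "smooth \<dots>"
    by (intro smooth_add smooth_bounded_linear[OF bounded_linear_scaleR_right] smooth_linear_scaleR lin
        smooth_frechet_derivative assms)
  ultimately show ?thesis by simp
qed

text \<open>The second-order parts agree by symmetry of the second derivative. What remains is the
  derivative along [u, v]/2 - [v, u]/2 = [u, v]; the corrections that depend on \<open>x\<close> are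
  nested brackets and vanish in a two-step algebra.\<close>

lemma left_deriv_commutator:
  assumes f: "smooth f"
  shows "left_deriv u (left_deriv v f) x = left_deriv v (left_deriv u f) x + left_deriv (lie_bracket u v) f x"
proof -
  let ?D = "\<lambda>w x. frechet_derivative f (at x) w"
  let ?z = "\<lambda>v x. v + (1/2) *\<^sub>R lie_bracket x v"
  define H where "H p q = frechet_derivative (?D p) (at x) q" for p q
  have linH: "linear (H p)" for p
    unfolding H_def using smooth_frechet_derivative[OF f] smooth_linear_frechet by blast
  have symH: "H p q = H q p" for p q
    unfolding H_def by (rule frechet_derivative_commute[OF f])
  note linD = smooth_linear_frechet[OF f]
  have br_bl: "bounded_linear (\<lambda>y. lie_bracket y v)" for v
    by (rule linear_conv_bounded_linear[THEN iffD1], rule linearI) (simp_all add: lie_bracket_linear)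
  have 1: "left_deriv v f = (\<lambda>y. \<Sum>b\<in>Basis. (?z v y \<bullet> b) *\<^sub>R ?D b y)" for v
  proof
    fix y
    have "left_deriv v f y = ?D (\<Sum>b\<in>Basis. (?z v y \<bullet> b) *\<^sub>R b) y"
      by (simp add: left_deriv_frechet smooth_differentiable f euclidean_representation)
    also have "\<dots> = (\<Sum>b\<in>Basis. (?z v y \<bullet> b) *\<^sub>R ?D b y)"
      by (simp only: linear_sum[OF linD] linear_cmul[OF linD])
    finally show "left_deriv v f y = \<dots>" .
  qed
  have "((\<lambda>y. (?z v y \<bullet> b) *\<^sub>R ?D b y) has_derivative
     (\<lambda>w. (?z v x \<bullet> b) *\<^sub>R H b w + (((1/2) *\<^sub>R lie_bracket w v) \<bullet> b) *\<^sub>R ?D b x)) (at x)" for b v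
    unfolding H_def
    by (auto intro!: derivative_eq_intros smooth_has_derivative[OF smooth_frechet_derivative[OF f]]
        bounded_linear_imp_has_derivative[OF br_bl])
  then have "((left_deriv v f) has_derivative
     (\<lambda>w. \<Sum>b\<in>Basis. (?z v x \<bullet> b) *\<^sub>R H b w + (((1/2) *\<^sub>R lie_bracket w v) \<bullet> b) *\<^sub>R ?D b x)) (at x)" for v
    unfolding 1 by (rule has_derivative_sum)
  then have "frechet_derivative (left_deriv v f) (at x) =
     (\<lambda>w. \<Sum>b\<in>Basis. (?z v x \<bullet> b) *\<^sub>R H b w + (((1/2) *\<^sub>R lie_bracket w v) \<bullet> b) *\<^sub>R ?D b x)" for v
    by (rule frechet_derivative_eqI)
  moreover have "(\<Sum>b\<in>Basis. (?z v x \<bullet> b) *\<^sub>R H b w + (((1/2) *\<^sub>R lie_bracket w v) \<bullet> b) *\<^sub>R ?D b x)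
      = H (?z v x) w + ?D ((1/2) *\<^sub>R lie_bracket w v) x" for v w
  proof -
    have a: "(\<Sum>b\<in>Basis. (z \<bullet> b) *\<^sub>R H b w) = H z w" for z
    proof -
      have "(\<Sum>b\<in>Basis. (z \<bullet> b) *\<^sub>R H b w) = (\<Sum>b\<in>Basis. (z \<bullet> b) *\<^sub>R H w b)"
        using symH by simp
      also have "\<dots> = H w (\<Sum>b\<in>Basis. (z \<bullet> b) *\<^sub>R b)"
        by (simp only: linear_sum[OF linH] linear_cmul[OF linH])
      finally show ?thesis
        using symH by (simp add: euclidean_representation)
    qed
    have b: "(\<Sum>b\<in>Basis. (z \<bullet> b) *\<^sub>R ?D b x) = ?D z x" for z
    proof -
      have "(\<Sum>b\<in>Basis. (z \<bullet> b) *\<^sub>R ?D b x) = ?D (\<Sum>b\<in>Basis. (z \<bullet> b) *\<^sub>R b) x"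
        by (simp only: linear_sum[OF linD] linear_cmul[OF linD])
      then show ?thesis
        by (simp add: euclidean_representation)
    qed
    show ?thesis by (simp only: sum.distrib a b)
  qed
  ultimately have 2: "left_deriv u (left_deriv v f) x = H (?z v x) (?z u x) + ?D ((1/2) *\<^sub>R lie_bracket (?z u x) v) x" for u v
    by (simp add: left_deriv_frechet[of "left_deriv v f"] smooth_differentiable smooth_left_deriv f)
  have 3: "(1/2) *\<^sub>R lie_bracket (?z u x) v = (1/2) *\<^sub>R lie_bracket u v" for u v
    by (simp add: lie_bracket_linear lie_bracket_two_step)
  have 4: "lie_bracket u v = (1/2) *\<^sub>R lie_bracket u v - (1/2) *\<^sub>R lie_bracket v u"
    by (simp add: vec_eq_iff lie_bracket_nth algebra_simps)
  have "left_deriv (lie_bracket u v) f x = ?D (lie_bracket u v) x"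
    by (simp add: left_deriv_frechet smooth_differentiable f lie_bracket_two_step)
  also have "\<dots> = ?D ((1/2) *\<^sub>R lie_bracket u v) x - ?D ((1/2) *\<^sub>R lie_bracket v u) x"
    using 4 linear_diff[OF linD] by metis
  finally show ?thesis
    unfolding 2 3 using symH by simp
qed

lemma left_deriv_bounded_linear:
  assumes "bounded_linear L" "smooth f"
  shows "left_deriv v (\<lambda>x. L (f x)) x = L (left_deriv v f x)"
proof -
  have "((\<lambda>t. L (f (x \<star> (t *\<^sub>R v)))) has_vector_derivative L (left_deriv v f (x \<star> (0 *\<^sub>R v)))) (at 0)"
    by (rule bounded_linear.has_vector_derivative[OF assms(1) has_vector_derivative_left_deriv[OF assms(2)]])
  then show ?thesis
    by (simp add: left_deriv_def vector_derivative_at nil_mult_zero)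
qed

lemma left_deriv_add:
  assumes "smooth f" "smooth g"
  shows "left_deriv v (\<lambda>x. f x + g x) x = left_deriv v f x + left_deriv v g x"
proof -
  have "((\<lambda>t. f (x \<star> (t *\<^sub>R v)) + g (x \<star> (t *\<^sub>R v))) has_vector_derivative
      left_deriv v f (x \<star> (0 *\<^sub>R v)) + left_deriv v g (x \<star> (0 *\<^sub>R v))) (at 0)"
    by (intro has_vector_derivative_add has_vector_derivative_left_deriv assms)
  then show ?thesis
    by (simp add: left_deriv_def vector_derivative_at nil_mult_zero)
qed

lemma left_deriv_sum:
  assumes "\<And>i. i \<in> I \<Longrightarrow> smooth (f i)"
  shows "left_deriv v (\<lambda>x. \<Sum>i\<in>I. f i x) x = (\<Sum>i\<in>I. left_deriv v (f i) x)"
  using assms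
proof (induction I rule: infinite_finite_induct)
  case (insert i I)
  then show ?case by (simp add: left_deriv_add smooth_sum)
qed (simp_all add: left_deriv_def)

lemma left_deriv_left_invariant:
  assumes "\<And>x. f (\<gamma> \<star> x) = f x"
  shows "left_deriv v f (\<gamma> \<star> x) = left_deriv v f x"
  by (simp add: left_deriv_def nil_mult_assoc assms)


subsection \<open>The Dirac operator\<close>

lemma sum_7: "(\<Sum>i\<in>UNIV. f (i::7)) = f 1 + f 2 + f 3 + f 4 + f 5 + f 6 + (f 7 :: 'a::comm_monoid_add)"
proof -
  have "finite A" for A :: "7 set"
    by simp
  note ins = sum.insert[OF this]
  show ?thesis
    unfolding UNIV_7 by (subst ins, simp)+ (simp add: add.assoc)
qed

lemma sum_rotate:
  "(\<Sum>i\<in>A. \<Sum>j\<in>A. \<Sum>k\<in>A. F i j k) = (\<Sum>i\<in>A. \<Sum>j\<in>A. \<Sum>k\<in>A. F j k i)"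
proof -
  have "(\<Sum>i\<in>A. \<Sum>j\<in>A. \<Sum>k\<in>A. F j k i) = (\<Sum>j\<in>A. \<Sum>i\<in>A. \<Sum>k\<in>A. F j k i)"
    by (rule sum.swap)
  also have "\<dots> = (\<Sum>j\<in>A. \<Sum>k\<in>A. \<Sum>i\<in>A. F j k i)"
    by (rule sum.cong[OF refl]) (rule sum.swap)
  finally show ?thesis by simp
qed

lemma sum_less_symmetric:
  fixes F :: "'i::{finite,linorder} \<Rightarrow> 'i \<Rightarrow> 'b::real_vector"
  assumes "\<And>j k. F j k = F k j" "\<And>j. F j j = 0"
  shows "(\<Sum>(j, k)\<in>{(j, k). j < k}. F j k) = (1/2) *\<^sub>R (\<Sum>j\<in>UNIV. \<Sum>k\<in>UNIV. F j k)"
proof -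
  let ?F = "\<lambda>(j, k). F j k"
  have "(\<Sum>j\<in>UNIV. \<Sum>k\<in>UNIV. F j k) = sum ?F UNIV"
    by (simp add: sum.cartesian_product)
  also have "UNIV = {(j, k). j < k} \<union> ({(j, k). k < j} \<union> {(j::'i, k). j = k})"
    by auto
  also have "sum ?F \<dots> = sum ?F {(j, k). j < k} + (sum ?F {(j, k). k < j} + sum ?F {(j, k). j = k})"
    by (subst sum.union_disjoint; (subst sum.union_disjoint)?) auto
  also have "sum ?F {(j, k). j = k} = 0"
    using assms(2) by (intro sum.neutral) auto
  also have "sum ?F {(j, k). k < j} = sum ?F {(j, k). j < k}"
    by (rule sum.reindex_bij_witness[of _ "\<lambda>(j, k). (k, j)" "\<lambda>(j, k). (k, j)"]) (auto simp: assms(1))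
  finally show ?thesis
    by (simp flip: scaleR_2)
qed

lemma bounded_linear_matrix_vector_complex: "bounded_linear (\<lambda>s. (A :: complex^'n^'m) *v s)"
  by (rule linear_conv_bounded_linear[THEN iffD1], rule linearI)
    (simp_all add: matrix_vector_right_distrib,
     simp add: vec_eq_iff matrix_vector_mult_def scaleR_sum_right)

lemma frame_expansion:
  assumes "a \<noteq> 0"
  shows "v = (\<Sum>k\<in>UNIV. left_metric a v (frame a k) *\<^sub>R frame a k)"
proof -
  have "\<forall>i. v $ i = (\<Sum>k\<in>UNIV. left_metric a v (frame a k) *\<^sub>R frame a k) $ i"
    unfolding forall_7 sum_7 using assms
    by (simp add: left_metric_def frame_def axis_def power2_eq_square)
  then show ?thesis
    by (simp add: vec_eq_iff)
qed

lemma left_deriv_frame: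
  assumes "a \<noteq> 0" "smooth f"
  shows "left_deriv v f x = (\<Sum>k\<in>UNIV. left_metric a v (frame a k) *\<^sub>R left_deriv (frame a k) f x)"
proof -
  note l = left_deriv_linear[OF assms(2)]
  have "left_deriv v f x = left_deriv (\<Sum>k\<in>UNIV. left_metric a v (frame a k) *\<^sub>R frame a k) f x"
    using frame_expansion[OF assms(1)] by simp
  also have "\<dots> = (\<Sum>k\<in>UNIV. left_metric a v (frame a k) *\<^sub>R left_deriv (frame a k) f x)"
    by (simp only: linear_sum[OF l] linear_cmul[OF l])
  finally show ?thesis .
qed

definition structure_const :: "real \<Rightarrow> 7 \<Rightarrow> 7 \<Rightarrow> 7 \<Rightarrow> real" where
  "structure_const a i j k = left_metric a (lie_bracket (frame a i) (frame a j)) (frame a k)"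

text \<open>Since e6 = E6/a and e7 = E7/a, the brackets in the orthonormal frame are [e1, e2] = -a
  e6 and [e1, e3] = -a e7.\<close>

lemma structure_const_eq:
  assumes "a \<noteq> 0"
  shows "structure_const a i j k =
    (if k = 6 then (if i = 1 \<and> j = 2 then - a else if i = 2 \<and> j = 1 then a else 0)
     else if k = 7 then (if i = 1 \<and> j = 3 then - a else if i = 3 \<and> j = 1 then a else 0)
     else 0)"
proof -
  have "\<forall>k i j. structure_const a i j k =
    (if k = 6 then (if i = 1 \<and> j = 2 then - a else if i = 2 \<and> j = 1 then a else 0)
     else if k = 7 then (if i = 1 \<and> j = 3 then - a else if i = 3 \<and> j = 1 then a else 0)
     else 0)"
    unfolding forall_7 structure_const_def using assms
    by (simp add: left_metric_def lie_bracket_nth frame_def axis_def power2_eq_square)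
  then show ?thesis by blast
qed

locale spin =
  fixes cl :: "real^7 \<Rightarrow> complex^8^8" and \<sigma> :: "complex^8 \<Rightarrow> complex^8"
  assumes spinor_module: "spinor_module cl \<sigma>"
begin

lemma clifford: "cl x *v (cl y *v s) + cl y *v (cl x *v s) = (- 2 * (x \<bullet> y)) *\<^sub>R s"
proof -
  have "cl x *v (cl y *v s) + cl y *v (cl x *v s) = (cl x ** cl y + cl y ** cl x) *v s"
    by (simp add: matrix_vector_mul_assoc matrix_vector_mult_add_rdistrib)
  also have "\<dots> = mat (of_real (- 2 * (x \<bullet> y))) *v s"
    using spinor_module by (simp add: spinor_module_def)
  also have "\<dots> = (- 2 * (x \<bullet> y)) *\<^sub>R s"
    unfolding vec_eq_iff matrix_vector_mult_def mat_def
    by (simp add: if_distrib[where f = "\<lambda>x. x * _"] cong: if_cong) (simp add: scaleR_conv_of_real)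
  finally show ?thesis .
qed

lemma linear_cl: "linear cl"
  using spinor_module by (simp add: spinor_module_def)

abbreviation e :: "7 \<Rightarrow> complex^8 \<Rightarrow> complex^8" where
  "e i s \<equiv> cl (axis i 1) *v s"

lemma e_squared: "e i (e i s) = - s"
proof -
  have "2 *\<^sub>R e i (e i s) = 2 *\<^sub>R (- s)"
    using clifford[of "axis i 1" "axis i 1" s] by (simp add: inner_axis_axis flip: scaleR_2)
  then show ?thesis
    by (simp only: scaleR_cancel_left) simp
qed

lemma e_anticommute: "i \<noteq> j \<Longrightarrow> e i (e j s) = - e j (e i s)"
  using clifford[of "axis i 1" "axis j 1" s] by (simp add: inner_axis_axis eq_neg_iff_add_eq_0)

lemma bounded_linear_e: "bounded_linear (e i)"
  by (rule bounded_linear_matrix_vector_complex)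

lemmas e_simps =
  linear_add[OF bounded_linear.linear[OF bounded_linear_e]]
  linear_diff[OF bounded_linear.linear[OF bounded_linear_e]]
  linear_neg[OF bounded_linear.linear[OF bounded_linear_e]]
  linear_cmul[OF bounded_linear.linear[OF bounded_linear_e]]
  linear_0[OF bounded_linear.linear[OF bounded_linear_e]]

lemmas e_sum = linear_sum[OF bounded_linear.linear[OF bounded_linear_e]]

definition omega :: "complex^8 \<Rightarrow> complex^8" where
  "omega s = e 1 (e 2 (e 6 s)) + e 1 (e 3 (e 7 s))"

lemma bounded_linear_omega: "bounded_linear omega"
proof -
  have "bounded_linear (\<lambda>s. e i (e j (e k s)))" for i j k
    using bounded_linear_compose[OF bounded_linear_e bounded_linear_compose[OF bounded_linear_e bounded_linear_e]] .
  then show ?thesis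
    unfolding omega_def by (intro bounded_linear_add)
qed

lemma e_reorder:
  "e 2 (e 1 s) = - e 1 (e 2 s)" "e 3 (e 1 s) = - e 1 (e 3 s)" "e 6 (e 1 s) = - e 1 (e 6 s)"
  "e 7 (e 1 s) = - e 1 (e 7 s)" "e 6 (e 2 s) = - e 2 (e 6 s)" "e 7 (e 3 s) = - e 3 (e 7 s)"
  "e 4 (e 1 s) = - e 1 (e 4 s)" "e 4 (e 2 s) = - e 2 (e 4 s)" "e 4 (e 3 s) = - e 3 (e 4 s)"
  "e 4 (e 6 s) = - e 6 (e 4 s)" "e 4 (e 7 s) = - e 7 (e 4 s)"
  by (rule e_anticommute; simp)+

text \<open>In \<open>\<Sum>\<^sub>i\<^sub>j\<^sub>k g(\<nabla>\<^sub>i e\<^sub>j, e\<^sub>k) e\<^sub>i e\<^sub>j e\<^sub>k\<close> the three terms of the Koszul formula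
  become equal after cyclic relabelling, since the bracket of \<open>e\<^sub>i\<close> and \<open>e\<^sub>j\<close> is orthogonal to both.\<close>

lemma dirac_eq:
  assumes a: "a \<noteq> 0"
  shows "dirac cl a \<psi> x = (\<Sum>i\<in>UNIV. e i (left_deriv (frame a i) \<psi> x)) - (a / 4) *\<^sub>R omega (\<psi> x)"
proof -
  let ?s = "\<psi> x" and ?c = "structure_const a"
  define G where "G i j k = left_metric a (levi_civita a (frame a i) (frame a j)) (frame a k)" for i j k
  note LC = is_levi_civita_levi_civita[OF a]
  have G: "G i j k = (1/2) * (?c i j k - ?c j k i + ?c k i j)" for i j k
    using koszul_formula[OF LC, of "frame a i" "frame a j" "frame a k"]
    by (simp add: G_def structure_const_def)
  have skew: "G i k j = - G i j k" for i j k
  proof -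
    have "G i k j + G i j k = 0"
      using LC left_metric_commute unfolding is_levi_civita_def G_def by metis
    then show ?thesis by linarith
  qed
  have pairs: "(\<Sum>(j, k)\<in>{(j, k). j < k}. G i j k *\<^sub>R e j (e k ?s)) = (1/2) *\<^sub>R (\<Sum>j\<in>UNIV. \<Sum>k\<in>UNIV. G i j k *\<^sub>R e j (e k ?s))" for i
  proof (rule sum_less_symmetric)
    show "G i j j *\<^sub>R e j (e j ?s) = 0" for j
      using skew[of i j j] by simp
    show "G i j k *\<^sub>R e j (e k ?s) = G i k j *\<^sub>R e k (e j ?s)" for j k
      using skew[of i j k] e_anticommute[of j k ?s] by (cases "j = k") simp_all
  qed
  let ?t = "\<lambda>i j k. e i (e j (e k ?s))"
  have koszul: "(\<Sum>i\<in>UNIV. \<Sum>j\<in>UNIV. \<Sum>k\<in>UNIV. G i j k *\<^sub>R ?t i j k) =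
    (1/2) *\<^sub>R ((\<Sum>i\<in>UNIV. \<Sum>j\<in>UNIV. \<Sum>k\<in>UNIV. ?c i j k *\<^sub>R ?t i j k)
      - (\<Sum>i\<in>UNIV. \<Sum>j\<in>UNIV. \<Sum>k\<in>UNIV. ?c j k i *\<^sub>R ?t i j k)
      + (\<Sum>i\<in>UNIV. \<Sum>j\<in>UNIV. \<Sum>k\<in>UNIV. ?c k i j *\<^sub>R ?t i j k))"
    unfolding G scaleR_sum_right scaleR_add_right scaleR_diff_right
    by (simp only: sum.distrib[symmetric] sum_subtractf[symmetric] scaleR_scaleR distrib_left right_diff_distrib
        scaleR_add_left scaleR_diff_left)
  have cyc1: "(\<Sum>i\<in>UNIV. \<Sum>j\<in>UNIV. \<Sum>k\<in>UNIV. ?c j k i *\<^sub>R ?t i j k) =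
      (\<Sum>i\<in>UNIV. \<Sum>j\<in>UNIV. \<Sum>k\<in>UNIV. ?c i j k *\<^sub>R ?t k i j)"
    by (rule sum_rotate[symmetric])
  have cyc2: "(\<Sum>i\<in>UNIV. \<Sum>j\<in>UNIV. \<Sum>k\<in>UNIV. ?c k i j *\<^sub>R ?t i j k) =
      (\<Sum>i\<in>UNIV. \<Sum>j\<in>UNIV. \<Sum>k\<in>UNIV. ?c i j k *\<^sub>R ?t j k i)"
    by (rule sum_rotate)
  \<comment> \<open>Simplification merges equal vectors into products with the numeral 2 of the
    vector type, not into real multiples.\<close>
  have *: "(1/2) *\<^sub>R (- (a *\<^sub>R (2 * q)) - a *\<^sub>R (2 * p)) = - (a *\<^sub>R (p + q))" for p q :: "complex^8"
  proof -
    have 2: "2 * x = 2 *\<^sub>R x" for x :: "complex^8"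
      by (simp only: mult_2 scaleR_2)
    show ?thesis
      unfolding 2 by (simp add: scaleR_diff_right scaleR_add_right)
  qed
  \<comment> \<open>A cyclic shift of three distinct anticommuting factors is even, so each of the
    three sums equals -2a times \<open>omega ?s\<close>; with signs +, -, + one copy
    survives.\<close>
  have eval: "(1/2) *\<^sub>R ((\<Sum>i\<in>UNIV. \<Sum>j\<in>UNIV. \<Sum>k\<in>UNIV. ?c i j k *\<^sub>R ?t i j k)
      - (\<Sum>i\<in>UNIV. \<Sum>j\<in>UNIV. \<Sum>k\<in>UNIV. ?c i j k *\<^sub>R ?t k i j)
      + (\<Sum>i\<in>UNIV. \<Sum>j\<in>UNIV. \<Sum>k\<in>UNIV. ?c i j k *\<^sub>R ?t j k i)) = - a *\<^sub>R omega ?s"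
    unfolding sum_7 structure_const_eq[OF a] omega_def
    apply (simp add: e_reorder e_simps)
    by (simp add: e_reorder e_simps *)
  have main: "(\<Sum>i\<in>UNIV. \<Sum>j\<in>UNIV. \<Sum>k\<in>UNIV. G i j k *\<^sub>R ?t i j k) = - a *\<^sub>R omega ?s"
    unfolding koszul cyc1 cyc2 eval ..
  \<comment> \<open>The factor 1/4 is the 1/2 of the spin connection times the 1/2 from summing over
    all pairs instead of j < k.\<close>
  have "dirac cl a \<psi> x = (\<Sum>i\<in>UNIV. e i (left_deriv (frame a i) \<psi> x + (1/4) *\<^sub>R (\<Sum>j\<in>UNIV. \<Sum>k\<in>UNIV. G i j k *\<^sub>R e j (e k ?s))))"
    unfolding dirac_def spin_connection_def G_def[symmetric] pairs by simp
  also have "\<dots> = (\<Sum>i\<in>UNIV. e i (left_deriv (frame a i) \<psi> x)) + (1/4) *\<^sub>R (\<Sum>i\<in>UNIV. \<Sum>j\<in>UNIV. \<Sum>k\<in>UNIV. G i j k *\<^sub>R ?t i j k)"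
    unfolding e_simps(1,4) e_sum sum.distrib scaleR_sum_right by simp
  finally show ?thesis
    unfolding main by (simp add: algebra_simps)
qed

end


subsection \<open>Compactness and the maximum principle\<close>

lemma nil_mult_cancel: "(- \<gamma>) \<star> (\<gamma> \<star> x) = x"
  by (simp add: vec_eq_iff nil_mult_eq lie_bracket_nth field_simps)

lemma subgroup_nil_groupD:
  assumes "subgroup \<Gamma> nil_group"
  shows "0 \<in> \<Gamma>" "\<gamma> \<in> \<Gamma> \<Longrightarrow> - \<gamma> \<in> \<Gamma>" "\<gamma> \<in> \<Gamma> \<Longrightarrow> \<delta> \<in> \<Gamma> \<Longrightarrow> \<gamma> \<star> \<delta> \<in> \<Gamma>"
proof -
  show "0 \<in> \<Gamma>"
    using subgroup.one_closed[OF assms] by (simp add: nil_group_def)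
  show "\<gamma> \<in> \<Gamma> \<Longrightarrow> \<delta> \<in> \<Gamma> \<Longrightarrow> \<gamma> \<star> \<delta> \<in> \<Gamma>"
    using subgroup.m_closed[OF assms] .
  have "(- \<gamma>) \<star> \<gamma> = \<one>\<^bsub>nil_group\<^esub>"
    by (simp add: nil_group_def vec_eq_iff lie_bracket_nth)
  then have "inv\<^bsub>nil_group\<^esub> \<gamma> = - \<gamma>"
    by (intro group.inv_equality[OF group_nil_group]) (simp_all add: nil_group_def)
  then show "\<gamma> \<in> \<Gamma> \<Longrightarrow> - \<gamma> \<in> \<Gamma>"
    using subgroup.m_inv_closed[OF assms] by metis
qed

lemma continuous_on_nil_mult: "continuous_on S (\<lambda>x. y \<star> x)"
proof -
  have "linear (\<lambda>x. lie_bracket y x)"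
    by (rule linearI) (simp_all add: lie_bracket_linear)
  then show ?thesis
    unfolding nil_mult_eq by (intro continuous_intros linear_continuous_on) (simp add: linear_conv_bounded_linear)
qed

lemma r_coset_eq_iff:
  assumes "subgroup \<Gamma> nil_group"
  shows "\<Gamma> #>\<^bsub>nil_group\<^esub> x = \<Gamma> #>\<^bsub>nil_group\<^esub> y \<longleftrightarrow> (\<exists>\<gamma>\<in>\<Gamma>. \<gamma> \<star> x = y)"
proof -
  have c: "z \<in> carrier nil_group" for z
    by (simp add: nil_group_def)
  have "\<Gamma> #>\<^bsub>nil_group\<^esub> x = \<Gamma> #>\<^bsub>nil_group\<^esub> y \<longleftrightarrow> y \<in> \<Gamma> #>\<^bsub>nil_group\<^esub> x"
    using group.repr_independence[OF group_nil_group _ c assms]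
      group.repr_independenceD[OF group_nil_group assms c] by blast
  then show ?thesis
    by (auto simp: r_coset_def)
qed

lemma topspace_nilmanifold: "topspace (nilmanifold \<Gamma>) = rcosets\<^bsub>nil_group\<^esub> \<Gamma>"
proof
  show "topspace (nilmanifold \<Gamma>) \<subseteq> rcosets\<^bsub>nil_group\<^esub> \<Gamma>"
    using openin_topspace[of "nilmanifold \<Gamma>"] unfolding openin_nilmanifold by blast
  have "\<Gamma> #>\<^bsub>nil_group\<^esub> x \<in> rcosets\<^bsub>nil_group\<^esub> \<Gamma>" for x
    by (auto simp: RCOSETS_def nil_group_def)
  then have "openin (nilmanifold \<Gamma>) (rcosets\<^bsub>nil_group\<^esub> \<Gamma>)"
    unfolding openin_nilmanifold by simp
  then show "rcosets\<^bsub>nil_group\<^esub> \<Gamma> \<subseteq> topspace (nilmanifold \<Gamma>)"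
    by (rule openin_subset)
qed

lemma rcosets_eq: "rcosets\<^bsub>nil_group\<^esub> \<Gamma> = range (\<lambda>x. \<Gamma> #>\<^bsub>nil_group\<^esub> x)"
  by (auto simp: RCOSETS_def nil_group_def)

text \<open>As a hypothesis, compactness of the quotient is used only in this form: every orbit of
  \<Gamma> meets one fixed ball. The images of the balls of integer radius are open, because their
  preimages are unions of translated balls, and they cover the quotient.\<close>

lemma compact_nilmanifold_bounded:
  assumes \<Gamma>: "subgroup \<Gamma> nil_group" and "compact_space (nilmanifold \<Gamma>)"
  obtains R where "\<And>x. \<exists>\<gamma>\<in>\<Gamma>. norm (\<gamma> \<star> x) \<le> R"
proof -
  let ?c = "\<lambda>x. \<Gamma> #>\<^bsub>nil_group\<^esub> x"
  define U where "U n = ?c ` ball 0 (real n)" for n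
  have op: "openin (nilmanifold \<Gamma>) (U n)" for n
  proof -
    have "{x. ?c x \<in> U n} = (\<Union>\<gamma>\<in>\<Gamma>. (\<lambda>x. \<gamma> \<star> x) -` ball 0 (real n))"
      unfolding U_def image_iff r_coset_eq_iff[OF \<Gamma>] by auto
    moreover have "open \<dots>"
      by (intro open_UN ballI open_vimage open_ball continuous_on_nil_mult)
    moreover have "U n \<subseteq> rcosets\<^bsub>nil_group\<^esub> \<Gamma>"
      unfolding rcosets_eq U_def by blast
    ultimately show ?thesis
      unfolding openin_nilmanifold by simp
  qed
  have "topspace (nilmanifold \<Gamma>) \<subseteq> \<Union>(range U)"
  proof -
    have "?c x \<in> \<Union>(range U)" for x
    proof -
      obtain n where "norm x < real n"
        using reals_Archimedean2 by blast
      then have "?c x \<in> U n"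
        by (auto simp: U_def)
      then show ?thesis by blast
    qed
    then show ?thesis
      unfolding topspace_nilmanifold rcosets_eq by blast
  qed
  then obtain \<F> where \<F>: "finite \<F>" "\<F> \<subseteq> range U" "topspace (nilmanifold \<Gamma>) \<subseteq> \<Union>\<F>"
    using assms(2) op unfolding compact_space_alt by (metis (no_types, lifting) imageE)
  then obtain N where N: "finite N" "\<F> = U ` N"
    by (metis finite_subset_image)
  show thesis
  proof (rule that)
    fix x
    have "?c x \<in> \<Union>\<F>"
      using \<F>(3) unfolding topspace_nilmanifold rcosets_eq by blast
    then obtain n where n: "n \<in> N" "?c x \<in> U n"
      using N by blast
    then obtain y where "norm y < real n" "?c x = ?c y"
      unfolding U_def by auto
    then obtain \<gamma> where "\<gamma> \<in> \<Gamma>" "norm (\<gamma> \<star> x) < real n"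
      unfolding r_coset_eq_iff[OF \<Gamma>] by auto
    \<comment> \<open>The sum of the finitely many radii is a convenient bound for their
      maximum.\<close>
    moreover have "real n \<le> (\<Sum>n\<in>N. real n)"
      using n(1) N(1) by (intro member_le_sum) auto
    ultimately show "\<exists>\<gamma>\<in>\<Gamma>. norm (\<gamma> \<star> x) \<le> (\<Sum>n\<in>N. real n)"
      by force
  qed
qed

lemma attains_maximum:
  fixes u :: "real^7 \<Rightarrow> real"
  assumes "cocompact_lattice \<Gamma>" "continuous_on UNIV u" "\<And>\<gamma> x. \<gamma> \<in> \<Gamma> \<Longrightarrow> u (\<gamma> \<star> x) = u x"
  obtains x0 where "\<And>x. u x \<le> u x0"
proof -
  obtain R where R: "\<And>x. \<exists>\<gamma>\<in>\<Gamma>. norm (\<gamma> \<star> x) \<le> R"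
    using assms(1) compact_nilmanifold_bounded unfolding cocompact_lattice_def by blast
  have "cball 0 R \<noteq> ({} :: (real^7) set)"
    using R[of 0] norm_ge_zero order_trans by (metis centre_in_cball empty_iff)
  then obtain x0 where x0: "\<And>y. y \<in> cball 0 R \<Longrightarrow> u y \<le> u x0"
    using continuous_attains_sup[of "cball 0 R" u] assms(2) continuous_on_subset by (metis compact_cball subset_UNIV)
  have "u x \<le> u x0" for x
  proof -
    obtain \<gamma> where "\<gamma> \<in> \<Gamma>" "norm (\<gamma> \<star> x) \<le> R"
      using R by blast
    then show ?thesis
      using x0[of "\<gamma> \<star> x"] assms(3) by simp
  qed
  then show thesis by (rule that)
qed

lemma second_derivative_at_max:
  fixes h :: "real \<Rightarrow> real"
  assumes h: "\<And>t. (h has_real_derivative h1 t) (at t)" and h1: "(h1 has_real_derivative d) (at 0)"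
    and max: "\<And>t. h t \<le> h 0"
  shows "d \<le> 0"
proof (rule ccontr)
  assume "\<not> d \<le> 0"
  have "h1 0 = 0"
    using DERIV_local_max[OF h[of 0], of 1] max by simp
  obtain \<delta> where \<delta>: "\<delta> > 0" "\<And>t. 0 < t \<Longrightarrow> t < \<delta> \<Longrightarrow> h1 0 < h1 (0 + t)"
    using DERIV_pos_inc_right[OF h1] \<open>\<not> d \<le> 0\<close> by (metis not_le)
  obtain z where z: "0 < z" "z < \<delta> / 2" "h (\<delta> / 2) - h 0 = (\<delta> / 2 - 0) * h1 z"
    using MVT2[of 0 "\<delta> / 2" h h1] h \<delta>(1) by auto
  then have "h1 z > 0"
    using \<delta>(2)[of z] \<open>h1 0 = 0\<close> by auto
  then have "h (\<delta> / 2) > h 0"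
    using z \<delta>(1) by (metis diff_gt_0_iff_gt diff_zero half_gt_zero mult_pos_pos)
  then show False
    using max[of "\<delta> / 2"] by simp
qed

lemma inner_curve_derivative:
  fixes f g :: "real^7 \<Rightarrow> complex^8"
  assumes "smooth f" "smooth g"
  shows "((\<lambda>t. f (x \<star> (t *\<^sub>R v)) \<bullet> g (x \<star> (t *\<^sub>R v))) has_real_derivative
     (left_deriv v f (x \<star> (t *\<^sub>R v)) \<bullet> g (x \<star> (t *\<^sub>R v)) + f (x \<star> (t *\<^sub>R v)) \<bullet> left_deriv v g (x \<star> (t *\<^sub>R v)))) (at t)"
proof -
  have "((\<lambda>t. f (x \<star> (t *\<^sub>R v)) \<bullet> g (x \<star> (t *\<^sub>R v))) has_derivative
     (\<lambda>h. f (x \<star> (t *\<^sub>R v)) \<bullet> (h *\<^sub>R left_deriv v g (x \<star> (t *\<^sub>R v))) +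
       (h *\<^sub>R left_deriv v f (x \<star> (t *\<^sub>R v))) \<bullet> g (x \<star> (t *\<^sub>R v)))) (at t)"
    using has_vector_derivative_left_deriv[OF assms(1)] has_vector_derivative_left_deriv[OF assms(2)]
    unfolding has_vector_derivative_def by (rule has_derivative_inner)
  then show ?thesis
    unfolding has_field_derivative_def by (rule has_derivative_eq_rhs) (simp add: fun_eq_iff algebra_simps)
qed

text \<open>The left-hand side is half of the second derivative at 0 along the curve through
  \<open>x0\<close> in direction \<open>v\<close>. Later \<open>F\<close> consists of the frame
  derivatives of \<open>f\<close>, and summing over the frame directions \<open>v\<close> produces
  the Laplacian.\<close>

lemma laplace_at_max:
  fixes F :: "'i \<Rightarrow> real^7 \<Rightarrow> complex^8"
  assumes F: "\<And>i. i \<in> I \<Longrightarrow> smooth (F i)" and f: "smooth f"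
    and max: "\<And>x. (\<Sum>i\<in>I. F i x \<bullet> F i x) + A * (f x \<bullet> f x) \<le> (\<Sum>i\<in>I. F i x0 \<bullet> F i x0) + A * (f x0 \<bullet> f x0)"
  shows "(\<Sum>i\<in>I. left_deriv v (left_deriv v (F i)) x0 \<bullet> F i x0 + left_deriv v (F i) x0 \<bullet> left_deriv v (F i) x0)
     + A * (left_deriv v (left_deriv v f) x0 \<bullet> f x0 + left_deriv v f x0 \<bullet> left_deriv v f x0) \<le> 0"
proof -
  let ?c = "\<lambda>t. x0 \<star> (t *\<^sub>R v)" and ?X = "left_deriv v"
  define h where "h t = (\<Sum>i\<in>I. F i (?c t) \<bullet> F i (?c t)) + A * (f (?c t) \<bullet> f (?c t))" for t
  define h1 where "h1 t = (\<Sum>i\<in>I. ?X (F i) (?c t) \<bullet> F i (?c t) + F i (?c t) \<bullet> ?X (F i) (?c t))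
      + A * (?X f (?c t) \<bullet> f (?c t) + f (?c t) \<bullet> ?X f (?c t))" for t
  have c0: "?c 0 = x0"
    by (simp add: nil_mult_zero)
  have "(h has_real_derivative h1 t) (at t)" for t
    unfolding h_def h1_def
    by (intro DERIV_add DERIV_sum DERIV_cmult inner_curve_derivative F f)
  moreover have "(h1 has_real_derivative
     (\<Sum>i\<in>I. (?X (?X (F i)) (?c 0) \<bullet> F i (?c 0) + ?X (F i) (?c 0) \<bullet> ?X (F i) (?c 0))
         + (?X (F i) (?c 0) \<bullet> ?X (F i) (?c 0) + F i (?c 0) \<bullet> ?X (?X (F i)) (?c 0)))
      + A * ((?X (?X f) (?c 0) \<bullet> f (?c 0) + ?X f (?c 0) \<bullet> ?X f (?c 0))
        + (?X f (?c 0) \<bullet> ?X f (?c 0) + f (?c 0) \<bullet> ?X (?X f) (?c 0)))) (at 0)"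
    unfolding h1_def
    by (intro DERIV_add DERIV_sum DERIV_cmult inner_curve_derivative F f smooth_left_deriv)
  moreover have "h t \<le> h 0" for t
    unfolding h_def c0 by (rule max)
  ultimately have "(\<Sum>i\<in>I. (?X (?X (F i)) (?c 0) \<bullet> F i (?c 0) + ?X (F i) (?c 0) \<bullet> ?X (F i) (?c 0))
         + (?X (F i) (?c 0) \<bullet> ?X (F i) (?c 0) + F i (?c 0) \<bullet> ?X (?X (F i)) (?c 0)))
      + A * ((?X (?X f) (?c 0) \<bullet> f (?c 0) + ?X f (?c 0) \<bullet> ?X f (?c 0))
        + (?X f (?c 0) \<bullet> ?X f (?c 0) + f (?c 0) \<bullet> ?X (?X f) (?c 0))) \<le> 0" (is "?d \<le> 0")
    by (rule second_derivative_at_max)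
  moreover have "?d = 2 * ((\<Sum>i\<in>I. ?X (?X (F i)) x0 \<bullet> F i x0 + ?X (F i) x0 \<bullet> ?X (F i) x0)
     + A * (?X (?X f) x0 \<bullet> f x0 + ?X f x0 \<bullet> ?X f x0))"
    unfolding c0 by (simp add: inner_commute sum.distrib sum_distrib_left algebra_simps)
  ultimately show ?thesis by simp
qed

lemma square_sum_le: "(\<Sum>i\<in>(I::'i set). f i)\<^sup>2 \<le> real (card I) * (\<Sum>i\<in>I. (f i :: real)\<^sup>2)"
  using Cauchy_Schwarz_ineq_sum[of f "\<lambda>_. 1" I] by (simp add: mult.commute)

text \<open>Absorption of the mixed terms in Bernstein's argument.\<close>

lemma absorb_mixed_terms:
  fixes p q C H G m :: real
  assumes "H\<^sup>2 \<le> 49 * q" "G\<^sup>2 \<le> 7 * p" "q + (174 * C\<^sup>2 + 2) * p \<le> C * H * G + (174 * C\<^sup>2 + 2) * (C * G * m)"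
    and "p \<ge> 0"
  shows "p \<le> 4 * (174 * C\<^sup>2 + 2) * C\<^sup>2 * m\<^sup>2"
proof -
  \<comment> \<open>In the application 49 and 7 count the index pairs and indices in Cauchy-Schwarz.
    Completing the square bounds C H G by q + (343/4) C^2 p, rounded up to 86; a second square takes
    half of A p for the term with \<open>m\<close>. The other half is (87 C^2 + 1) p, which still
    exceeds 86 C^2 p by at least p.\<close>
  define A where "A = 174 * C\<^sup>2 + 2"
  have A: "A \<ge> 0" by (simp add: A_def)
  have "0 \<le> (H / 7 - 7 / 2 * C * G)\<^sup>2" by simp
  then have 1: "C * H * G \<le> H\<^sup>2 / 49 + 49 / 4 * (C\<^sup>2 * G\<^sup>2)"
    by (simp add: power2_eq_square algebra_simps)
  have "C\<^sup>2 * G\<^sup>2 \<le> C\<^sup>2 * (7 * p)"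
    using assms(2) by (intro mult_left_mono) auto
  moreover have P: "0 \<le> C\<^sup>2 * p"
    using assms(4) by simp
  ultimately have 2: "C * H * G \<le> q + 86 * (C\<^sup>2 * p)"
    using 1 assms(1) by (simp only: mult.left_commute[of _ 7])
  have "0 \<le> (G - 7 * C * m)\<^sup>2" by simp
  then have "14 * (C * G * m) \<le> G\<^sup>2 + 49 * C\<^sup>2 * m\<^sup>2"
    by (simp add: power2_eq_square algebra_simps)
  moreover have "0 \<le> C\<^sup>2 * m\<^sup>2"
    by simp
  ultimately have "C * G * m \<le> p / 2 + 4 * (C\<^sup>2 * m\<^sup>2)"
    using assms(2) by (simp only: mult.assoc)
  then have "A * (C * G * m) \<le> A * (p / 2 + 4 * (C\<^sup>2 * m\<^sup>2))"
    using A by (rule mult_left_mono)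
  then have "q + A * p \<le> q + 86 * (C\<^sup>2 * p) + A * (p / 2 + 4 * (C\<^sup>2 * m\<^sup>2))"
    using 2 assms(3) unfolding A_def[symmetric] by linarith
  then have 3: "A * p / 2 \<le> 86 * (C\<^sup>2 * p) + 4 * (A * (C\<^sup>2 * m\<^sup>2))"
    by (simp add: algebra_simps)
  have "A * p = 174 * (C\<^sup>2 * p) + 2 * p"
    by (simp add: A_def algebra_simps)
  then have "p \<le> 4 * (A * (C\<^sup>2 * m\<^sup>2))"
    using 3 P by linarith
  then show ?thesis
    by (simp only: A_def mult.assoc)
qed

context spin
begin

abbreviation X :: "real \<Rightarrow> 7 \<Rightarrow> (real^7 \<Rightarrow> complex^8) \<Rightarrow> real^7 \<Rightarrow> complex^8" where
  "X a i \<equiv> left_deriv (frame a i)"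

lemma left_deriv_dirac:
  assumes a: "a \<noteq> 0" and f: "smooth f"
  shows "left_deriv v (dirac cl a f) x =
    (\<Sum>i\<in>UNIV. e i (left_deriv v (X a i f) x)) - (a / 4) *\<^sub>R omega (left_deriv v f x)"
proof -
  have bl: "bounded_linear (\<lambda>s. (- (a / 4)) *\<^sub>R omega s)"
    by (rule bounded_linear_compose[OF bounded_linear_scaleR_right bounded_linear_omega])
  have "dirac cl a f = (\<lambda>x. (\<Sum>i\<in>UNIV. e i (X a i f x)) + (- (a / 4)) *\<^sub>R omega (f x))"
    by (rule ext) (simp add: dirac_eq[OF a])
  moreover have "smooth (\<lambda>x. e i (X a i f x))" for i
    by (rule smooth_bounded_linear[OF bounded_linear_e smooth_left_deriv[OF f]])
  ultimately show ?thesis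
    by (simp only: left_deriv_add smooth_sum smooth_bounded_linear[OF bl f] left_deriv_sum
        left_deriv_bounded_linear[OF bl f] left_deriv_bounded_linear[OF bounded_linear_e smooth_left_deriv[OF f]]) simp
qed

lemma X_commutator:
  assumes "a \<noteq> 0" "smooth f"
  shows "X a i (X a j f) x = X a j (X a i f) x + (\<Sum>k\<in>UNIV. structure_const a i j k *\<^sub>R X a k f x)"
  using left_deriv_commutator[OF assms(2), of "frame a i" "frame a j" x]
  unfolding left_deriv_frame[OF assms, of "lie_bracket (frame a i) (frame a j)"] structure_const_def .

text \<open>Apply X_i to D f = 0, multiply by e_i and sum. The part symmetric in the indices is
  minus the sum of the X_k X_k by the Clifford relation; the rest consists of commutators and the
  derivative of the zero-order term, hence of first derivatives. The maps \<open>L\<close> are the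
  same for all \<open>f\<close>, which makes the later constants uniform.\<close>

lemma laplace_of_harmonic:
  assumes a: "a \<noteq> 0"
  obtains L where "\<And>k. bounded_linear (L k)"
    "\<And>f x. smooth f \<Longrightarrow> (\<And>x. dirac cl a f x = 0) \<Longrightarrow>
       (\<Sum>k\<in>UNIV. X a k (X a k f) x) = (\<Sum>k\<in>UNIV. L k (X a k f x))"
proof
  define L where "L k s = (1/2) *\<^sub>R (\<Sum>i\<in>UNIV. \<Sum>j\<in>UNIV. structure_const a j i k *\<^sub>R e j (e i s)) - (a / 4) *\<^sub>R e k (omega s)" for k s
  have ee: "bounded_linear (\<lambda>s. e j (e i s))" "bounded_linear (\<lambda>s. e k (omega s))" for i j k
    using bounded_linear_compose[OF bounded_linear_e bounded_linear_e]
      bounded_linear_compose[OF bounded_linear_e bounded_linear_omega] by auto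
  show "bounded_linear (L k)" for k
    unfolding L_def
    by (intro bounded_linear_sub bounded_linear_const_scaleR bounded_linear_sum ee)
  fix f x
  assume f: "smooth f" and D: "\<And>x. dirac cl a f x = 0"
  let ?c = "structure_const a" and ?h = "\<lambda>i j. X a i (X a j f) x"
  have "left_deriv v (dirac cl a f) x = 0" for v
  proof -
    have "dirac cl a f = (\<lambda>x. 0)"
      using D by auto
    then show ?thesis by (simp add: left_deriv_def)
  qed
  then have "(\<Sum>j\<in>UNIV. e j (?h i j)) = (a / 4) *\<^sub>R omega (X a i f x)" for i
    using left_deriv_dirac[OF a f] by simp
  then have S: "(\<Sum>i\<in>UNIV. \<Sum>j\<in>UNIV. e i (e j (?h i j))) = (\<Sum>i\<in>UNIV. (a / 4) *\<^sub>R e i (omega (X a i f x)))"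
    by (simp add: e_simps flip: e_sum)
  \<comment> \<open>Each term is paired with its mirror image. Exchanging the two derivatives in the
    mirror image costs a bracket term, after which the Clifford relation applies to a single
    vector.\<close>
  have pair: "e i (e j (?h i j)) + e j (e i (?h j i)) =
     (- 2 * (if i = j then 1 else 0)) *\<^sub>R ?h i j + (\<Sum>k\<in>UNIV. ?c j i k *\<^sub>R e j (e i (X a k f x)))" for i j
  proof -
    have "e j (e i (?h j i)) = e j (e i (?h i j)) + (\<Sum>k\<in>UNIV. ?c j i k *\<^sub>R e j (e i (X a k f x)))"
      unfolding X_commutator[OF a f, of j i] by (simp add: e_simps e_sum)
    then show ?thesis
      using clifford[of "axis i 1" "axis j 1" "?h i j"] by (simp add: inner_axis_axis add.assoc[symmetric])
  qed
  have 1: "2 *\<^sub>R (\<Sum>i\<in>UNIV. \<Sum>j\<in>UNIV. e i (e j (?h i j))) =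
     (\<Sum>i\<in>UNIV. \<Sum>j\<in>UNIV. e i (e j (?h i j)) + e j (e i (?h j i)))"
    unfolding sum.distrib scaleR_2 by (rule arg_cong[OF sum.swap])
  have 2: "(\<Sum>i\<in>UNIV. \<Sum>j\<in>UNIV. (- 2 * (if i = j then 1 else 0)) *\<^sub>R ?h i j) = - 2 *\<^sub>R (\<Sum>i\<in>UNIV. ?h i i)"
  proof -
    have "(\<Sum>j\<in>UNIV. (- 2 * (if i = j then 1 else 0)) *\<^sub>R ?h i j) = - 2 *\<^sub>R ?h i i" for i
      by (subst sum.remove[of _ i]) auto
    then show ?thesis by (simp add: scaleR_sum_right)
  qed
  have 3: "(\<Sum>i\<in>UNIV. \<Sum>j\<in>UNIV. \<Sum>k\<in>UNIV. ?c j i k *\<^sub>R e j (e i (X a k f x))) =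
      (\<Sum>k\<in>UNIV. \<Sum>i\<in>UNIV. \<Sum>j\<in>UNIV. ?c j i k *\<^sub>R e j (e i (X a k f x)))"
    by (rule sum_rotate)
  have "2 *\<^sub>R (\<Sum>i\<in>UNIV. ?h i i) = (\<Sum>k\<in>UNIV. \<Sum>i\<in>UNIV. \<Sum>j\<in>UNIV. ?c j i k *\<^sub>R e j (e i (X a k f x)))
       - 2 *\<^sub>R (\<Sum>i\<in>UNIV. (a / 4) *\<^sub>R e i (omega (X a i f x)))"
    using 1 unfolding S pair sum.distrib 2 3 by simp
  also have "\<dots> = 2 *\<^sub>R (\<Sum>k\<in>UNIV. L k (X a k f x))"
    unfolding L_def sum_subtractf scaleR_diff_right by (simp add: scaleR_sum_right)
  finally show "(\<Sum>k\<in>UNIV. X a k (X a k f) x) = (\<Sum>k\<in>UNIV. L k (X a k f x))"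
    by (simp only: scaleR_cancel_left) simp
qed

end

lemma abs_structure_const_le: "a \<noteq> 0 \<Longrightarrow> \<bar>structure_const a i j k\<bar> \<le> \<bar>a\<bar>"
  by (simp add: structure_const_eq)

lemma harmonic_spinorsD:
  assumes "f \<in> harmonic_spinors cl a \<Gamma>"
  shows "smooth f" "\<And>\<gamma> x. \<gamma> \<in> \<Gamma> \<Longrightarrow> f (\<gamma> \<star> x) = f x" "\<And>x. dirac cl a f x = 0"
  using assms by (auto simp: harmonic_spinors_def)

text \<open>Each functional cuts the dimension by at most one: a vector on which it does not vanish,
  together with a spanning set for its kernel in \<open>V\<close>, spans \<open>V\<close>. The
  subspace varies in the induction because the kernel takes the place of \<open>V\<close>.\<close>

lemma (in vector_space) finite_spanning_set_of_functionals:
  assumes "finite I" "subspace V"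
    and "\<And>i f g. i \<in> I \<Longrightarrow> \<phi> i (f + g) = \<phi> i f + \<phi> i g"
    and "\<And>i c f. i \<in> I \<Longrightarrow> \<phi> i (scale c f) = c * \<phi> i f"
    and "\<And>f. f \<in> V \<Longrightarrow> (\<And>i. i \<in> I \<Longrightarrow> \<phi> i f = 0) \<Longrightarrow> f = 0"
  shows "\<exists>B. finite B \<and> V \<subseteq> span B"
  using assms
proof (induction I arbitrary: V rule: finite_induct)
  case empty
  then have "V \<subseteq> span {}" by auto
  then show ?case by blast
next
  case (insert i I)
  have zero: "\<phi> i 0 = 0"
    using insert.prems(3)[of i 0 0] by simp
  define W where "W = {f \<in> V. \<phi> i f = 0}"
  have "subspace W"
    using insert.prems(1,2,3) zero unfolding subspace_def W_def by simp
  moreover have "f = 0" if "f \<in> W" "\<And>j. j \<in> I \<Longrightarrow> \<phi> j f = 0" for f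
    using that insert.prems(4)[of f] unfolding W_def by auto
  ultimately obtain B where B: "finite B" "W \<subseteq> span B"
    using insert.IH[of W] insert.prems(2,3) by (metis insertCI)
  show ?case
  proof (cases "W = V")
    case False
    then obtain v where v: "v \<in> V" "\<phi> i v \<noteq> 0"
      unfolding W_def by blast
    have "f \<in> span (insert v B)" if "f \<in> V" for f
    proof -
      let ?c = "\<phi> i f / \<phi> i v"
      have "\<phi> i (f + scale (- ?c) v) = 0"
        using insert.prems(2)[of i f "scale (- ?c) v"] insert.prems(3)[of i "- ?c" v] v(2) by simp
      moreover have "f + scale (- ?c) v \<in> V"
        using insert.prems(1) v(1) that by (intro subspace_add subspace_scale)
      ultimately have "f + scale (- ?c) v \<in> W"
        by (simp add: W_def)
      then have "f + scale (- ?c) v \<in> span (insert v B)"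
        using B(2) span_mono[of B "insert v B"] by blast
      moreover have "scale ?c v \<in> span (insert v B)"
        by (simp add: span_base span_scale)
      ultimately have "(f + scale (- ?c) v) + scale ?c v \<in> span (insert v B)"
        by (rule span_add)
      then show ?thesis by simp
    qed
    then show ?thesis
      using B(1) by blast
  qed (use B in blast)
qed

context spin
begin

text \<open>Bernstein's method: the Laplacian of \<open>\<bar>\<nabla>f\<bar>\<^sup>2 + A \<bar>f\<bar>\<^sup>2\<close> is nonpositive at a maximum, where
  for large \<open>A\<close> it bounds the gradient by \<open>f\<close>.\<close>

lemma gradient_estimate:
  assumes a: "a \<noteq> 0" and \<Gamma>: "cocompact_lattice \<Gamma>"
  obtains K where "K \<ge> 0" "\<And>f. f \<in> harmonic_spinors cl a \<Gamma> \<Longrightarrow>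
    \<exists>x0. \<forall>x. (norm (f x))\<^sup>2 + (\<Sum>i\<in>UNIV. (norm (X a i f x))\<^sup>2) \<le> K * (norm (f x0))\<^sup>2"
proof -
  obtain L where L: "\<And>k. bounded_linear (L k)"
    and lap: "\<And>f x. smooth f \<Longrightarrow> (\<And>x. dirac cl a f x = 0) \<Longrightarrow>
       (\<Sum>k\<in>UNIV. X a k (X a k f) x) = (\<Sum>k\<in>UNIV. L k (X a k f x))"
    using laplace_of_harmonic[OF a] by blast
  define C0 where "C0 = (\<Sum>k\<in>UNIV. onorm (L k))"
  have onorm_nonneg: "onorm (L k) \<ge> 0" for k
    using onorm_pos_le[OF L] .
  have C0: "norm (L k s) \<le> C0 * norm s" for k s
  proof -
    have "norm (L k s) \<le> onorm (L k) * norm s"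
      using onorm[OF L] .
    also have "\<dots> \<le> C0 * norm s"
      unfolding C0_def using onorm_nonneg by (intro mult_right_mono member_le_sum) auto
    finally show ?thesis .
  qed
  have C0_nonneg: "C0 \<ge> 0"
    unfolding C0_def by (intro sum_nonneg onorm_nonneg)
  \<comment> \<open>\<open>C0\<close> bounds the operators \<open>L k\<close>. The two summands |a|
    pay for the two commutators needed to bring X_i to the front of the third derivative X_k X_k X_i
    f.\<close>
  define C where "C = C0 + 2 * \<bar>a\<bar>"
  have C: "C \<ge> 0" "C0 \<le> C"
    using C0_nonneg by (auto simp: C_def)
  define A where "A = 174 * C\<^sup>2 + 2"
  have A: "A \<ge> 1"
    by (simp add: A_def)
  show thesis
  proof (rule that)
    show "0 \<le> 4 * A * C\<^sup>2 + A"
      using A by simp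
    fix f
    assume f: "f \<in> harmonic_spinors cl a \<Gamma>"
    note sf = harmonic_spinorsD(1)[OF f] and inv = harmonic_spinorsD(2)[OF f] and D = harmonic_spinorsD(3)[OF f]
    note lap = lap[OF sf D]
    define u where "u x = (\<Sum>i\<in>UNIV. X a i f x \<bullet> X a i f x) + A * (f x \<bullet> f x)" for x
    have "continuous_on UNIV u"
      unfolding u_def by (intro continuous_intros smooth_continuous_on smooth_left_deriv sf)
    moreover have "u (\<gamma> \<star> x) = u x" if "\<gamma> \<in> \<Gamma>" for \<gamma> x
      using inv[OF that] left_deriv_left_invariant[of f \<gamma>] by (simp add: u_def)
    \<comment> \<open>This point maximizes \<open>u\<close> and need not maximize the norm of
      \<open>f\<close>. Later only the value of \<open>f\<close> at this one point has to be shown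
      to vanish.\<close>
    ultimately obtain x0 where max: "\<And>x. u x \<le> u x0"
      using attains_maximum[OF \<Gamma>] by blast
    define h where "h i j = X a i (X a j f) x0" for i j
    define H where "H = (\<Sum>i\<in>UNIV. \<Sum>j\<in>UNIV. norm (h i j))"
    define G where "G = (\<Sum>i\<in>UNIV. norm (X a i f x0))"
    define q where "q = (\<Sum>i\<in>UNIV. \<Sum>j\<in>UNIV. (norm (h i j))\<^sup>2)"
    define p where "p = (\<Sum>i\<in>UNIV. (norm (X a i f x0))\<^sup>2)"
    define m where "m = norm (f x0)"
    have G0: "G \<ge> 0" and p0: "p \<ge> 0" and H0: "H \<ge> 0"
      by (auto simp: G_def p_def H_def intro!: sum_nonneg)
    have "H\<^sup>2 \<le> 49 * q"
    proof -
      have "H = (\<Sum>z\<in>UNIV. norm (h (fst z) (snd z)))" "q = (\<Sum>z\<in>UNIV. (norm (h (fst z) (snd z)))\<^sup>2)"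
        unfolding H_def q_def by (simp_all add: sum.cartesian_product case_prod_unfold)
      then show ?thesis
        using square_sum_le[of "\<lambda>z. norm (h (fst z) (snd z))" "UNIV :: (7 \<times> 7) set"] by simp
    qed
    moreover have "G\<^sup>2 \<le> 7 * p"
      using square_sum_le[of "\<lambda>i. norm (X a i f x0)" "UNIV :: 7 set"] by (simp add: G_def p_def)
    moreover have "q + A * p \<le> C * H * G + A * (C * G * m)"
    proof -
      have "(\<Sum>i\<in>UNIV. X a k (X a k (X a i f)) x0 \<bullet> X a i f x0 + h k i \<bullet> h k i)
          + A * (h k k \<bullet> f x0 + X a k f x0 \<bullet> X a k f x0) \<le> 0" for k
        unfolding h_def using max unfolding u_def
        by (intro laplace_at_max smooth_left_deriv sf)
      then have "(\<Sum>k\<in>UNIV. (\<Sum>i\<in>UNIV. X a k (X a k (X a i f)) x0 \<bullet> X a i f x0 + h k i \<bullet> h k i)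
          + A * (h k k \<bullet> f x0 + X a k f x0 \<bullet> X a k f x0)) \<le> 0"
        by (rule sum_nonpos)
      then have "(\<Sum>k\<in>UNIV. \<Sum>i\<in>UNIV. X a k (X a k (X a i f)) x0 \<bullet> X a i f x0) + q
          + A * ((\<Sum>k\<in>UNIV. h k k) \<bullet> f x0 + p) \<le> 0"
        by (simp add: sum.distrib q_def p_def power2_norm_eq_inner inner_sum_left flip: sum_distrib_left)
      then have "q + A * p \<le> - (\<Sum>i\<in>UNIV. (\<Sum>k\<in>UNIV. X a k (X a k (X a i f)) x0) \<bullet> X a i f x0)
          - A * ((\<Sum>k\<in>UNIV. h k k) \<bullet> f x0)"
        unfolding inner_sum_left by (subst sum.swap) (simp add: algebra_simps)
      moreover have "- (\<Sum>i\<in>UNIV. (\<Sum>k\<in>UNIV. X a k (X a k (X a i f)) x0) \<bullet> X a i f x0) \<le> C * H * G"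
      proof -
        have "norm (\<Sum>k\<in>UNIV. X a k (X a k (X a i f)) x0) \<le> C * H" for i
        proof -
          let ?c = "structure_const a"
          have 1: "X a k (X a k (X a i f)) x0 = X a i (X a k (X a k f)) x0
              + (\<Sum>l\<in>UNIV. ?c k i l *\<^sub>R h l k) + (\<Sum>l\<in>UNIV. ?c k i l *\<^sub>R h k l)" for k
          proof -
            have sm: "smooth (\<lambda>x. ?c k i l *\<^sub>R X a l f x)" for l
              by (rule smooth_bounded_linear[OF bounded_linear_scaleR_right smooth_left_deriv[OF sf]])
            have "X a k (X a i f) = (\<lambda>x. X a i (X a k f) x + (\<Sum>l\<in>UNIV. ?c k i l *\<^sub>R X a l f x))"
              using X_commutator[OF a sf] by (rule ext)
            then have "X a k (X a k (X a i f)) x0 = X a k (X a i (X a k f)) x0 + (\<Sum>l\<in>UNIV. ?c k i l *\<^sub>R h k l)"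
              by (simp only: left_deriv_add smooth_sum sm smooth_left_deriv sf left_deriv_sum h_def
                  left_deriv_bounded_linear[OF bounded_linear_scaleR_right smooth_left_deriv[OF sf]])
            moreover have "X a k (X a i (X a k f)) x0 = X a i (X a k (X a k f)) x0 + (\<Sum>l\<in>UNIV. ?c k i l *\<^sub>R h l k)"
              unfolding h_def by (rule X_commutator[OF a smooth_left_deriv[OF sf]])
            ultimately show ?thesis by simp
          qed
          \<comment> \<open>The formula for the Laplacian is an identity of functions and may be
            differentiated: third derivatives become second ones.\<close>
          have 2: "(\<Sum>k\<in>UNIV. X a i (X a k (X a k f)) x0) = (\<Sum>k\<in>UNIV. L k (h i k))"
          proof -
            have "(\<Sum>k\<in>UNIV. X a i (X a k (X a k f)) x0) = X a i (\<lambda>x. \<Sum>k\<in>UNIV. X a k (X a k f) x) x0"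
              by (simp add: left_deriv_sum smooth_left_deriv sf)
            also have "\<dots> = (\<Sum>k\<in>UNIV. L k (h i k))"
              unfolding lap h_def
              by (simp add: left_deriv_sum smooth_bounded_linear[OF L] smooth_left_deriv sf left_deriv_bounded_linear[OF L])
            finally show ?thesis .
          qed
          have le_H: "(\<Sum>k\<in>UNIV. norm (h i k)) \<le> H"
            unfolding H_def by (intro member_le_sum sum_nonneg) auto
          have "norm (\<Sum>k\<in>UNIV. L k (h i k)) \<le> (\<Sum>k\<in>UNIV. C0 * norm (h i k))"
            by (rule order_trans[OF norm_sum sum_mono[OF C0]])
          also have "\<dots> \<le> C0 * H"
            using le_H C0_nonneg by (simp add: mult_left_mono flip: sum_distrib_left)
          finally have n1: "norm (\<Sum>k\<in>UNIV. L k (h i k)) \<le> C0 * H" .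
          have n: "norm (\<Sum>k\<in>UNIV. \<Sum>l\<in>UNIV. ?c k i l *\<^sub>R g k l) \<le> \<bar>a\<bar> * (\<Sum>k\<in>UNIV. \<Sum>l\<in>UNIV. norm (g k l))"
            for g :: "7 \<Rightarrow> 7 \<Rightarrow> complex^8"
            unfolding sum_distrib_left
            by (intro order_trans[OF norm_sum sum_mono] order_trans[OF norm_sum sum_mono])
              (simp add: abs_structure_const_le a mult_right_mono)
          have n2: "norm (\<Sum>k\<in>UNIV. \<Sum>l\<in>UNIV. ?c k i l *\<^sub>R h l k) \<le> \<bar>a\<bar> * H"
            using n[of "\<lambda>k l. h l k"] sum.swap[of "\<lambda>k l. norm (h l k)" UNIV UNIV] by (simp add: H_def)
          have n3: "norm (\<Sum>k\<in>UNIV. \<Sum>l\<in>UNIV. ?c k i l *\<^sub>R h k l) \<le> \<bar>a\<bar> * H"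
            using n[of h] by (simp add: H_def)
          have "norm (\<Sum>k\<in>UNIV. X a k (X a k (X a i f)) x0) \<le> C0 * H + \<bar>a\<bar> * H + \<bar>a\<bar> * H"
            unfolding 1 sum.distrib 2 by (intro norm_triangle_le add_mono n1 n2 n3)
          then show ?thesis
            by (simp add: C_def algebra_simps)
        qed
        then have "- ((\<Sum>k\<in>UNIV. X a k (X a k (X a i f)) x0) \<bullet> X a i f x0) \<le> C * H * norm (X a i f x0)" for i
          by (metis (no_types, lifting) Cauchy_Schwarz_ineq2 abs_le_D2 mult_right_mono norm_ge_zero order_trans)
        then have "(\<Sum>i\<in>UNIV. - ((\<Sum>k\<in>UNIV. X a k (X a k (X a i f)) x0) \<bullet> X a i f x0)) \<le> (\<Sum>i\<in>UNIV. C * H * norm (X a i f x0))"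
          by (rule sum_mono)
        then show ?thesis
          by (simp add: sum_negf G_def sum_distrib_left)
      qed
      moreover have "- (A * ((\<Sum>k\<in>UNIV. h k k) \<bullet> f x0)) \<le> A * (C * G * m)"
      proof -
        have "norm (\<Sum>k\<in>UNIV. h k k) \<le> (\<Sum>k\<in>UNIV. C0 * norm (X a k f x0))"
          unfolding h_def lap by (rule order_trans[OF norm_sum sum_mono[OF C0]])
        also have "\<dots> \<le> C * G"
          unfolding G_def sum_distrib_left[symmetric] using C(2) G0[unfolded G_def] by (rule mult_right_mono)
        finally have "- ((\<Sum>k\<in>UNIV. h k k) \<bullet> f x0) \<le> C * G * m"
          unfolding m_def by (metis (no_types, lifting) Cauchy_Schwarz_ineq2 abs_le_D2 mult_right_mono norm_ge_zero order_trans)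
        then show ?thesis
          using A by (metis mult_left_mono mult_minus_right order_trans zero_le_one)
      qed
      ultimately show ?thesis by linarith
    qed
    ultimately have "p \<le> 4 * A * C\<^sup>2 * m\<^sup>2"
      unfolding A_def using absorb_mixed_terms p0 by blast
    then have ux0: "u x0 \<le> (4 * A * C\<^sup>2 + A) * m\<^sup>2"
      by (simp add: u_def p_def m_def power2_norm_eq_inner algebra_simps)
    have "(norm (f x))\<^sup>2 + (\<Sum>i\<in>UNIV. (norm (X a i f x))\<^sup>2) \<le> (4 * A * C\<^sup>2 + A) * (norm (f x0))\<^sup>2" for x
    proof -
      have "(norm (f x))\<^sup>2 \<le> A * (norm (f x))\<^sup>2"
        using A mult_right_mono[of 1 A "(norm (f x))\<^sup>2"] by simp
      then have "(norm (f x))\<^sup>2 + (\<Sum>i\<in>UNIV. (norm (X a i f x))\<^sup>2) \<le> u x"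
        unfolding u_def power2_norm_eq_inner by simp
      then show ?thesis
        using max[of x] ux0 unfolding m_def by linarith
    qed
    then show "\<exists>x0. \<forall>x. (norm (f x))\<^sup>2 + (\<Sum>i\<in>UNIV. (norm (X a i f x))\<^sup>2) \<le> (4 * A * C\<^sup>2 + A) * (norm (f x0))\<^sup>2"
      by blast
  qed
qed

section \<open>A finite net that determines harmonic spinors\<close>

lemma open_frame_ball: "open {x. \<forall>k. \<bar>left_metric a ((- p) \<star> x) (frame a k)\<bar> < \<delta>}"
proof -
  have "{x. \<forall>k. \<bar>left_metric a ((- p) \<star> x) (frame a k)\<bar> < \<delta>} =
      (\<Inter>k\<in>UNIV. {x. \<bar>left_metric a ((- p) \<star> x) (frame a k)\<bar> < \<delta>})"
    by auto
  moreover have "open {x. \<bar>left_metric a ((- p) \<star> x) (frame a k)\<bar> < \<delta>}" for k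
    unfolding left_metric_def
    by (intro open_Collect_less continuous_intros continuous_on_nil_mult)
  ultimately show ?thesis
    by auto
qed

lemma nil_mult_left_inverse: "p \<star> ((- p) \<star> x) = x"
  using nil_mult_cancel[of "- p" x] by simp

text \<open>Let x0 be the point from the gradient estimate. A translate of x0 is reached from a net
  point, where \<open>f\<close> vanishes, along a curve so short that \<open>f\<close> grows by at
  most half of |f(x0)|. Hence f(x0) = 0, and the estimate then gives f = 0 everywhere.\<close>

lemma harmonic_determined_by_finite_set:
  assumes a: "a \<noteq> 0" and \<Gamma>: "cocompact_lattice \<Gamma>"
  obtains P where "finite P" "\<And>f. f \<in> harmonic_spinors cl a \<Gamma> \<Longrightarrow> (\<And>p. p \<in> P \<Longrightarrow> f p = 0) \<Longrightarrow> f = 0"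
proof -
  obtain K where K: "K \<ge> 0" "\<And>f. f \<in> harmonic_spinors cl a \<Gamma> \<Longrightarrow>
    \<exists>x0. \<forall>x. (norm (f x))\<^sup>2 + (\<Sum>i\<in>UNIV. (norm (X a i f x))\<^sup>2) \<le> K * (norm (f x0))\<^sup>2"
    using gradient_estimate[OF assms] by metis
  \<comment> \<open>Seven frame directions, each with coordinate below \<delta> and derivative at
    most sqrt K |f(x0)|, must contribute at most |f(x0)|/2 in total. The summand 1 covers K =
    0.\<close>
  define \<delta> where "\<delta> = 1 / (14 * (sqrt K + 1))"
  have \<delta>: "\<delta> > 0" "7 * \<delta> * sqrt K \<le> 1 / 2"
    using K(1) by (auto simp: \<delta>_def field_simps add_pos_nonneg)
  define B where "B p = {x. \<forall>k. \<bar>left_metric a ((- p) \<star> x) (frame a k)\<bar> < \<delta>}" for p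
  obtain R where R: "\<And>x. \<exists>\<gamma>\<in>\<Gamma>. norm (\<gamma> \<star> x) \<le> R"
    using \<Gamma> compact_nilmanifold_bounded unfolding cocompact_lattice_def by blast
  have "p \<in> B p" for p
  proof -
    have "(- p) \<star> p = 0"
      using nil_mult_cancel[of p 0] by (simp add: nil_mult_zero)
    then show ?thesis
      using \<delta>(1) by (simp add: B_def left_metric_def)
  qed
  then have "cball 0 R \<subseteq> (\<Union>p\<in>cball 0 R. B p)"
    by blast
  moreover have "open (B p)" for p
    unfolding B_def by (rule open_frame_ball)
  ultimately obtain P where P: "finite P" "cball 0 R \<subseteq> (\<Union>p\<in>P. B p)"
    using compactE_image[OF compact_cball, of "cball 0 R" B] by metis
  show thesis
  proof (rule that[OF P(1)])
    fix f
    assume f: "f \<in> harmonic_spinors cl a \<Gamma>" and P0: "\<And>p. p \<in> P \<Longrightarrow> f p = 0"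
    note sf = harmonic_spinorsD(1)[OF f]
    obtain x0 where x0: "\<And>x. (norm (f x))\<^sup>2 + (\<Sum>i\<in>UNIV. (norm (X a i f x))\<^sup>2) \<le> K * (norm (f x0))\<^sup>2"
      using K(2)[OF f] by blast
    have Xle: "norm (X a i f x) \<le> sqrt K * norm (f x0)" for i x
    proof -
      have "(norm (X a i f x))\<^sup>2 \<le> (\<Sum>i\<in>UNIV. (norm (X a i f x))\<^sup>2)"
        by (intro member_le_sum) auto
      also have "\<dots> \<le> K * (norm (f x0))\<^sup>2"
        using x0[of x] zero_le_power2[of "norm (f x)"] by linarith
      also have "\<dots> = (sqrt K * norm (f x0))\<^sup>2"
        using K(1) by (simp add: power_mult_distrib)
      finally show ?thesis
        by (rule power2_le_imp_le) (simp add: K(1))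
    qed
    obtain \<gamma> where \<gamma>: "\<gamma> \<in> \<Gamma>" "norm (\<gamma> \<star> x0) \<le> R"
      using R by blast
    then obtain p where p: "p \<in> P" "\<gamma> \<star> x0 \<in> B p"
      using P(2) by (metis (no_types, lifting) UN_E dist_0_norm mem_cball subsetD)
    \<comment> \<open>The inverse of \<open>p\<close> is \<open>- p\<close>, so \<open>v\<close>
      generates the one-parameter curve that leads from \<open>p\<close> at time 0 to the translate
      of \<open>x0\<close> at time 1.\<close>
    define v where "v = (- p) \<star> (\<gamma> \<star> x0)"
    have v: "\<bar>left_metric a v (frame a k)\<bar> < \<delta>" for k
      using p(2) by (simp add: B_def v_def)
    have Dv: "norm (left_deriv v f x) \<le> norm (f x0) / 2" for x
    proof -
      have "norm (left_deriv v f x) \<le> (\<Sum>k\<in>UNIV. norm (left_metric a v (frame a k) *\<^sub>R X a k f x))"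
        unfolding left_deriv_frame[OF a sf, of v] by (rule norm_sum)
      also have "\<dots> \<le> (\<Sum>k\<in>(UNIV::7 set). \<delta> * (sqrt K * norm (f x0)))"
        using v Xle \<delta>(1) by (intro sum_mono) (simp add: mult_mono less_imp_le)
      also have "\<dots> = (7 * \<delta> * sqrt K) * norm (f x0)"
        by simp
      also have "\<dots> \<le> 1 / 2 * norm (f x0)"
        using \<delta>(2) by (rule mult_right_mono) simp
      finally show ?thesis by simp
    qed
    have hd: "((\<lambda>t. f (p \<star> (t *\<^sub>R v))) has_derivative (\<lambda>h. h *\<^sub>R left_deriv v f (p \<star> (t *\<^sub>R v)))) (at t)" for t
      using has_vector_derivative_left_deriv[OF sf] by (simp add: has_vector_derivative_def)
    have "continuous_on {0..1} (\<lambda>t. f (p \<star> (t *\<^sub>R v)))"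
      using hd has_derivative_continuous continuous_at_imp_continuous_on by blast
    then obtain z where "norm (f (p \<star> (1 *\<^sub>R v)) - f (p \<star> (0 *\<^sub>R v))) \<le> norm ((1 - 0) *\<^sub>R left_deriv v f (p \<star> (z *\<^sub>R v)))"
      using mvt_general[of 0 1 "\<lambda>t. f (p \<star> (t *\<^sub>R v))" "\<lambda>t h. h *\<^sub>R left_deriv v f (p \<star> (t *\<^sub>R v))"] hd by auto
    moreover have "p \<star> (1 *\<^sub>R v) = \<gamma> \<star> x0"
      by (simp add: v_def nil_mult_left_inverse)
    ultimately have "norm (f x0) \<le> norm (left_deriv v f (p \<star> (z *\<^sub>R v)))"
      using P0[OF p(1)] harmonic_spinorsD(2)[OF f \<gamma>(1)] by (simp add: nil_mult_zero)
    then have "norm (f x0) = 0"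
      using Dv[of "p \<star> (z *\<^sub>R v)"] norm_ge_zero[of "f x0"] by linarith
    have "f x = 0" for x
    proof -
      have "(norm (f x))\<^sup>2 + (\<Sum>i\<in>UNIV. (norm (X a i f x))\<^sup>2) \<le> 0"
        using x0[of x] \<open>norm (f x0) = 0\<close> by simp
      moreover have "(\<Sum>i\<in>UNIV. (norm (X a i f x))\<^sup>2) \<ge> 0"
        by (intro sum_nonneg) auto
      ultimately have "(norm (f x))\<^sup>2 \<le> 0"
        by linarith
      then show ?thesis by simp
    qed
    then show "f = 0"
      by (simp add: fun_eq_iff)
  qed
qed

lemma bounded_linear_complex_scale: "bounded_linear (\<lambda>s::complex^'n. c *s s)"
  by (rule linear_conv_bounded_linear[THEN iffD1], rule linearI) (simp_all add: vec_eq_iff algebra_simps)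

lemma complex_scale_matrix: "A *v (c *s s) = c *s (A *v (s :: complex^'n))"
  by (simp add: vec_eq_iff matrix_vector_mult_def sum_distrib_left mult_ac)

lemma omega_complex_scale: "omega (c *s s) = c *s omega s"
  by (simp add: omega_def complex_scale_matrix vector_add_ldistrib)

lemma dirac_add:
  assumes "a \<noteq> 0" "smooth f" "smooth g"
  shows "dirac cl a (\<lambda>x. f x + g x) x = dirac cl a f x + dirac cl a g x"
  unfolding dirac_eq[OF assms(1)] left_deriv_add[OF assms(2,3)]
  by (simp add: e_simps sum.distrib linear_add[OF bounded_linear.linear[OF bounded_linear_omega]] scaleR_add_right)

lemma dirac_scale:
  assumes "a \<noteq> 0" "smooth f"
  shows "dirac cl a (\<lambda>x. c *s f x) x = c *s dirac cl a f x"
proof -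
  have sc: "r *\<^sub>R (c *s s) = c *s (r *\<^sub>R s)" for r and s :: "complex^8"
    by (simp add: vec_eq_iff)
  have sub: "c *s (s - t) = c *s s - c *s t" for s t :: "complex^8"
    by (simp add: vec_eq_iff algebra_simps)
  have sm: "c *s sum f A = (\<Sum>i\<in>A. c *s f i)" for f :: "7 \<Rightarrow> complex^8" and A
    by (simp add: vec_eq_iff sum_distrib_left)
  show ?thesis
    unfolding dirac_eq[OF assms(1)] left_deriv_bounded_linear[OF bounded_linear_complex_scale assms(2)]
    by (simp only: complex_scale_matrix omega_complex_scale sc sub sm)
qed

lemma harmonic_subspace:
  assumes "a \<noteq> 0"
  shows "spinor_fields.subspace (harmonic_spinors cl a \<Gamma>)"
  unfolding spinor_fields.subspace_def
proof (intro conjI ballI allI)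
  have "left_deriv v 0 x = 0" for v and x :: "real^7"
    by (simp add: left_deriv_def)
  then show "0 \<in> harmonic_spinors cl a \<Gamma>"
    using smooth_zero by (simp add: harmonic_spinors_def dirac_eq[OF assms] zero_fun_def
        e_simps linear_0[OF bounded_linear.linear[OF bounded_linear_omega]])
next
  fix f g
  assume f: "f \<in> harmonic_spinors cl a \<Gamma>" and g: "g \<in> harmonic_spinors cl a \<Gamma>"
  then show "f + g \<in> harmonic_spinors cl a \<Gamma>"
    using smooth_add dirac_add[OF assms] by (auto simp: harmonic_spinors_def plus_fun_def)
next
  fix f c
  assume f: "f \<in> harmonic_spinors cl a \<Gamma>"
  then show "spinor_scale c f \<in> harmonic_spinors cl a \<Gamma>"
    using smooth_bounded_linear[OF bounded_linear_complex_scale] dirac_scale[OF assms]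
    by (auto simp: harmonic_spinors_def spinor_scale_def)
qed

lemma harmonic_finite_dimensional:
  assumes a: "a \<noteq> 0" and \<Gamma>: "cocompact_lattice \<Gamma>"
  shows "\<exists>B. finite B \<and> harmonic_spinors cl a \<Gamma> \<subseteq> spinor_fields.span B"
proof -
  obtain P where P: "finite P" "\<And>f. f \<in> harmonic_spinors cl a \<Gamma> \<Longrightarrow> (\<And>p. p \<in> P \<Longrightarrow> f p = 0) \<Longrightarrow> f = 0"
    using harmonic_determined_by_finite_set[OF assms] by blast
  show ?thesis
  proof (rule spinor_fields.finite_spanning_set_of_functionals[of "P \<times> (UNIV :: 8 set)" _ "\<lambda>(p, i) f. f p $ i"])
    fix f
    assume "f \<in> harmonic_spinors cl a \<Gamma>" "\<And>z. z \<in> P \<times> (UNIV :: 8 set) \<Longrightarrow> (case z of (p, i) \<Rightarrow> \<lambda>f. f p $ i) f = 0"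
    then show "f = 0"
      using P(2)[of f] by (auto simp: vec_eq_iff)
  qed (use P(1) harmonic_subspace[OF a] in \<open>auto simp: spinor_scale_def\<close>)
qed

end


subsection \<open>Parity of the dimension\<close>

context spin
begin

abbreviation T4 :: "(real^7 \<Rightarrow> complex^8) \<Rightarrow> real^7 \<Rightarrow> complex^8" where
  "T4 \<equiv> left_deriv (axis 4 1)"

lemma frame_4: "frame a 4 = axis 4 1"
  by (simp add: frame_def)

lemma lie_bracket_axis_4: "lie_bracket (axis 4 1) v = 0"
  by (simp add: lie_bracket_def) (simp add: axis_def)

lemma T4_commute:
  assumes "smooth f"
  shows "T4 (left_deriv v f) x = left_deriv v (T4 f) x"
proof -
  have "left_deriv 0 f x = 0"
    using linear_0[OF left_deriv_linear[OF assms]] .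
  then show ?thesis
    using left_deriv_commutator[OF assms, of "axis 4 1" v x] by (simp add: lie_bracket_axis_4)
qed

lemma bounded_linear_real_structure: "bounded_linear \<sigma>"
proof -
  have \<sigma>: "\<sigma> (s + t) = \<sigma> s + \<sigma> t" "\<sigma> (c *s s) = cnj c *s \<sigma> s" for s t c
    using spinor_module by (auto simp: spinor_module_def real_structure_def)
  have "\<sigma> (r *\<^sub>R s) = r *\<^sub>R \<sigma> s" for r s
  proof -
    have "r *\<^sub>R t = complex_of_real r *s t" for t :: "complex^8"
      unfolding vec_eq_iff vector_scaleR_component vector_smult_component
      by (simp add: scaleR_conv_of_real)
    then show ?thesis
      using \<sigma>(2)[of "complex_of_real r" s] by simp
  qed
  then show ?thesis
    by (intro linear_conv_bounded_linear[THEN iffD1] linearI \<sigma>(1))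
qed

lemma real_structure_simps:
  "\<sigma> (s + t) = \<sigma> s + \<sigma> t" "\<sigma> (c *s s) = cnj c *s \<sigma> s" "\<sigma> (\<sigma> s) = s" "\<sigma> (e i s) = e i (\<sigma> s)"
  using spinor_module by (auto simp: spinor_module_def real_structure_def)

lemma real_structure_omega: "\<sigma> (omega s) = omega (\<sigma> s)"
  by (simp add: omega_def real_structure_simps)

lemma dirac_real_structure:
  assumes "a \<noteq> 0" "smooth f"
  shows "dirac cl a (\<lambda>x. \<sigma> (f x)) x = \<sigma> (dirac cl a f x)"
  unfolding dirac_eq[OF assms(1)] left_deriv_bounded_linear[OF bounded_linear_real_structure assms(2)]
  by (simp add: real_structure_simps real_structure_omega linear_sum linear_diff linear_cmul
      bounded_linear.linear[OF bounded_linear_real_structure])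

lemma harmonic_real_structure:
  assumes "a \<noteq> 0" "f \<in> harmonic_spinors cl a \<Gamma>"
  shows "(\<lambda>x. \<sigma> (f x)) \<in> harmonic_spinors cl a \<Gamma>"
  using assms(2) smooth_bounded_linear[OF bounded_linear_real_structure] dirac_real_structure[OF assms(1)]
  by (auto simp: harmonic_spinors_def linear_0 bounded_linear.linear[OF bounded_linear_real_structure])

lemma harmonic_T4:
  assumes "a \<noteq> 0" "f \<in> harmonic_spinors cl a \<Gamma>"
  shows "T4 f \<in> harmonic_spinors cl a \<Gamma>"
proof -
  note f = harmonic_spinorsD[OF assms(2)]
  have "dirac cl a (T4 f) x = T4 (dirac cl a f) x" for x
    unfolding dirac_eq[OF assms(1)] left_deriv_dirac[OF assms(1) f(1)] T4_commute[OF f(1)] ..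
  moreover have "dirac cl a f = (\<lambda>x. 0)"
    using f(3) by auto
  ultimately have "dirac cl a (T4 f) x = 0" for x
    by (simp add: left_deriv_def)
  then show ?thesis
    using f left_deriv_left_invariant[of f] smooth_left_deriv by (auto simp: harmonic_spinors_def)
qed

text \<open>\<open>e 4\<close> anticommutes with the other generators, and passing the three factors
  of each term of \<open>omega\<close> gives the sign -1. The only term of the Dirac operator with
  the wrong sign contains the derivative along e4, which is zero here; so D(e4 f) = -e4 D f.\<close>

lemma harmonic_e4:
  assumes a: "a \<noteq> 0" and f: "f \<in> harmonic_spinors cl a \<Gamma>" and 0: "T4 f = 0"
  shows "(\<lambda>x. e 4 (f x)) \<in> harmonic_spinors cl a \<Gamma>" "T4 (\<lambda>x. e 4 (f x)) = 0"
proof -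
  note sf = harmonic_spinorsD(1)[OF f]
  note d = left_deriv_bounded_linear[OF bounded_linear_e sf]
  have X4: "X a 4 f x = 0" for x
    using 0 by (simp add: frame_4)
  have "dirac cl a (\<lambda>x. e 4 (f x)) x = - e 4 (dirac cl a f x)" for x
  proof -
    have "(\<Sum>i\<in>UNIV. e i (e 4 (X a i f x))) = (\<Sum>i\<in>UNIV. - e 4 (e i (X a i f x)))"
    proof (rule sum.cong[OF refl])
      fix i :: 7
      show "e i (e 4 (X a i f x)) = - e 4 (e i (X a i f x))"
        using e_anticommute[of i 4 "X a i f x"] X4 by (cases "i = 4") (auto simp: e_simps)
    qed
    moreover have "omega (e 4 s) = - e 4 (omega s)" for s
      by (simp add: omega_def e_reorder e_simps)
    ultimately show ?thesis
      unfolding dirac_eq[OF a] d by (simp add: e_simps e_sum sum_negf)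
  qed
  then show "(\<lambda>x. e 4 (f x)) \<in> harmonic_spinors cl a \<Gamma>"
    using harmonic_spinorsD[OF f] smooth_bounded_linear[OF bounded_linear_e]
    by (auto simp: harmonic_spinors_def e_simps)
  show "T4 (\<lambda>x. e 4 (f x)) = 0"
    using d 0 by (auto simp: fun_eq_iff e_simps)
qed

lemma derivative_at_max:
  fixes f g :: "real^7 \<Rightarrow> complex^8"
  assumes \<Gamma>: "cocompact_lattice \<Gamma>" and "smooth f" "smooth g"
    and inv: "\<And>\<gamma> x. \<gamma> \<in> \<Gamma> \<Longrightarrow> f (\<gamma> \<star> x) = f x" "\<And>\<gamma> x. \<gamma> \<in> \<Gamma> \<Longrightarrow> g (\<gamma> \<star> x) = g x"
  obtains x0 where "\<And>x. f x \<bullet> g x \<le> f x0 \<bullet> g x0"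
    "left_deriv v f x0 \<bullet> g x0 + f x0 \<bullet> left_deriv v g x0 = 0"
proof -
  have "continuous_on UNIV (\<lambda>x. f x \<bullet> g x)"
    by (intro continuous_intros smooth_continuous_on assms)
  then obtain x0 where x0: "\<And>x. f x \<bullet> g x \<le> f x0 \<bullet> g x0"
    using attains_maximum[OF \<Gamma>, of "\<lambda>x. f x \<bullet> g x"] inv by auto
  have "left_deriv v f x0 \<bullet> g x0 + f x0 \<bullet> left_deriv v g x0 = 0"
    using DERIV_local_max[OF inner_curve_derivative[OF assms(2,3), of x0 v 0], of 1] x0
    by (simp add: nil_mult_zero)
  then show thesis
    using that x0 by blast
qed

text \<open>For r \<noteq> 0 the derivative of |f|^2, which is 2r|f|^2, vanishes at a maximum. For r
  = 0 the function g would be affine with slope f along the curves of E4, against boundedness. To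
  see this at a maximum, take the product of g + A f with f: its derivative is |f|^2, so f vanishes
  where the product is maximal, the maximum is 0, and A |f|^2 is bounded by minus the product of g
  and f, for every real A.\<close>

lemma no_real_eigenvalue_of_T4:
  assumes \<Gamma>: "cocompact_lattice \<Gamma>" and g: "g \<in> harmonic_spinors cl a \<Gamma>" and f: "f \<in> harmonic_spinors cl a \<Gamma>"
    and "f = T4 g" and ev: "T4 f = (\<lambda>x. r *\<^sub>R f x)"
  shows "f = 0"
proof (cases "r = 0")
  case False
  obtain x0 where x0: "\<And>x. f x \<bullet> f x \<le> f x0 \<bullet> f x0" "T4 f x0 \<bullet> f x0 + f x0 \<bullet> T4 f x0 = 0"
    using derivative_at_max[OF \<Gamma> harmonic_spinorsD(1)[OF f] harmonic_spinorsD(1)[OF f]] harmonic_spinorsD(2)[OF f]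
    by metis
  have "f x0 \<bullet> f x0 = 0"
    using x0(2) False by (simp add: ev)
  then have "f x = 0" for x
    using x0(1)[of x] by (metis inner_eq_zero_iff inner_ge_zero antisym)
  then show ?thesis by (simp add: fun_eq_iff)
next
  case True
  have "A * (f x \<bullet> f x) \<le> - (g x \<bullet> f x)" for A x
  proof -
    have sA: "smooth (\<lambda>x. A *\<^sub>R f x)"
      by (rule smooth_bounded_linear[OF bounded_linear_scaleR_right harmonic_spinorsD(1)[OF f]])
    have T: "T4 (\<lambda>x. g x + A *\<^sub>R f x) x = f x" for x
      unfolding left_deriv_add[OF harmonic_spinorsD(1)[OF g] sA]
        left_deriv_bounded_linear[OF bounded_linear_scaleR_right harmonic_spinorsD(1)[OF f]]
      unfolding assms(4)[symmetric] by (simp add: ev True)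
    obtain x0 where x0: "\<And>x. (g x + A *\<^sub>R f x) \<bullet> f x \<le> (g x0 + A *\<^sub>R f x0) \<bullet> f x0"
      "T4 (\<lambda>x. g x + A *\<^sub>R f x) x0 \<bullet> f x0 + (g x0 + A *\<^sub>R f x0) \<bullet> T4 f x0 = 0"
      using derivative_at_max[OF \<Gamma> smooth_add[OF harmonic_spinorsD(1)[OF g] sA] harmonic_spinorsD(1)[OF f]]
        harmonic_spinorsD(2)[OF f] harmonic_spinorsD(2)[OF g] by (metis (no_types, lifting))
    have "f x0 = 0"
      using x0(2) True by (simp add: T ev)
    then show ?thesis
      using x0(1)[of x] by (simp add: inner_add_left)
  qed
  note A = this
  have "f x = 0" for x
  proof (rule ccontr)
    assume "f x \<noteq> 0"
    then have "f x \<bullet> f x > 0" by simp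
    \<comment> \<open>For this \<open>A\<close> the left-hand side is 1 minus the inner product of
      \<open>g x\<close> and \<open>f x\<close>, so the inequality becomes 1 \<le> 0.\<close>
    then show False
      using A[of "(1 - g x \<bullet> f x) / (f x \<bullet> f x)" x] by simp
  qed
  then show ?thesis by (simp add: fun_eq_iff)
qed

lemma spinor_scale_of_real: "spinor_scale (of_real r) f = (\<lambda>x. r *\<^sub>R f x)"
  unfolding spinor_scale_def fun_eq_iff vec_eq_iff vector_scaleR_component vector_smult_component
  by (simp add: scaleR_conv_of_real)

lemma harmonic_even_dimensional:
  assumes a: "a \<noteq> 0" and \<Gamma>: "cocompact_lattice \<Gamma>"
  shows "even_dimensional (harmonic_spinors cl a \<Gamma>)"
proof -
  let ?V = "harmonic_spinors cl a \<Gamma>"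
  define S where "S f = (\<lambda>x. \<sigma> (f x))" for f :: "real^7 \<Rightarrow> complex^8"
  note V = harmonic_subspace[OF a, of \<Gamma>]
  note vs = spinor_fields.vector_space_axioms
  obtain C where C: "finite C" "?V \<subseteq> spinor_fields.span C"
    using harmonic_finite_dimensional[OF assms] by blast
  have T_add: "T4 (f + g) = T4 f + T4 g" if "f \<in> ?V" "g \<in> ?V" for f g
    using left_deriv_add[OF harmonic_spinorsD(1)[OF that(1)] harmonic_spinorsD(1)[OF that(2)]]
    by (simp add: fun_eq_iff plus_fun_def)
  have T_sc: "T4 (spinor_scale c f) = spinor_scale c (T4 f)" if "f \<in> ?V" for f c
    using left_deriv_bounded_linear[OF bounded_linear_complex_scale harmonic_spinorsD(1)[OF that]]
    by (simp add: fun_eq_iff spinor_scale_def)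
  have TV: "T4 f \<in> ?V" if "f \<in> ?V" for f
    by (rule harmonic_T4[OF a that])
  have S: "S (f + g) = S f + S g" "S (spinor_scale c f) = spinor_scale (cnj c) (S f)" "S (S f) = f" for f g c
    by (simp_all add: S_def spinor_scale_def fun_eq_iff real_structure_simps)
  have SV: "S f \<in> ?V" if "f \<in> ?V" for f
    unfolding S_def by (rule harmonic_real_structure[OF a that])
  have TS: "T4 (S f) = S (T4 f)" if "f \<in> ?V" for f
    unfolding S_def using left_deriv_bounded_linear[OF bounded_linear_real_structure harmonic_spinorsD(1)[OF that]]
    by (rule ext)
  have T0: "T4 0 = 0"
    using T_sc[of 0 0] spinor_fields.subspace_0[OF V] by (simp add: spinor_fields.scale_zero_left)
  have S0: "S 0 = 0"
    using S(2)[of 0 0] by simp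
  have even_ker: "even (spinor_fields.dim {f \<in> ?V. T4 f = 0})"
  proof (rule even_dim_of_no_real_eigenvalue[OF vs _ C(1), where S = S and T = "\<lambda>f x. e 4 (f x)"])
    show "spinor_fields.subspace {f \<in> ?V. T4 f = 0}"
      using V T0 unfolding spinor_fields.subspace_def by (simp add: T_add T_sc)
    show "{f \<in> ?V. T4 f = 0} \<subseteq> spinor_fields.span C"
      using C(2) by blast
    show "(\<lambda>x. e 4 ((f + g) x)) = (\<lambda>x. e 4 (f x)) + (\<lambda>x. e 4 (g x))" for f g :: "real^7 \<Rightarrow> complex^8"
      by (simp add: fun_eq_iff e_simps)
    show "(\<lambda>x. e 4 (spinor_scale c f x)) = spinor_scale c (\<lambda>x. e 4 (f x))" for c and f :: "real^7 \<Rightarrow> complex^8"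
      by (simp add: fun_eq_iff spinor_scale_def complex_scale_matrix)
    show "(\<lambda>x. e 4 (f x)) \<in> {f \<in> ?V. T4 f = 0}" if "f \<in> {f \<in> ?V. T4 f = 0}" for f
      using harmonic_e4[OF a] that by blast
    show "S f \<in> {f \<in> ?V. T4 f = 0}" if "f \<in> {f \<in> ?V. T4 f = 0}" for f
      using that SV TS S0 by simp
    show "(\<lambda>x. e 4 (S f x)) = S (\<lambda>x. e 4 (f x))" for f
      by (simp add: S_def real_structure_simps)
    show "f = 0" if "(\<lambda>x. e 4 (f x)) = spinor_scale (of_real r) f" for f r
    proof -
      have e4: "e 4 (f x) = r *\<^sub>R f x" for x
        using that by (simp add: spinor_scale_of_real fun_eq_iff)
      have "f x = 0" for x
      proof -
        have "e 4 (e 4 (f x)) = (r * r) *\<^sub>R f x"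
          by (simp add: e4 e_simps)
        then have "(r * r) *\<^sub>R f x = - f x"
          by (simp only: e_squared)
        then have "(r * r + 1) *\<^sub>R f x = 0"
          by (simp add: scaleR_add_left)
        moreover have "r * r + 1 \<noteq> 0"
          using zero_le_square[of r] by linarith
        ultimately show ?thesis by simp
      qed
      then show ?thesis by (simp add: fun_eq_iff)
    qed
  qed (auto simp: S)
  have even_im: "even (spinor_fields.dim (T4 ` ?V))"
  proof (rule even_dim_of_no_real_eigenvalue[OF vs _ C(1), where S = S and T = T4])
    have im: "T4 ` ?V \<subseteq> ?V"
      using TV by blast
    show "spinor_fields.subspace (T4 ` ?V)"
      unfolding spinor_fields.subspace_def
    proof (intro conjI ballI allI)
      show "0 \<in> T4 ` ?V"
        using T0 spinor_fields.subspace_0[OF V] by (metis imageI)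
      show "f + g \<in> T4 ` ?V" if fg: "f \<in> T4 ` ?V" "g \<in> T4 ` ?V" for f g
      proof -
        obtain f' g' where "f' \<in> ?V" "g' \<in> ?V" "f = T4 f'" "g = T4 g'"
          using fg by blast
        then show ?thesis
          using T_add spinor_fields.subspace_add[OF V] by (metis imageI)
      qed
      show "spinor_scale c f \<in> T4 ` ?V" if fg: "f \<in> T4 ` ?V" for f c
      proof -
        obtain f' where "f' \<in> ?V" "f = T4 f'"
          using fg by blast
        then show ?thesis
          using T_sc spinor_fields.subspace_scale[OF V] by (metis imageI)
      qed
    qed
    show "T4 ` ?V \<subseteq> spinor_fields.span C"
      using im C(2) by blast
    show "T4 (f + g) = T4 f + T4 g" if "f \<in> T4 ` ?V" "g \<in> T4 ` ?V" for f g
      using that im T_add by blast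
    show "T4 (spinor_scale c f) = spinor_scale c (T4 f)" if "f \<in> T4 ` ?V" for f c
      using that im T_sc by blast
    show "T4 f \<in> T4 ` ?V" if "f \<in> T4 ` ?V" for f
      using that im by blast
    show "S f \<in> T4 ` ?V" if f: "f \<in> T4 ` ?V" for f
    proof -
      obtain g where g: "g \<in> ?V" "f = T4 g"
        using f by blast
      have "S f = T4 (S g)"
        unfolding g(2) TS[OF g(1)] ..
      then show ?thesis
        using SV[OF g(1)] by (rule image_eqI)
    qed
    show "T4 (S f) = S (T4 f)" if "f \<in> T4 ` ?V" for f
      using that im TS by blast
    show "f = 0" if "f \<in> T4 ` ?V" "T4 f = spinor_scale (of_real r) f" for f r
      using that im no_real_eigenvalue_of_T4[OF \<Gamma>] unfolding spinor_scale_of_real by blast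
  qed (auto simp: S)
  have "even (spinor_fields.dim ?V)"
    using spinor_fields.rank_nullity_on[OF V C T_add T_sc] even_ker even_im by simp
  moreover obtain B where B: "B \<subseteq> ?V" "spinor_fields.independent B" "?V \<subseteq> spinor_fields.span B" "card B = spinor_fields.dim ?V"
    using spinor_fields.basis_exists by blast
  moreover have "finite B"
    using spinor_fields.independent_span_bound[OF C(1) B(2)] B(1) C(2) by blast
  moreover have "spinor_fields.span B = ?V"
    using B(1,3) spinor_fields.span_minimal[OF B(1) V] by blast
  ultimately show ?thesis
    unfolding even_dimensional_def by metis
qed

end


subsection \<open>Harmonic plane waves\<close>

context spin
begin

text \<open>Rotating the \<open>(2, 3)\<close>- and \<open>(6, 7)\<close>-planes simultaneously, the covector \<open>(x\<^sub>1, x\<^sub>2, x\<^sub>3)\<close> becomes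
  \<open>(x\<^sub>1, r, 0)\<close> and \<open>omega = e\<^sub>1 v w + e\<^sub>1 v' w'\<close>. On a joint eigenspace of \<open>v' w'\<close> and \<open>e\<^sub>1 v w\<close> the symbol
  is \<open>Y\<close> plus a scalar, where \<open>Y\<^sup>2\<close> is scalar and \<open>Y\<close> anticommutes with \<open>w\<close>.\<close>

lemma symbol_kernel:
  fixes x1 x2 x3 \<mu> :: real
  assumes eq: "x1\<^sup>2 + x2\<^sup>2 + x3\<^sup>2 = 2 * \<mu> * x1"
  obtains s where "s \<noteq> 0"
    "(\<i> * x1) *s e 1 s + (\<i> * x2) *s e 2 s + (\<i> * x3) *s e 3 s + complex_of_real \<mu> *s omega s = 0"
proof -
  define r where "r = sqrt (x2\<^sup>2 + x3\<^sup>2)"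
  have r2: "r\<^sup>2 = x2\<^sup>2 + x3\<^sup>2"
    by (simp add: r_def)
  \<comment> \<open>Polar coordinates of (x2, x3); at the origin any direction will do.\<close>
  obtain c d where cd: "c\<^sup>2 + d\<^sup>2 = 1" "x2 = r * c" "x3 = r * d"
  proof (cases "r = 0")
    case True
    then have "x2 = 0" "x3 = 0"
      using r2 by (simp_all add: sum_power2_eq_zero_iff)
    then show ?thesis
      using that[of 1 0] True by simp
  next
    case False
    then have "(x2 / r)\<^sup>2 + (x3 / r)\<^sup>2 = 1"
      unfolding power_divide add_divide_distrib[symmetric] r2[symmetric] by simp
    then show ?thesis
      using that[of "x2 / r" "x3 / r"] False by simp
  qed
  define u v v' w w' :: "real^7" where "u = axis 1 1"
    and "v = c *\<^sub>R axis 2 1 + d *\<^sub>R axis 3 1" and "v' = (- d) *\<^sub>R axis 2 1 + c *\<^sub>R axis 3 1"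
    and "w = c *\<^sub>R axis 6 1 + d *\<^sub>R axis 7 1" and "w' = (- d) *\<^sub>R axis 6 1 + c *\<^sub>R axis 7 1"
  note defs = u_def v_def v'_def w_def w'_def
  have cd': "c * c + d * d = 1" "d * d + c * c = 1"
    using cd(1) by (simp_all add: power2_eq_square add.commute)
  have orth: "u \<bullet> u = 1" "v \<bullet> v = 1" "v' \<bullet> v' = 1" "w \<bullet> w = 1" "w' \<bullet> w' = 1"
    "v \<bullet> u = 0" "v' \<bullet> u = 0" "w \<bullet> u = 0" "w' \<bullet> u = 0" "v' \<bullet> v = 0" "w \<bullet> v = 0" "w' \<bullet> v = 0"
    "w \<bullet> v' = 0" "w' \<bullet> v' = 0" "w' \<bullet> w = 0"
    using cd' by (simp_all add: defs inner_add_left inner_add_right inner_diff_left inner_diff_right inner_axis_axis)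
  define A V V' W W' where "A s = cl u *v s" and "V s = cl v *v s" and "V' s = cl v' *v s"
    and "W s = cl w *v s" and "W' s = cl w' *v s" for s
  note ops = A_def V_def V'_def W_def W'_def
  have sq: "cl y *v (cl y *v s) = - s" if "y \<bullet> y = 1" for y s
  proof -
    have "2 *\<^sub>R (cl y *v (cl y *v s)) = 2 *\<^sub>R (- s)"
      using clifford[of y y s] that by (simp flip: scaleR_2)
    then show ?thesis
      by (simp only: scaleR_cancel_left) simp
  qed
  have ac: "cl y *v (cl z *v s) = - (cl z *v (cl y *v s))" if "y \<bullet> z = 0" for y z s
    using clifford[of y z s] that by (simp add: eq_neg_iff_add_eq_0)
  have squares: "A (A s) = - s" "V (V s) = - s" "V' (V' s) = - s" "W (W s) = - s" "W' (W' s) = - s" for s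
    unfolding ops by (rule sq, rule orth)+
  have swaps: "V (A s) = - A (V s)" "V' (A s) = - A (V' s)" "W (A s) = - A (W s)" "W' (A s) = - A (W' s)"
    "V' (V s) = - V (V' s)" "W (V s) = - V (W s)" "W' (V s) = - V (W' s)"
    "W (V' s) = - V' (W s)" "W' (V' s) = - V' (W' s)" "W' (W s) = - W (W' s)" for s
    unfolding ops by (rule ac, rule orth)+
  have neg: "M *v (- s) = - (M *v s)" for M :: "complex^8^8" and s
    using linear_neg[OF bounded_linear.linear[OF bounded_linear_matrix_vector_complex]] .
  have lin: "A (s + t) = A s + A t" "A (c *s s) = c *s A s" "A (- s) = - A s" "A (s - t) = A s - A t"
    "V (s + t) = V s + V t" "V (c *s s) = c *s V s" "V (- s) = - V s" "V (s - t) = V s - V t"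
    "V' (s + t) = V' s + V' t" "V' (c *s s) = c *s V' s" "V' (- s) = - V' s" "V' (s - t) = V' s - V' t"
    "W (s + t) = W s + W t" "W (c *s s) = c *s W s" "W (- s) = - W s" "W (s - t) = W s - W t"
    "W' (s + t) = W' s + W' t" "W' (c *s s) = c *s W' s" "W' (- s) = - W' s" "W' (s - t) = W' s - W' t"
    for s t c
    unfolding ops by (rule matrix_vector_right_distrib complex_scale_matrix neg matrix_vector_mult_diff_distrib)+
  note alg = squares swaps lin
  have nonzero: "V s \<noteq> 0" "V' s \<noteq> 0" "W s \<noteq> 0" "W' s \<noteq> 0" if "s \<noteq> 0" for s
    using that squares[of s] lin(6,10,14,18)[of 0 0] by auto
  define F where "F s = (\<i> * x1) *s A s + (\<i> * r) *s V s + complex_of_real \<mu> *s (A (V (W s)) + A (V' (W' s)))" for s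
  have F_eq: "(\<i> * x1) *s e 1 s + (\<i> * x2) *s e 2 s + (\<i> * x3) *s e 3 s + complex_of_real \<mu> *s omega s = F s" for s
  proof -
    have cl_lin: "cl (p *\<^sub>R y + q *\<^sub>R z) *v t = complex_of_real p *s (cl y *v t) + complex_of_real q *s (cl z *v t)" for p q y z t
      by (simp add: linear_add[OF linear_cl] linear_cmul[OF linear_cl] matrix_vector_mult_add_rdistrib)
        (simp add: vec_eq_iff matrix_vector_mult_def sum_distrib_left scaleR_conv_of_real[where 'a = complex] mult.assoc)
    have ccd: "complex_of_real c * complex_of_real c + complex_of_real d * complex_of_real d = 1"
      using cd'(1) by (metis of_real_1 of_real_add of_real_mult)
    have om: "A (V (W s)) + A (V' (W' s)) = omega s"
    proof -
      have "V (W s) + V' (W' s) = (complex_of_real c * complex_of_real c + complex_of_real d * complex_of_real d) *s (e 2 (e 6 s) + e 3 (e 7 s))"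
        unfolding ops v_def v'_def w_def w'_def cl_lin
        by (simp add: matrix_vector_right_distrib complex_scale_matrix vec_eq_iff algebra_simps)
      then have "V (W s) + V' (W' s) = e 2 (e 6 s) + e 3 (e 7 s)"
        by (simp add: ccd)
      then show ?thesis
        unfolding lin(1)[symmetric] by (simp add: A_def u_def omega_def e_simps)
    qed
    have "(\<i> * r) *s V s = (\<i> * x2) *s e 2 s + (\<i> * x3) *s e 3 s"
      unfolding V_def v_def cl_lin cd(2,3) by (simp add: vec_eq_iff algebra_simps)
    then show ?thesis
      unfolding F_def om by (simp add: A_def u_def add.assoc)
  qed
  obtain z :: "complex^8" where "z \<noteq> 0"
    by (metis zero_neq_one)
  \<comment> \<open>The product of \<open>V'\<close> and \<open>W'\<close> squares to -1, so adding
    \<i> times its value projects, up to a factor, onto the eigenspace of -\<i>. If the result is 0,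
    then \<open>z\<close> belongs to the eigenvalue \<i>, and \<open>V'\<close>, which anticommutes
    with the product, exchanges the two eigenspaces.\<close>
  obtain s0 where s0: "s0 \<noteq> 0" "V' (W' s0) = (- \<i>) *s s0"
  proof (cases "z + \<i> *s V' (W' z) = 0")
    case False
    then show ?thesis
      using that[of "z + \<i> *s V' (W' z)"] by (simp add: alg)
  next
    case True
    have "V' (W' z) = \<i> *s z"
    proof -
      have "\<i> *s (z + \<i> *s V' (W' z)) = 0"
        using True by simp
      then show ?thesis
        by (simp add: vec_eq_iff algebra_simps)
    qed
    then show ?thesis
      using that[of "V' z"] nonzero(2)[OF \<open>z \<noteq> 0\<close>] by (simp add: alg)
  qed
  \<comment> \<open>The product of \<open>A\<close>, \<open>V\<close> and \<open>W\<close> squares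
    to 1 and commutes with that of \<open>V'\<close> and \<open>W'\<close>, so it has an eigenvector
    with eigenvalue \<open>p\<close> = 1 or -1 inside the eigenspace just found. Which sign occurs
    is left open.\<close>
  obtain s1 p where s1: "s1 \<noteq> 0" "V' (W' s1) = (- \<i>) *s s1" "A (V (W s1)) = p *s s1" "p * p = (1::complex)"
  proof (cases "s0 + A (V (W s0)) = 0")
    case True
    then have "A (V (W s0)) = (- 1) *s s0"
      by (simp add: vec_eq_iff eq_neg_iff_add_eq_0 add.commute)
    then show ?thesis
      using that[of s0 "- 1"] s0 by simp
  next
    case False
    then show ?thesis
    proof (intro that[of "s0 + A (V (W s0))" 1])
      have "V' (W' (A (V (W s0)))) = A (V (W (V' (W' s0))))"
        by (simp add: alg)
      then show "V' (W' (s0 + A (V (W s0)))) = (- \<i>) *s (s0 + A (V (W s0)))"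
        unfolding lin s0(2) by (simp add: vec_eq_iff algebra_simps)
    qed (auto simp: alg add.commute)
  qed
  \<comment> \<open>On the eigenspace of -\<i> the term with \<open>V'\<close> and \<open>W'\<close>
    becomes a multiple of \<open>A\<close> and shifts x1 to x1 - \<mu>. The hypothesis on the
    covector is exactly (x1 - \<mu>)^2 + r^2 = \<mu>^2, so that \<open>Y\<close> squares to
    \<mu>^2.\<close>
  define Y where "Y s = (\<i> * (x1 - \<mu>)) *s A s + (\<i> * r) *s V s" for s
  have F: "F s = Y s + (\<mu> * p) *s s" if "V' (W' s) = (- \<i>) *s s" "A (V (W s)) = p *s s" for s
    unfolding F_def Y_def that(2) that(1) lin by (simp add: vec_eq_iff algebra_simps)
  have YY: "Y (Y s) = complex_of_real (\<mu>\<^sup>2) *s s" for s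
  proof -
    have "(x1 - \<mu>)\<^sup>2 + r\<^sup>2 = \<mu>\<^sup>2"
      using eq r2 by (simp add: power2_eq_square algebra_simps)
    then have "complex_of_real (\<mu>\<^sup>2) = complex_of_real ((x1 - \<mu>)\<^sup>2 + r\<^sup>2)"
      by simp
    moreover have "Y (Y s) = complex_of_real ((x1 - \<mu>)\<^sup>2 + r\<^sup>2) *s s"
      unfolding Y_def by (simp add: alg) (simp add: vec_eq_iff power2_eq_square algebra_simps)
    ultimately show ?thesis by simp
  qed
  \<comment> \<open>(Y + \<mu> p)(Y - \<mu> p) = 0, so the second factor maps \<open>s1\<close> into
    the kernel of the first. If that image is 0, then \<open>W\<close> carries \<open>s1\<close> to
    an eigenvector of \<open>Y\<close> with the opposite eigenvalue and preserves both other
    eigenspaces.\<close>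
  have "\<exists>s. s \<noteq> 0 \<and> F s = 0"
  proof (cases "Y s1 - (\<mu> * p) *s s1 = 0")
    case False
    let ?s = "Y s1 - (\<mu> * p) *s s1"
    have "V' (W' ?s) = (- \<i>) *s ?s" "A (V (W ?s)) = p *s ?s"
    proof -
      have "V' (W' (Y s1)) = Y (V' (W' s1))" "A (V (W (Y s1))) = Y (A (V (W s1)))"
        unfolding Y_def by (simp_all add: alg)
      moreover have "Y (c *s t) = c *s Y t" for c t
        unfolding Y_def by (simp add: lin) (simp add: vec_eq_iff algebra_simps)
      ultimately have "V' (W' (Y s1)) = (- \<i>) *s Y s1" "A (V (W (Y s1))) = p *s Y s1"
        by (simp_all only: s1(2,3))
      then show "V' (W' ?s) = (- \<i>) *s ?s" "A (V (W ?s)) = p *s ?s"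
        unfolding lin s1(2,3) by (simp_all add: vec_eq_iff algebra_simps)
    qed
    then have "F ?s = Y ?s + (\<mu> * p) *s ?s"
      by (rule F)
    also have "Y ?s = Y (Y s1) - (\<mu> * p) *s Y s1"
      unfolding Y_def by (simp add: lin) (simp add: vec_eq_iff algebra_simps)
    also have "\<dots> + (\<mu> * p) *s ?s = 0"
      unfolding YY using s1(4) by (simp add: vec_eq_iff power2_eq_square algebra_simps)
    finally show ?thesis
      using False by blast
  next
    case True
    have "V' (W' (W s1)) = (- \<i>) *s W s1" "A (V (W (W s1))) = p *s W s1"
    proof -
      have "V' (W' (W s1)) = W (V' (W' s1))" "A (V (W (W s1))) = W (A (V (W s1)))"
        by (simp_all add: alg)
      then show "V' (W' (W s1)) = (- \<i>) *s W s1" "A (V (W (W s1))) = p *s W s1"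
        unfolding s1(2,3) lin .
    qed
    then have "F (W s1) = Y (W s1) + (\<mu> * p) *s W s1"
      by (rule F)
    also have "Y (W s1) = - W (Y s1)"
      unfolding Y_def by (simp add: alg)
    also have "Y s1 = (\<mu> * p) *s s1"
      using True by simp
    also have "- W ((\<mu> * p) *s s1) + (\<mu> * p) *s W s1 = 0"
      by (simp add: lin)
    finally show ?thesis
      using nonzero(3)[OF s1(1)] by blast
  qed
  then show thesis
    using that F_eq by metis
qed

text \<open>The phase depends only on coordinates to which brackets do not contribute, so it is a
  homomorphism to the reals, and the wave descends to the quotient if the phase maps \<Gamma> into
  the multiples of 2 pi. The factor -a/4 is the coefficient of \<open>omega\<close> in
  \<open>dirac_eq\<close>, here in the role of \<mu>.\<close>

lemma plane_wave_harmonic: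
  fixes x1 x2 x3 :: real
  assumes a: "a \<noteq> 0" and x1: "x1 \<noteq> 0" and eq: "x1\<^sup>2 + x2\<^sup>2 + x3\<^sup>2 = 2 * (- a / 4) * x1"
    and \<Gamma>: "\<And>\<gamma>. \<gamma> \<in> \<Gamma> \<Longrightarrow> \<exists>n::int. x1 * \<gamma> $ 1 + x2 * \<gamma> $ 2 + x3 * \<gamma> $ 3 = 2 * pi * n"
  shows "\<exists>\<psi>\<in>harmonic_spinors cl a \<Gamma>. \<psi> \<noteq> 0 \<and> \<not> invariant_spinor \<psi>"
proof -
  obtain s where s: "s \<noteq> 0"
    "(\<i> * x1) *s e 1 s + (\<i> * x2) *s e 2 s + (\<i> * x3) *s e 3 s + complex_of_real (- a / 4) *s omega s = 0"
    using symbol_kernel[OF eq] by blast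
  define l where "l x = x1 * x $ 1 + x2 * x $ 2 + x3 * x $ 3" for x :: "real^7"
  have l: "linear l"
    by (rule linearI) (simp_all add: l_def algebra_simps)
  define \<psi> where "\<psi> x = exp (\<i> * of_real (l x)) *s s" for x
  note sm = smooth_plane_wave[OF l, where s = s, folded \<psi>_def]
  have D: "left_deriv v \<psi> x = (\<i> * of_real (l v)) *s \<psi> x" for v x
  proof -
    have "l (v + (1/2) *\<^sub>R lie_bracket x v) = l v"
      by (simp add: l_def lie_bracket_nth)
    then show ?thesis
      unfolding left_deriv_frechet[OF smooth_differentiable[OF sm(1)]] frechet_derivative_eqI[OF sm(2)] by simp
  qed
  have "dirac cl a \<psi> x = 0" for x
  proof -
    have lf: "l (frame a 1) = x1" "l (frame a 2) = x2" "l (frame a 3) = x3" "l (frame a 4) = 0"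
      "l (frame a 5) = 0" "l (frame a 6) = 0" "l (frame a 7) = 0"
      by (simp_all add: l_def frame_def axis_def)
    have sc: "r *\<^sub>R t = complex_of_real r *s t" for r and t :: "complex^8"
      unfolding vec_eq_iff vector_scaleR_component vector_smult_component
      by (simp add: scaleR_conv_of_real)
    have "dirac cl a \<psi> x = exp (\<i> * of_real (l x)) *s
       ((\<i> * x1) *s e 1 s + (\<i> * x2) *s e 2 s + (\<i> * x3) *s e 3 s + complex_of_real (- a / 4) *s omega s)"
      unfolding dirac_eq[OF a] D sum_7 lf sc \<psi>_def complex_scale_matrix omega_complex_scale
      by (simp add: vec_eq_iff algebra_simps)
    then show ?thesis
      unfolding s(2) by simp
  qed
  moreover have "\<psi> (\<gamma> \<star> x) = \<psi> x" if \<gamma>: "\<gamma> \<in> \<Gamma>" for \<gamma> x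
  proof -
    obtain n :: int where "l \<gamma> = 2 * pi * n"
      using \<Gamma>[OF \<gamma>] by (auto simp: l_def)
    moreover have "l (\<gamma> \<star> x) = l \<gamma> + l x"
      by (simp add: l_def nil_mult_eq lie_bracket_nth algebra_simps)
    ultimately have "exp (\<i> * of_real (l (\<gamma> \<star> x))) = exp (\<i> * of_real (l x) + of_int (2 * n) * (of_real pi * \<i>))"
      by (simp add: algebra_simps)
    also have "\<dots> = exp (\<i> * of_real (l x))"
      by (subst exp_eq) (rule exI[of _ n], simp)
    finally show ?thesis
      by (simp add: \<psi>_def)
  qed
  ultimately have "\<psi> \<in> harmonic_spinors cl a \<Gamma>"
    using sm(1) by (simp add: harmonic_spinors_def)
  moreover have "\<psi> 0 = s"
    by (simp add: \<psi>_def l_def)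
  \<comment> \<open>Half a period along E1 changes the sign of the wave, which is therefore not
    constant; this is where x1 \<noteq> 0 enters.\<close>
  moreover have "\<psi> ((pi / x1) *\<^sub>R axis 1 1) = - s"
  proof -
    have "l ((pi / x1) *\<^sub>R axis 1 1) = pi"
      using x1 by (simp add: l_def) (simp add: axis_def)
    then show ?thesis
      by (simp add: \<psi>_def mult.commute vec_eq_iff)
  qed
  moreover have "s \<noteq> - s"
  proof
    assume "s = - s"
    then have "s $ i = 0" for i
      by (metis add.inverse_unique eq_neg_iff_add_eq_0 mult_2 mult_eq_0_iff vector_uminus_component zero_neq_numeral)
    then show False
      using s(1) by (simp add: vec_eq_iff)
  qed
  ultimately show ?thesis
    using s(1) unfolding invariant_spinor_def by (metis zero_fun_apply)
qed

end


subsection \<open>Lattices\<close>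

text \<open>Elements of \<open>S\<close> cannot compensate a displacement orthogonal to their span,
  and one of length R + 1 is too long to be left uncompensated.\<close>

lemma span_of_coarsely_dense:
  fixes S :: "'a::euclidean_space set"
  assumes R: "\<And>y. \<exists>s\<in>S. norm (s + y) \<le> R"
  shows "span S = UNIV"
proof (rule ccontr)
  assume "span S \<noteq> UNIV"
  then have "span S \<subset> span (UNIV :: 'a set)"
    by auto
  then obtain z where z: "z \<noteq> 0" "\<And>y. y \<in> span S \<Longrightarrow> orthogonal z y"
    using orthogonal_to_subspace_exists_gen by metis
  obtain s where s: "s \<in> S" "norm (s + ((R + 1) / norm z) *\<^sub>R z) \<le> R"
    using R by blast
  have "R \<ge> 0"
    using R[of 0] norm_ge_zero order_trans by blast
  have "z \<bullet> s = 0"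
    using z(2)[of s] s(1) by (simp add: orthogonal_def span_base)
  then have "z \<bullet> (s + ((R + 1) / norm z) *\<^sub>R z) = (R + 1) * norm z"
    using z(1) by (simp add: inner_add_right dot_square_norm power2_eq_square)
  moreover have "z \<bullet> (s + ((R + 1) / norm z) *\<^sub>R z) \<le> norm z * R"
    using norm_cauchy_schwarz[of z] s(2) by (meson mult_left_mono norm_ge_zero order_trans)
  ultimately have "(R + 1) * norm z \<le> R * norm z"
    by (simp add: mult.commute)
  then show False
    using z(1) by simp
qed

text \<open>Modulo the subgroup generated by a basis contained in \<open>S\<close>, multiples of an element of \<open>S\<close> can be
  moved to a fixed bounded set, which contains only finitely many elements of \<open>S\<close>. Hence a common
  multiple of the coordinates with respect to the basis takes integer values on \<open>S\<close>.\<close>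

lemma discrete_subgroup_integral_functional:
  fixes S :: "'a::euclidean_space set"
  assumes zero: "0 \<in> S" and add: "\<And>x y. x \<in> S \<Longrightarrow> y \<in> S \<Longrightarrow> x + y \<in> S" and neg: "\<And>x. x \<in> S \<Longrightarrow> - x \<in> S"
    and \<epsilon>: "\<epsilon> > 0" "\<And>x. x \<in> S \<Longrightarrow> norm x < \<epsilon> \<Longrightarrow> x = 0"
    and span: "span S = UNIV" and z: "z \<noteq> 0"
  obtains \<xi> :: "'a \<Rightarrow> real" where "linear \<xi>" "\<And>s. s \<in> S \<Longrightarrow> \<xi> s \<in> \<int>" "\<xi> z \<noteq> 0"
proof -
  obtain B where B: "B \<subseteq> S" "independent B" "S \<subseteq> span B"
    using maximal_independent_subset by blast
  have spanB: "span B = UNIV"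
    using span span_minimal[OF B(3)] by auto
  have fin: "finite B"
    using B(2) independent_imp_finite by blast
  define \<rho> where "\<rho> b x = representation B x b" for b x
  have lin: "linear (\<rho> b)" for b
    unfolding \<rho>_def using linear_representation[OF B(2) spanB] by (simp add: linear_def real_scaleR_def[abs_def])
  have expand: "x = (\<Sum>b\<in>B. \<rho> b x *\<^sub>R b)" for x
    unfolding \<rho>_def using sum_representation_eq[OF B(2) _ fin order_refl, of x] spanB by simp
  have nat_mult: "real k *\<^sub>R x \<in> S" if "x \<in> S" for k x
    by (induction k) (auto simp: zero add that scaleR_add_left)
  have int_mult: "real_of_int k *\<^sub>R x \<in> S" if "x \<in> S" for k x
    using nat_mult[OF that, of "nat k"] nat_mult[OF neg[OF that], of "nat (- k)"] by (cases "k \<ge> 0") auto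
  have sum_S: "(\<Sum>b\<in>F. real_of_int (k b) *\<^sub>R b) \<in> S" if "F \<subseteq> B" for F k
    using finite_subset[OF that fin] that
    by (induction F rule: finite_induct) (use B(1) in \<open>auto simp: zero intro!: add int_mult\<close>)
  define M where "M = (\<Sum>b\<in>B. norm b)"
  define K where "K = S \<inter> cball 0 M"
  have finK: "finite K"
  proof (rule ccontr)
    assume "infinite K"
    then obtain x where "x islimpt K"
      using Heine_Borel_imp_Bolzano_Weierstrass[of "cball 0 M" K] by (auto simp: K_def)
    moreover have "y = x" if "x \<in> K" "y \<in> K" "dist y x < \<epsilon>" for x y
      using \<epsilon>(2)[of "y - x"] add[of y "- x"] neg[of x] that by (simp add: K_def dist_norm)
    ultimately show False
      using discrete_imp_not_islimpt[OF \<epsilon>(1)] by metis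
  qed
  \<comment> \<open>Among the card K + 1 multiples of \<open>s\<close> with factors 0, ..., card K,
    two reach the same point of \<open>K\<close>. The difference of their factors is at most card K
    and so divides this factorial, which does not depend on \<open>s\<close>.\<close>
  define N where "N = fact (card K) * (1::real)"
  have "N * \<rho> b s \<in> \<int>" if s: "s \<in> S" for s b
  proof (cases "b \<in> B")
    case False
    then have "\<rho> b s = 0"
      unfolding \<rho>_def using representation_ne_zero by blast
    then show ?thesis by simp
  next
    case True
    \<comment> \<open>The k-th multiple of \<open>s\<close>, reduced by integral combinations of the
      basis to a vector whose coordinates are fractional parts.\<close>
    define h where "h k = real k *\<^sub>R s + (\<Sum>b\<in>B. real_of_int (- \<lfloor>real k * \<rho> b s\<rfloor>) *\<^sub>R b)" for k
    have h: "h k = (\<Sum>b\<in>B. frac (real k * \<rho> b s) *\<^sub>R b)" for k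
    proof -
      have "real k *\<^sub>R s = (\<Sum>b\<in>B. (real k * \<rho> b s) *\<^sub>R b)"
        by (subst expand) (simp add: scaleR_sum_right)
      then show ?thesis
        unfolding h_def by (simp add: frac_def scaleR_diff_left sum_subtractf sum_negf)
    qed
    have "h k \<in> K" for k
    proof -
      have "norm (h k) \<le> (\<Sum>b\<in>B. norm (frac (real k * \<rho> b s) *\<^sub>R b))"
        unfolding h by (rule norm_sum)
      also have "\<dots> \<le> M"
        unfolding M_def
      proof (rule sum_mono)
        fix b
        have "\<bar>frac (real k * \<rho> b s)\<bar> \<le> 1"
          using frac_lt_1[of "real k * \<rho> b s"] frac_ge_0[of "real k * \<rho> b s"] by simp
        then show "norm (frac (real k * \<rho> b s) *\<^sub>R b) \<le> norm b"
          using mult_right_mono[of "\<bar>frac (real k * \<rho> b s)\<bar>" 1 "norm b"] by simp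
      qed
      finally have "norm (h k) \<le> M" .
      moreover have "h k \<in> S"
        unfolding h_def by (rule add[OF nat_mult[OF s] sum_S[OF order_refl]])
      ultimately show ?thesis
        by (simp add: K_def)
    qed
    then have "h ` {..card K} \<subseteq> K"
      by blast
    then have "card (h ` {..card K}) \<le> card K"
      by (rule card_mono[OF finK])
    then have "\<not> inj_on h {..card K}"
      using pigeonhole[of h "{..card K}"] by simp
    then obtain i j where ij: "i < j" "j \<le> card K" "h i = h j"
      unfolding inj_on_def by (metis atMost_iff linorder_neqE_nat)
    have "(\<Sum>b\<in>B. (frac (real j * \<rho> b s) - frac (real i * \<rho> b s)) *\<^sub>R b) = 0"
      using ij(3) unfolding h by (simp add: scaleR_diff_left sum_subtractf)
    then have "frac (real j * \<rho> b s) = frac (real i * \<rho> b s)"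
      using independentD[OF B(2) fin order_refl _ True] by fastforce
    then have "(real j - real i) * \<rho> b s = of_int (\<lfloor>real j * \<rho> b s\<rfloor> - \<lfloor>real i * \<rho> b s\<rfloor>)"
      by (simp add: frac_def algebra_simps)
    then have int: "(real j - real i) * \<rho> b s \<in> \<int>"
      by (simp only: Ints_of_int)
    obtain m where "fact (card K) = (j - i) * m"
    proof -
      have "j - i dvd fact (card K)"
        using ij by (intro dvd_fact) auto
      then show ?thesis
        using that by (auto elim: dvdE)
    qed
    then have "N = real ((j - i) * m)"
      unfolding N_def by (metis mult.right_neutral of_nat_fact)
    then have "N * \<rho> b s = real m * ((real j - real i) * \<rho> b s)"
      using ij(1) by (simp add: of_nat_diff)
    then show ?thesis
      using Ints_mult[OF Ints_of_nat int] by (simp only:)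
  qed
  moreover obtain b where "\<rho> b z \<noteq> 0"
    using expand[of z] z by (metis (no_types, lifting) scaleR_zero_left sum.neutral)
  moreover have "N \<noteq> 0"
    by (simp add: N_def)
  moreover have "linear (\<lambda>x. N * \<rho> b x)" for b
    using linear_compose_scale_right[OF lin, of N b] by simp
  ultimately show thesis
    using that[of "\<lambda>x. N * \<rho> b x"] by simp
qed

text \<open>The center of the Lie algebra is spanned by E4, ..., E7, so this is the quotient of the
  group by its center. It is a homomorphism to an additive group, and the bracket depends only on
  the images of its arguments.\<close>

definition proj3 :: "real^7 \<Rightarrow> real^3" where
  "proj3 x = vector [x $ 1, x $ 2, x $ 3]"

lemma proj3_nth: "proj3 x $ 1 = x $ 1" "proj3 x $ 2 = x $ 2" "proj3 x $ 3 = x $ 3"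
  by (simp_all add: proj3_def)

lemma norm_proj3_le: "norm (proj3 x) \<le> norm x"
proof -
  have "(norm (proj3 x))\<^sup>2 \<le> (norm x)\<^sup>2"
    unfolding power2_norm_eq_inner inner_vec_def sum_3 sum_7 proj3_nth by simp
  then show ?thesis
    by (rule power2_le_imp_le) simp
qed

lemma norm_lie_bracket_le: "norm (lie_bracket x y) \<le> 4 * norm (proj3 x) * norm (proj3 y)"
proof -
  have m: "\<bar>proj3 x $ i * proj3 y $ j\<bar> \<le> norm (proj3 x) * norm (proj3 y)" for i j
    unfolding abs_mult by (intro mult_mono component_le_norm_cart) auto
  have "norm (lie_bracket x y) \<le> \<bar>x $ 1 * y $ 2 - x $ 2 * y $ 1\<bar> + \<bar>x $ 1 * y $ 3 - x $ 3 * y $ 1\<bar>"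
    unfolding lie_bracket_def
    by (rule order_trans[OF norm_triangle_ineq4]) simp
  then show ?thesis
    using m[of 1 2] m[of 2 1] m[of 1 3] m[of 3 1] unfolding proj3_nth by linarith
qed

text \<open>In exponential coordinates of a two-step group the group commutator is the Lie bracket
  itself, without the factor 1/2.\<close>

lemma commutator_in_subgroup:
  assumes "subgroup \<Gamma> nil_group" "\<gamma> \<in> \<Gamma>" "\<delta> \<in> \<Gamma>"
  shows "lie_bracket \<gamma> \<delta> \<in> \<Gamma>"
proof -
  have "lie_bracket \<gamma> \<delta> = \<gamma> \<star> \<delta> \<star> (- \<gamma>) \<star> (- \<delta>)"
    by (simp add: vec_eq_iff nil_mult_eq lie_bracket_nth field_simps)
  then show ?thesis
    using assms subgroup_nil_groupD[OF assms(1)] by simp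
qed

text \<open>The image of a discrete group under a projection may well be dense. Here, if \<delta>
  has a small projection, its brackets with finitely many lattice elements whose projections form a
  basis are small elements of \<Gamma>, hence 0. Then \<delta> is central and its projection is
  0.\<close>

lemma lattice_dual_vector:
  assumes \<Gamma>: "cocompact_lattice \<Gamma>"
  obtains x1 x2 x3 :: real where "x1 \<noteq> 0"
    "\<And>\<gamma>. \<gamma> \<in> \<Gamma> \<Longrightarrow> \<exists>n::int. x1 * \<gamma> $ 1 + x2 * \<gamma> $ 2 + x3 * \<gamma> $ 3 = 2 * pi * n"
proof -
  have sub: "subgroup \<Gamma> nil_group" and disc: "discrete \<Gamma>" and cpt: "compact_space (nilmanifold \<Gamma>)"
    using \<Gamma> by (auto simp: cocompact_lattice_def)
  note G = subgroup_nil_groupD[OF sub]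
  define S where "S = proj3 ` \<Gamma>"
  have proj_mult: "proj3 (x \<star> y) = proj3 x + proj3 y" and proj_neg: "proj3 (- x) = - proj3 x"
    and proj_0: "proj3 0 = 0" for x y
    by (simp_all add: vec_eq_iff forall_3 proj3_nth nil_mult_eq lie_bracket_nth)
  have S: "0 \<in> S" "\<And>x y. x \<in> S \<Longrightarrow> y \<in> S \<Longrightarrow> x + y \<in> S" "\<And>x. x \<in> S \<Longrightarrow> - x \<in> S"
    unfolding S_def using G proj_0 proj_mult proj_neg by (auto simp: image_iff) metis+
  obtain R where R: "\<And>x. \<exists>\<gamma>\<in>\<Gamma>. norm (\<gamma> \<star> x) \<le> R"
    using compact_nilmanifold_bounded[OF sub cpt] by blast
  have spanS: "span S = UNIV"
  proof (rule span_of_coarsely_dense)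
    fix y :: "real^3"
    define x :: "real^7" where "x = (\<chi> i. if i = 1 then y $ 1 else if i = 2 then y $ 2 else if i = 3 then y $ 3 else 0)"
    have y: "proj3 x = y"
      by (simp add: vec_eq_iff forall_3 proj3_nth x_def)
    obtain \<gamma> where "\<gamma> \<in> \<Gamma>" "norm (\<gamma> \<star> x) \<le> R"
      using R by blast
    then have "norm (proj3 \<gamma> + y) \<le> R"
      using norm_proj3_le[of "\<gamma> \<star> x"] by (simp add: proj_mult y)
    then show "\<exists>s\<in>S. norm (s + y) \<le> R"
      using \<open>\<gamma> \<in> \<Gamma>\<close> by (auto simp: S_def)
  qed
  obtain B where B: "B \<subseteq> S" "independent B" "S \<subseteq> span B"
    using maximal_independent_subset by blast
  have spanB: "span B = UNIV"
    using spanS span_minimal[OF B(3)] by auto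
  have fin: "finite B"
    using B(2) independent_imp_finite by blast
  obtain \<epsilon>0 where \<epsilon>0: "\<epsilon>0 > 0" "\<And>\<gamma>. \<gamma> \<in> \<Gamma> \<Longrightarrow> norm \<gamma> < \<epsilon>0 \<Longrightarrow> \<gamma> = 0"
    using disc G(1) unfolding discrete_def isolated_in_dist_Ex_iff
    by (metis dist_0_norm)
  define M where "M = (\<Sum>b\<in>B. norm b)"
  have M: "norm b \<le> M" if "b \<in> B" for b
    unfolding M_def using that fin by (intro member_le_sum) auto
  have M0: "M \<ge> 0"
    unfolding M_def by (simp add: sum_nonneg)
  \<comment> \<open>The bracket of a lift of a basis vector with \<delta> then has norm at most 4 M
    \<epsilon>, which is less than \<epsilon>0; M + 1 keeps the denominator positive.\<close>
  define \<epsilon> where "\<epsilon> = \<epsilon>0 / (4 * (M + 1))"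
  have \<epsilon>: "\<epsilon> > 0"
    using \<epsilon>0(1) M0 by (simp add: \<epsilon>_def)
  have disc_S: "s = 0" if s: "s \<in> S" "norm s < \<epsilon>" for s
  proof -
    obtain \<delta> where \<delta>: "\<delta> \<in> \<Gamma>" "s = proj3 \<delta>"
      using s(1) by (auto simp: S_def)
    \<comment> \<open>Up to sign, these are the E6 and E7 components of the bracket of lifts of
      \<open>b\<close> and \<open>s\<close>. The map is linear in \<open>b\<close>, so vanishing on
      the basis \<open>B\<close> makes it vanish on the unit vectors, from which the coordinates of
      \<open>s\<close> are read off.\<close>
    define l where "l b = (\<chi> i::2. if i = 1 then b $ 1 * s $ 2 - b $ 2 * s $ 1 else b $ 1 * s $ 3 - b $ 3 * s $ 1)" for b :: "real^3"
    have l: "linear l"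
      by (rule linearI) (simp_all add: l_def vec_eq_iff algebra_simps)
    have "l b = 0" if b: "b \<in> B" for b
    proof -
      obtain \<gamma> where \<gamma>: "\<gamma> \<in> \<Gamma>" "b = proj3 \<gamma>"
        using B(1) b by (auto simp: S_def)
      have "norm (lie_bracket \<gamma> \<delta>) \<le> 4 * norm b * norm s"
        using norm_lie_bracket_le[of \<gamma> \<delta>] by (simp add: \<gamma> \<delta>)
      also have "\<dots> \<le> 4 * M * norm s"
        using M[OF b] by (intro mult_right_mono) auto
      also have "\<dots> \<le> 4 * M * \<epsilon>"
        using s(2) M0 by (intro mult_left_mono) auto
      also have "\<dots> < 4 * (M + 1) * \<epsilon>"
        using \<epsilon> by simp
      also have "\<dots> = \<epsilon>0"
        using M0 by (simp add: \<epsilon>_def)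
      finally have "lie_bracket \<gamma> \<delta> = 0"
        using \<epsilon>0(2) commutator_in_subgroup[OF sub \<gamma>(1) \<delta>(1)] by blast
      then have "lie_bracket \<gamma> \<delta> $ 6 = 0" "lie_bracket \<gamma> \<delta> $ 7 = 0"
        by simp_all
      then show ?thesis
        by (simp add: l_def vec_eq_iff \<gamma>(2) \<delta>(2) proj3_nth lie_bracket_nth)
    qed
    then have l0: "l b = 0" for b
      using linear_eq_0_on_span[OF l, of B b] spanB by simp
    have "s $ 2 = 0"
      using arg_cong[OF l0[of "axis 1 1"], of "\<lambda>v. v $ 1"] by (simp add: l_def axis_def)
    moreover have "s $ 3 = 0"
      using arg_cong[OF l0[of "axis 1 1"], of "\<lambda>v. v $ 2"] by (simp add: l_def axis_def)
    moreover have "s $ 1 = 0"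
      using arg_cong[OF l0[of "axis 2 1"], of "\<lambda>v. v $ 1"] by (simp add: l_def axis_def)
    ultimately show ?thesis
      by (simp add: vec_eq_iff forall_3)
  qed
  have z: "axis 1 1 \<noteq> (0 :: real^3)"
    by (simp add: axis_eq_0_iff)
  obtain \<xi> :: "real^3 \<Rightarrow> real" where \<xi>: "linear \<xi>" "\<And>s. s \<in> S \<Longrightarrow> \<xi> s \<in> \<int>" "\<xi> (axis 1 1) \<noteq> 0"
    by (rule discrete_subgroup_integral_functional[where S = S and \<epsilon> = \<epsilon> and z = "axis 1 1"])
      (use S \<epsilon> disc_S spanS z in blast)+
  show thesis
  proof (rule that)
    show "2 * pi * \<xi> (axis 1 1) \<noteq> 0"
      using \<xi>(3) by simp
    fix \<gamma> assume "\<gamma> \<in> \<Gamma>"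
    then obtain n :: int where n: "\<xi> (proj3 \<gamma>) = n"
      using \<xi>(2) by (auto simp: S_def elim: Ints_cases)
    have "proj3 \<gamma> = \<gamma> $ 1 *\<^sub>R axis 1 1 + \<gamma> $ 2 *\<^sub>R axis 2 1 + \<gamma> $ 3 *\<^sub>R axis 3 1"
      by (simp add: vec_eq_iff forall_3 proj3_nth axis_def)
    then have "\<xi> (proj3 \<gamma>) = \<gamma> $ 1 * \<xi> (axis 1 1) + \<gamma> $ 2 * \<xi> (axis 2 1) + \<gamma> $ 3 * \<xi> (axis 3 1)"
      by (simp add: linear_add[OF \<xi>(1)] linear_cmul[OF \<xi>(1)])
    then have "2 * pi * \<xi> (axis 1 1) * \<gamma> $ 1 + 2 * pi * \<xi> (axis 2 1) * \<gamma> $ 2 + 2 * pi * \<xi> (axis 3 1) * \<gamma> $ 3 = 2 * pi * n"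
      unfolding n[symmetric] by (simp add: algebra_simps)
    then show "\<exists>n::int. 2 * pi * \<xi> (axis 1 1) * \<gamma> $ 1 + 2 * pi * \<xi> (axis 2 1) * \<gamma> $ 2 + 2 * pi * \<xi> (axis 3 1) * \<gamma> $ 3 = 2 * pi * n"
      by blast
  qed
qed

section \<open>Construction of cocompact lattices\<close>

lemma compact_nilmanifoldI:
  assumes sub: "subgroup \<Gamma> nil_group" and K: "compact K" and cover: "\<And>x. \<exists>\<gamma>\<in>\<Gamma>. \<gamma> \<star> x \<in> K"
  shows "compact_space (nilmanifold \<Gamma>)"
  unfolding compact_space_alt
proof (intro allI impI)
  let ?c = "\<lambda>x. \<Gamma> #>\<^bsub>nil_group\<^esub> x"
  fix \<U> assume "(\<forall>U\<in>\<U>. openin (nilmanifold \<Gamma>) U) \<and> topspace (nilmanifold \<Gamma>) \<subseteq> \<Union>\<U>"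
  then have U: "\<forall>U\<in>\<U>. openin (nilmanifold \<Gamma>) U" "topspace (nilmanifold \<Gamma>) \<subseteq> \<Union>\<U>"
    by auto
  have "K \<subseteq> (\<Union>U\<in>\<U>. {x. ?c x \<in> U})"
    using U(2) unfolding topspace_nilmanifold rcosets_eq by blast
  moreover have "open {x. ?c x \<in> U}" if "U \<in> \<U>" for U
    using U(1) that openin_nilmanifold by blast
  ultimately obtain \<F> where \<F>: "\<F> \<subseteq> \<U>" "finite \<F>" "K \<subseteq> (\<Union>U\<in>\<F>. {x. ?c x \<in> U})"
    using compactE_image[OF K] by metis
  have "?c x \<in> \<Union>\<F>" for x
  proof -
    obtain \<gamma> where \<gamma>: "\<gamma> \<in> \<Gamma>" "\<gamma> \<star> x \<in> K"
      using cover by blast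
    then have "?c x = ?c (\<gamma> \<star> x)"
      unfolding r_coset_eq_iff[OF sub] by blast
    moreover obtain U where "U \<in> \<F>" "?c (\<gamma> \<star> x) \<in> U"
      using \<F>(3) \<gamma>(2) by blast
    ultimately show ?thesis by auto
  qed
  then show "\<exists>\<F>. finite \<F> \<and> \<F> \<subseteq> \<U> \<and> topspace (nilmanifold \<Gamma>) \<subseteq> \<Union>\<F>"
    using \<F>(1,2) unfolding topspace_nilmanifold rcosets_eq by blast
qed

text \<open>The factor 2 in the second and third coordinate compensates the \<open>1/2\<close> in front of the bracket.\<close>

lemma standard_lattice:
  fixes t :: real
  assumes t: "t > 0"
  obtains \<Gamma> where "cocompact_lattice \<Gamma>" "\<And>\<gamma>. \<gamma> \<in> \<Gamma> \<Longrightarrow> \<exists>m::int. \<gamma> $ 1 = t * m"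
proof -
  define st :: "7 \<Rightarrow> real" where "st i = (if i = 2 \<or> i = 3 then 2 else if i = 4 \<or> i = 5 then 1 else t)" for i
  have st: "st i > 0" "st i \<le> t + 2" "min 1 t \<le> st i" for i
    using t by (auto simp: st_def)
  define \<Gamma> where "\<Gamma> = {x :: real^7. \<forall>i. x $ i / st i \<in> \<int>}"
  have inv: "inv\<^bsub>nil_group\<^esub> x = - x" for x
  proof (rule group.inv_equality[OF group_nil_group])
    show "(- x) \<star> x = \<one>\<^bsub>nil_group\<^esub>"
      by (simp add: nil_group_def vec_eq_iff lie_bracket_nth)
  qed (simp_all add: nil_group_def)
  have sub: "subgroup \<Gamma> nil_group"
  proof (rule group.subgroupI[OF group_nil_group])
    show "\<Gamma> \<subseteq> carrier nil_group"
      by (simp add: nil_group_def)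
    have "0 \<in> \<Gamma>"
      by (simp add: \<Gamma>_def)
    then show "\<Gamma> \<noteq> {}"
      by blast
    show "inv\<^bsub>nil_group\<^esub> x \<in> \<Gamma>" if "x \<in> \<Gamma>" for x
      using that by (simp add: inv \<Gamma>_def)
    show "x \<star> y \<in> \<Gamma>" if "x \<in> \<Gamma>" "y \<in> \<Gamma>" for x y
    proof -
      have xy: "x $ i / st i \<in> \<int>" "y $ i / st i \<in> \<int>" for i
        using that by (auto simp: \<Gamma>_def)
      have "lie_bracket x y $ i / 2 / st i \<in> \<int>" for i
      proof -
        have "(x $ j / st j) * (y $ 1 / st 1) - (x $ 1 / st 1) * (y $ j / st j) \<in> \<int>" for j
          using xy by (intro Ints_diff Ints_mult)
        moreover have "lie_bracket x y $ 6 / 2 / st 6 = (x $ 2 / st 2) * (y $ 1 / st 1) - (x $ 1 / st 1) * (y $ 2 / st 2)"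
          "lie_bracket x y $ 7 / 2 / st 7 = (x $ 3 / st 3) * (y $ 1 / st 1) - (x $ 1 / st 1) * (y $ 3 / st 3)"
          using t by (simp_all add: lie_bracket_nth st_def field_simps)
        moreover have "lie_bracket x y $ i = 0" if "i \<noteq> 6" "i \<noteq> 7"
          using that by (simp add: lie_bracket_nth)
        ultimately show ?thesis
          by (cases "i = 6"; cases "i = 7") auto
      qed
      then have "x $ i / st i + y $ i / st i + lie_bracket x y $ i / 2 / st i \<in> \<int>" for i
        using xy by (intro Ints_add)
      then show ?thesis
        by (simp add: \<Gamma>_def nil_mult_eq add_divide_distrib)
    qed
  qed
  have "discrete \<Gamma>"
    unfolding discrete_def isolated_in_dist_Ex_iff
  proof (intro ballI conjI exI[of _ "min 1 t"] impI)
    show "0 < min 1 t"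
      using t by simp
    fix x y assume xy: "x \<in> \<Gamma>" "y \<in> \<Gamma>" "dist x y < min 1 t"
    have "y $ i = x $ i" for i
    proof -
      have "\<bar>x $ i - y $ i\<bar> < st i"
        using component_le_norm_cart[of "x - y" i] less_le_trans[OF xy(3) st(3)[of i]] by (simp add: dist_norm)
      then have "\<bar>x $ i / st i - y $ i / st i\<bar> < 1"
        using st(1)[of i] by (simp flip: diff_divide_distrib)
      moreover have "x $ i / st i - y $ i / st i \<in> \<int>"
        using xy by (auto simp: \<Gamma>_def)
      ultimately have "x $ i / st i - y $ i / st i = 0"
        using Ints_nonzero_abs_less1 by blast
      then show ?thesis
        using st(1)[of i] by (simp add: field_simps)
    qed
    then show "y = x"
      by (simp add: vec_eq_iff)
  qed
  moreover have "compact_space (nilmanifold \<Gamma>)"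
  proof (rule compact_nilmanifoldI[OF sub compact_cball])
    fix x :: "real^7"
    \<comment> \<open>The bracket with \<open>x\<close> depends only on the first three coordinates
      of the lattice element. Those are fixed by \<gamma>0, so the shift caused by the bracket is
      known before the central coordinates of \<gamma> are chosen.\<close>
    define \<gamma>0 :: "real^7" where "\<gamma>0 = (\<chi> i. - st i * \<lfloor>x $ i / st i\<rfloor>)"
    define c where "c i = x $ i + lie_bracket \<gamma>0 x $ i / 2" for i
    define \<gamma> :: "real^7" where "\<gamma> = (\<chi> i. - st i * \<lfloor>c i / st i\<rfloor>)"
    have "\<gamma> $ 1 = \<gamma>0 $ 1" "\<gamma> $ 2 = \<gamma>0 $ 2" "\<gamma> $ 3 = \<gamma>0 $ 3"
      by (simp_all add: \<gamma>_def \<gamma>0_def c_def lie_bracket_nth)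
    then have "lie_bracket \<gamma> x = lie_bracket \<gamma>0 x"
      by (simp add: vec_eq_iff lie_bracket_nth)
    then have "(\<gamma> \<star> x) $ i = st i * frac (c i / st i)" for i
      using st(1)[of i] by (simp add: nil_mult_eq \<gamma>_def c_def frac_def field_simps)
    moreover have "st i * frac (c i / st i) \<le> st i * 1" for i
      using st(1)[of i] frac_lt_1[of "c i / st i"] by (intro mult_left_mono) auto
    moreover have "0 \<le> st i * frac (c i / st i)" for i
      using st(1)[of i] frac_ge_0[of "c i / st i"] by simp
    ultimately have "\<bar>(\<gamma> \<star> x) $ i\<bar> \<le> t + 2" for i
      using order_trans[of "st i * frac (c i / st i)" "st i" "t + 2"] st(2)[of i] by simp
    then have "(\<Sum>i\<in>UNIV. \<bar>(\<gamma> \<star> x) $ i\<bar>) \<le> of_nat (card (UNIV :: 7 set)) * (t + 2)"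
      by (rule sum_bounded_above)
    then have "norm (\<gamma> \<star> x) \<le> 7 * (t + 2)"
      using norm_le_l1_cart[of "\<gamma> \<star> x"] by simp
    moreover have "\<gamma> \<in> \<Gamma>"
      using st(1) by (simp add: \<Gamma>_def \<gamma>_def less_imp_neq[symmetric])
    ultimately show "\<exists>\<gamma>\<in>\<Gamma>. \<gamma> \<star> x \<in> cball 0 (7 * (t + 2))"
      by auto
  qed
  ultimately have "cocompact_lattice \<Gamma>"
    using sub by (simp add: cocompact_lattice_def)
  moreover have "\<exists>m::int. \<gamma> $ 1 = t * m" if \<gamma>: "\<gamma> \<in> \<Gamma>" for \<gamma>
  proof -
    have "\<gamma> $ 1 / st 1 \<in> \<int>"
      using \<gamma> unfolding \<Gamma>_def by blast
    then obtain m :: int where "\<gamma> $ 1 / t = m"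
      by (auto simp: st_def elim: Ints_cases)
    then show ?thesis
      using t by (intro exI[of _ m]) (simp add: field_simps)
  qed
  ultimately show thesis by (rule that)
qed

theorem proposition2p4:
  fixes cl :: "real^7 \<Rightarrow> complex^8^8" and \<sigma> :: "complex^8 \<Rightarrow> complex^8"
  assumes "spinor_module cl \<sigma>"
  shows "(\<forall>\<Gamma>. cocompact_lattice \<Gamma> \<longrightarrow>
            (\<forall>a. a \<noteq> 0 \<longrightarrow> even_dimensional (harmonic_spinors cl a \<Gamma>)) \<and>
            (\<exists>a. a \<noteq> 0 \<and> (\<exists>\<psi>\<in>harmonic_spinors cl a \<Gamma>. \<psi> \<noteq> 0 \<and> \<not> invariant_spinor \<psi>))) \<and>
         (\<forall>a. a \<noteq> 0 \<longrightarrow>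
            (\<exists>\<Gamma>. cocompact_lattice \<Gamma> \<and>
              (\<exists>\<psi>\<in>harmonic_spinors cl a \<Gamma>. \<psi> \<noteq> 0 \<and> \<not> invariant_spinor \<psi>)))"
proof (intro conjI allI impI)
  interpret spin cl \<sigma>
    using assms by unfold_locales
  fix \<Gamma> assume \<Gamma>: "cocompact_lattice \<Gamma>"
  show "even_dimensional (harmonic_spinors cl a \<Gamma>)" if "a \<noteq> 0" for a
    using harmonic_even_dimensional[OF that \<Gamma>] .
  obtain x1 x2 x3 :: real where x: "x1 \<noteq> 0"
    "\<And>\<gamma>. \<gamma> \<in> \<Gamma> \<Longrightarrow> \<exists>n::int. x1 * \<gamma> $ 1 + x2 * \<gamma> $ 2 + x3 * \<gamma> $ 3 = 2 * pi * n"
    using lattice_dual_vector[OF \<Gamma>] by blast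
  define n where "n = x1\<^sup>2 + x2\<^sup>2 + x3\<^sup>2"
  \<comment> \<open>The singularity condition n = -(a/2) x1, solved for \<open>a\<close>.\<close>
  define a where "a = - 2 * n / x1"
  have "n > 0"
    using x(1) by (simp add: n_def add_pos_nonneg)
  then have "a \<noteq> 0" "n = 2 * (- a / 4) * x1"
    using x(1) by (simp_all add: a_def)
  then show "\<exists>a. a \<noteq> 0 \<and> (\<exists>\<psi>\<in>harmonic_spinors cl a \<Gamma>. \<psi> \<noteq> 0 \<and> \<not> invariant_spinor \<psi>)"
    using plane_wave_harmonic[of a x1 x2 x3 \<Gamma>] x unfolding n_def by blast
next
  interpret spin cl \<sigma>
    using assms by unfold_locales
  fix a :: real assume a: "a \<noteq> 0"
  \<comment> \<open>The covector (-a/2, 0, 0) solves the singularity condition, since both sides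
    equal a^2/4. The step 4 pi/|a| makes its values on the lattice multiples of 2 pi.\<close>
  obtain \<Gamma> where \<Gamma>: "cocompact_lattice \<Gamma>" "\<And>\<gamma>. \<gamma> \<in> \<Gamma> \<Longrightarrow> \<exists>m::int. \<gamma> $ 1 = (4 * pi / \<bar>a\<bar>) * m"
    using standard_lattice[of "4 * pi / \<bar>a\<bar>"] a by auto
  have "\<exists>n::int. (- a / 2) * \<gamma> $ 1 + 0 * \<gamma> $ 2 + 0 * \<gamma> $ 3 = 2 * pi * n" if \<gamma>: "\<gamma> \<in> \<Gamma>" for \<gamma>
  proof -
    obtain m :: int where "\<gamma> $ 1 = (4 * pi / \<bar>a\<bar>) * m"
      using \<Gamma>(2)[OF \<gamma>] by blast
    then show ?thesis
      using a by (intro exI[of _ "if a > 0 then - m else m"]) (auto simp: field_simps)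
  qed
  then show "\<exists>\<Gamma>. cocompact_lattice \<Gamma> \<and> (\<exists>\<psi>\<in>harmonic_spinors cl a \<Gamma>. \<psi> \<noteq> 0 \<and> \<not> invariant_spinor \<psi>)"
    using plane_wave_harmonic[OF a, of "- a / 2" 0 0 \<Gamma>] a \<Gamma>(1) by (auto simp: power2_eq_square)
qed

end
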